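(* Let $(\bar A,\bar B)$ be a structural pair, where $\bar A\in\{0,\star\}^{n\times n}$ is symmetrically structured and $\bar B\in\{0,\star\}^{n\times m}$ is structured. Then: (1) If $(\bar A,\bar B)$ is irreducible, then $\textrm{m-dim}(\bar A,\bar B)$, the maximum dimension of the stabilizable subspace of $(\bar A,\bar B)$, equals the generic dimension of the controllable subspace of $(\bar A,\bar B)$. (2) If $(\bar A,\bar B)$ is reducible, permute it into the form $$P\bar A P^\top=\begin{bmatrix}\bar A_{11}&\mathbf 0\\ \mathbf 0&\bar A_{22}\end{bmatrix},\qquad P\bar B=\begin{bmatrix}\bar B_1\\ \mathbf 0\end{bmatrix},$$ with $P$ a permutation matrix, $\bar A_{11}\in\{0,\star\}^{p\times p}$, $\bar B_1\in\{0,\star\}^{p\times m}$, $\bar A_{22}\in\{0,\star\}^{(n-p)\times(n-p)}$, where the indices of $\bar A_{11}$ correspond to the input-reachable state vertices and those of $\bar A_{22}$ to the input-unreachable state vertices of $\mathcal D(\bar A,\bar B)$. Let $\{\mathcal C_i\}_{i=1}^k$ be any set of (vertex-)disjoint cycles in $\mathcal D(\bar A_{22})$, let $\mathcal S_e$ be the set of indices $i$ for which $\mathcal C_i$ has even length and $\mathcal S_o$ the set of indices $i$ for which $\mathcal C_i$ has odd length. Then $$\textrm{m-dim}(\bar A,\bar B)\ \ge\ \textrm{t-rank}([\bar A_{11},\bar B_1])+\frac12\sum_{i\in\mathcal S_e}|\mathcal C_i|+\frac12\sum_{i\in\mathcal S_o}\left(|\mathcal C_i|+1\right).$$ Moreover,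 $$\textrm{m-dim}(\bar A,\bar B)\ \le\ \textrm{t-rank}([\bar A_{11},\bar B_1])+(n-p)-|\mathcal S|,$$ where $\mathcal S$ is a maximal independence set in $\mathcal D(\bar A_{22})$.
   Context: A structured matrix $\bar M\in\{0,\star\}^{n\times m}$ is a matrix each of whose entries is either a fixed zero or an independent free real parameter $\star$. A matrix in $\{0,\star\}^{n\times n}$ is symmetrically structured if its pattern is symmetric and the free parameters at positions $(i,j)$ and $(j,i)$ are constrained to be equal. A numerical realization $\tilde M$ assigns real numbers to the $\star$-parameters; $\mathbf p_{\tilde M}\in\mathbb R^{n_{\bar M}}$ is the vector of values of the $n_{\bar M}$ independent parameters. For real $(A,B)$, the stabilizable subspace of $\dot x=Ax+Bu$ is the subspace of all initial states $x(0)\in\mathbb R^n$ for which there is a control input $u(t)\in\mathbb R^m$, $t\ge0$, with $\lim_{t\to\infty}x(t)=\mathbf 0$. $\textrm{m-dim}(\bar A,\bar B)$ is the maximum, over all numerical realizations $(\tilde A,\tilde B)$ of $(\bar A,\bar B)$, of the dimension of the stabilizable subspace of $(\tilde A,\tilde B)$. A variety in $\mathbb R^N$ is the common zero set of finitely many polynomials; it is proper if it is not all of $\mathbb R^N$. The generic dimension of the controllable subspace of $(\bar A,\bar B)$ is the integer $d_c$ for which there is a proper variety $V\subset\mathbb R^{n_{\bar A}+n_{\bar B}}$ such that $\operatorname{rank}[\tilde B,\tilde A\tilde B,\dots,\tilde A^{n-1}\tilde B]=d_c$ for every realization with $[\mathbf p_{\tilde A},\mathbf p_{\tilde B}]\notin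 V$. The term rank $\textrm{t-rank}(\bar M)$ is the largest $k$ such that there are distinct rows $i_1,\dots,i_k$ and distinct columns $j_1,\dots,j_k$ with $[\bar M]_{i_\ell j_\ell}=\star$ for all $\ell$. $[\bar A_{11},\bar B_1]$ denotes concatenation. $(\bar A,\bar B)$ is reducible if there is a permutation matrix $P$ bringing it to the displayed block form for some $0\le p<n$; it is irreducible otherwise. The digraph $\mathcal D(\bar A,\bar B)$ has state vertices $x_1,\dots,x_n$, input vertices $u_1,\dots,u_m$, and edges $(x_j,x_i)$ whenever $[\bar A]_{ij}=\star$ and $(u_j,x_i)$ whenever $[\bar B]_{ij}=\star$. A state vertex is input-reachable if there is a directed path to it from some input vertex. $\mathcal D(\bar A_{22})$ is the digraph on the state vertices indexing $\bar A_{22}$, with an edge $(x_j,x_i)$ for each $\star$-entry of $\bar A_{22}$ in the position of row $x_i$ and column $x_j$. Cycles are directed cycles: self-loops are cycles of length $1$, and a pair of opposite edges $(x_i,x_j),(x_j,x_i)$ with $i\neq j$ is a cycle of length $2$; $|\mathcal C_i|$ is the number of distinct vertices in $\mathcal C_i$. An independence set is a set $\mathcal S$ of vertices such that there is no edge between $x_i$ and $x_j$ for all $x_i,x_j\in\mathcal S$ (including $i=j$, so no vertex of $\mathcal S$ has a self-loop); it is called maximal if its number of vertices is the largest over all independence sets. *)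

theory Defs
  imports
    Complex_Main
    "HOL-Library.FuncSet"
    "HOL-Combinatorics.Permutations"
    "Jordan_Normal_Form.DL_Rank"
    "Graph_Theory.Pair_Digraph"
begin

section \<open>Structured matrices and their realizations\<close>

datatype entry = Fixed_Zero | Star

text \<open>The instance makes \<open>0\<^sub>m\<close>, \<open>four_block_mat\<close> and \<open>@\<^sub>r\<close> available for patterns.\<close>

instantiation entry :: zero
begin
definition zero_entry :: entry where "0 = Fixed_Zero"
instance ..
end

type_synonym pattern = "entry mat"

definition sym_structured :: "nat \<Rightarrow> pattern \<Rightarrow> bool" where
  "sym_structured n A \<longleftrightarrow> A \<in> carrier_mat n n \<and> transpose_mat A = A"

text \<open>
  A free parameter is named by its position; in the symmetric case the positions \<open>(i, j)\<close> and
  \<open>(j, i)\<close> share one parameter, named by the position with \<open>i \<le> j\<close>.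
\<close>

definition sym_params :: "pattern \<Rightarrow> (nat \<times> nat) set" where
  "sym_params A = {(i, j). i \<le> j \<and> j < dim_row A \<and> A $$ (i, j) = Star}"

definition struct_params :: "pattern \<Rightarrow> (nat \<times> nat) set" where
  "struct_params B = {(i, j). i < dim_row B \<and> j < dim_col B \<and> B $$ (i, j) = Star}"

definition sym_realization :: "pattern \<Rightarrow> (nat \<times> nat \<Rightarrow> real) \<Rightarrow> real mat" where
  "sym_realization A a = mat (dim_row A) (dim_col A)
     (\<lambda>(i, j). if A $$ (i, j) = Star then a (min i j, max i j) else 0)"

definition struct_realization :: "pattern \<Rightarrow> (nat \<times> nat \<Rightarrow> real) \<Rightarrow> real mat" where
  "struct_realization B b = mat (dim_row B) (dim_col B)
     (\<lambda>(i, j). if B $$ (i, j) = Star then b (i, j) else 0)"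

type_synonym param = "nat \<times> nat + nat \<times> nat"

definition pair_params :: "pattern \<Rightarrow> pattern \<Rightarrow> param set" where
  "pair_params A B = sym_params A <+> struct_params B"

text \<open>\<open>\<real>\<^sup>N\<close> with coordinates named by a finite set \<open>I\<close> of cardinality \<open>N\<close>.\<close>

definition coord_space :: "'v set \<Rightarrow> ('v \<Rightarrow> real) set" where
  "coord_space I = I \<rightarrow>\<^sub>E UNIV"

definition realize_A :: "pattern \<Rightarrow> (param \<Rightarrow> real) \<Rightarrow> real mat" where
  "realize_A A \<theta> = sym_realization A (\<theta> \<circ> Inl)"

definition realize_B :: "pattern \<Rightarrow> (param \<Rightarrow> real) \<Rightarrow> real mat" where
  "realize_B B \<theta> = struct_realization B (\<theta> \<circ> Inr)"


section \<open>Stabilizable subspace\<close>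

text \<open>
  The input is an arbitrary function of time; \<open>x\<close> is a classical solution on \<open>[0, \<infinity>)\<close>, with a
  one-sided derivative at \<open>0\<close>. The derivative and the limit are taken componentwise.
\<close>

definition trajectory ::
  "real mat \<Rightarrow> real mat \<Rightarrow> (real \<Rightarrow> real vec) \<Rightarrow> (real \<Rightarrow> real vec) \<Rightarrow> bool" where
  "trajectory A B u x \<longleftrightarrow>
     (\<forall>t\<ge>0. x t \<in> carrier_vec (dim_row A) \<and> u t \<in> carrier_vec (dim_col B) \<and>
       (\<forall>i<dim_row A. ((\<lambda>s. x s $ i) has_real_derivative (A *\<^sub>v x t + B *\<^sub>v u t) $ i)
                         (at t within {0..})))"

definition stabilizable_subspace :: "real mat \<Rightarrow> real mat \<Rightarrow> real vec set" where
  "stabilizable_subspace A B =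
     {x0. \<exists>u x. trajectory A B u x \<and> x 0 = x0 \<and>
            (\<forall>i<dim_row A. ((\<lambda>t. x t $ i) \<longlongrightarrow> 0) at_top)}"

definition subspace_dim :: "nat \<Rightarrow> real vec set \<Rightarrow> nat" where
  "subspace_dim n W = vectorspace.dim class_ring ((module_vec TYPE(real) n)\<lparr>carrier := W\<rparr>)"

definition m_dim :: "pattern \<Rightarrow> pattern \<Rightarrow> nat" where
  "m_dim A B = Max {subspace_dim (dim_row A)
                      (stabilizable_subspace (realize_A A \<theta>) (realize_B B \<theta>)) | \<theta>.
                    \<theta> \<in> coord_space (pair_params A B)}"


section \<open>Generic dimension of the controllable subspace\<close>

inductive polynomial_in :: "'v set \<Rightarrow> (('v \<Rightarrow> real) \<Rightarrow> real) \<Rightarrow> bool" for I where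
  const: "polynomial_in I (\<lambda>\<theta>. c)"
| coord: "v \<in> I \<Longrightarrow> polynomial_in I (\<lambda>\<theta>. \<theta> v)"
| add: "polynomial_in I f \<Longrightarrow> polynomial_in I g \<Longrightarrow> polynomial_in I (\<lambda>\<theta>. f \<theta> + g \<theta>)"
| mult: "polynomial_in I f \<Longrightarrow> polynomial_in I g \<Longrightarrow> polynomial_in I (\<lambda>\<theta>. f \<theta> * g \<theta>)"

definition variety :: "'v set \<Rightarrow> ('v \<Rightarrow> real) set \<Rightarrow> bool" where
  "variety I V \<longleftrightarrow> (\<exists>F. finite F \<and> (\<forall>f\<in>F. polynomial_in I f) \<and>
     V = {\<theta> \<in> coord_space I. \<forall>f\<in>F. f \<theta> = 0})"

definition proper_variety :: "'v set \<Rightarrow> ('v \<Rightarrow> real) set \<Rightarrow> bool" where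
  "proper_variety I V \<longleftrightarrow> variety I V \<and> V \<noteq> coord_space I"

text \<open>The matrix \<open>[B, A B, \<dots>, A\<^sup>n\<^sup>-\<^sup>1 B]\<close>.\<close>

definition controllability_mat :: "real mat \<Rightarrow> real mat \<Rightarrow> real mat" where
  "controllability_mat A B =
     mat_of_cols (dim_row A) (concat (map (\<lambda>k. cols (A ^\<^sub>m k * B)) [0..<dim_row A]))"

definition generic_controllable_dim :: "pattern \<Rightarrow> pattern \<Rightarrow> nat" where
  "generic_controllable_dim A B =
     (THE d. \<exists>V. proper_variety (pair_params A B) V \<and>
        (\<forall>\<theta> \<in> coord_space (pair_params A B) - V.
           vec_space.rank (dim_row A) (controllability_mat (realize_A A \<theta>) (realize_B B \<theta>)) = d))"


section \<open>Term rank\<close>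

definition t_rank :: "pattern \<Rightarrow> nat" where
  "t_rank M = Max {k. \<exists>r c. inj_on r {..<k} \<and> inj_on c {..<k} \<and>
     (\<forall>l<k. r l < dim_row M \<and> c l < dim_col M \<and> M $$ (r l, c l) = Star)}"

definition append_cols :: "pattern \<Rightarrow> pattern \<Rightarrow> pattern" where
  "append_cols A B = four_block_mat A B (0\<^sub>m 0 (dim_col A)) (0\<^sub>m 0 (dim_col B))"


section \<open>Reducibility\<close>

text \<open>
  A permutation \<open>\<pi>\<close> of \<open>{..<n}\<close> stands for the permutation matrix \<open>P\<close> with \<open>P\<^sub>i\<^sub>j = 1\<close> iff
  \<open>j = \<pi> i\<close>, so \<open>(P M)\<^sub>i\<^sub>j = M (\<pi> i, j)\<close> and \<open>(P M P\<^sup>T)\<^sub>i\<^sub>j = M (\<pi> i, \<pi> j)\<close>.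
\<close>

definition perm_rows :: "(nat \<Rightarrow> nat) \<Rightarrow> pattern \<Rightarrow> pattern" where
  "perm_rows \<pi> M = mat (dim_row M) (dim_col M) (\<lambda>(i, j). M $$ (\<pi> i, j))"

definition perm_conj :: "(nat \<Rightarrow> nat) \<Rightarrow> pattern \<Rightarrow> pattern" where
  "perm_conj \<pi> M = mat (dim_row M) (dim_col M) (\<lambda>(i, j). M $$ (\<pi> i, \<pi> j))"

definition block_form ::
  "nat \<Rightarrow> nat \<Rightarrow> nat \<Rightarrow> (nat \<Rightarrow> nat) \<Rightarrow> pattern \<Rightarrow> pattern \<Rightarrow> pattern \<Rightarrow> pattern \<Rightarrow> pattern \<Rightarrow> bool"
where
  "block_form n m p \<pi> A B A11 A22 B1 \<longleftrightarrow>
     p < n \<and> \<pi> permutes {..<n} \<and>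
     A11 \<in> carrier_mat p p \<and> A22 \<in> carrier_mat (n - p) (n - p) \<and> B1 \<in> carrier_mat p m \<and>
     perm_conj \<pi> A = four_block_mat A11 (0\<^sub>m p (n - p)) (0\<^sub>m (n - p) p) A22 \<and>
     perm_rows \<pi> B = B1 @\<^sub>r 0\<^sub>m (n - p) m"

definition reducible :: "nat \<Rightarrow> nat \<Rightarrow> pattern \<Rightarrow> pattern \<Rightarrow> bool" where
  "reducible n m A B \<longleftrightarrow> (\<exists>p \<pi> A11 A22 B1. block_form n m p \<pi> A B A11 A22 B1)"


section \<open>Digraphs\<close>

datatype vertex = State nat | Input nat

definition pair_digraph :: "pattern \<Rightarrow> pattern \<Rightarrow> vertex pair_pre_digraph" where
  "pair_digraph A B =
     \<lparr> pverts = State ` {..<dim_row A} \<union> Input ` {..<dim_col B},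
       parcs = {(State j, State i) | i j. i < dim_row A \<and> j < dim_col A \<and> A $$ (i, j) = Star} \<union>
               {(Input j, State i) | i j. i < dim_row B \<and> j < dim_col B \<and> B $$ (i, j) = Star} \<rparr>"

definition input_reachable :: "pattern \<Rightarrow> pattern \<Rightarrow> nat \<Rightarrow> bool" where
  "input_reachable A B i \<longleftrightarrow>
     (\<exists>j<dim_col B. reachable (with_proj (pair_digraph A B)) (Input j) (State i))"

text \<open>In a diagonal block of a permuted matrix, the vertices are the indices within the block.\<close>

definition mat_digraph :: "pattern \<Rightarrow> nat pair_pre_digraph" where
  "mat_digraph A =
     \<lparr> pverts = {..<dim_row A},
       parcs = {(j, i) | i j. i < dim_row A \<and> j < dim_col A \<and> A $$ (i, j) = Star} \<rparr>"

text \<open>A cycle is given by its list of arcs, so its vertices are the tails of these arcs.\<close>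

definition cycle_verts :: "(nat \<times> nat) awalk \<Rightarrow> nat set" where
  "cycle_verts c = fst ` set c"

definition disjoint_cycles :: "nat pair_pre_digraph \<Rightarrow> nat \<Rightarrow> (nat \<Rightarrow> (nat \<times> nat) awalk) \<Rightarrow> bool"
where
  "disjoint_cycles G k C \<longleftrightarrow>
     (\<forall>i\<in>{1..k}. pre_digraph.cycle (with_proj G) (C i)) \<and>
     (\<forall>i\<in>{1..k}. \<forall>j\<in>{1..k}. i \<noteq> j \<longrightarrow> cycle_verts (C i) \<inter> cycle_verts (C j) = {})"

definition independence_set :: "nat pair_pre_digraph \<Rightarrow> nat set \<Rightarrow> bool" where
  "independence_set G S \<longleftrightarrow> S \<subseteq> pverts G \<and> (\<forall>x\<in>S. \<forall>y\<in>S. (x, y) \<notin> parcs G)"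

text \<open>Maximal refers to the number of vertices, not to inclusion.\<close>

definition maximal_independence_set :: "nat pair_pre_digraph \<Rightarrow> nat set \<Rightarrow> bool" where
  "maximal_independence_set G S \<longleftrightarrow>
     independence_set G S \<and> (\<forall>T. independence_set G T \<longrightarrow> card T \<le> card S)"

end

theory Submission
  imports Defs "HOL-Library.Infinite_Set" "HOL-Computational_Algebra.Polynomial"
begin

text \<open>Let \<open>W\<close> be the stabilizable subspace of a realization. A vector orthogonal to \<open>W\<close> is orthogonal
  to all eigenvectors of \<open>A\<close> with negative eigenvalue and to all \<open>A\<^sup>k B\<close>, so the form of \<open>A\<close> is
  nonnegative on the orthogonal complement of \<open>W\<close>. Conversely, on the uncontrolled block the form of
  \<open>A\<close> increases along trajectories.

  Upper bound: \<open>W\<close> meets the coordinate subspace of an independence set trivially, because \<open>A\<close> has no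
  entries there, and \<open>W\<close> is orthogonal to the left kernel of \<open>[A, B]\<close>; the rank of a structured
  matrix is at most its term rank.

  Lower bound: since the pattern is symmetric, a maximum matching of the reachable rows splits into single
  edges from inputs to states and disjoint cycles. Start from the single edges and attach the
  cycles and the remaining states one at a time by an edge, giving a cycle a very large weight and a
  remaining state a very small one. By compactness the vectors that are orthogonal to the
  controllable subspace and vanish on the remaining states are zero throughout, so the
  controllable subspace has at least the dimension of the matching. On the unreachable block each
  given cycle gets a realization that is negative definite on a subspace of dimension half its length,
  rounded up.\<close>

section \<open>Linear algebra over finite index sets\<close>

text \<open>Since \<open>A\<close> is symmetric, \<open>z\<close> is orthogonal to all columns of
  all \<open>A^k B\<close> exactly when \<open>z\<close> is unobservable through the transpose of
  \<open>B\<close>. Controllability is therefore treated as observability on one undirected graph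
  whose vertices are the states and the inputs. The obstacle is that the entries above and below the
  diagonal cannot be varied independently: a component attached by an edge also feeds back into what
  is already there. The two extreme weights separate the scales. A cycle is observable from its
  entry vertex on its own, and a large weight lets this dominate the feedback. A remaining state is
  set to zero in advance, and a small weight makes it a mere perturbation that still serves as a
  stepping stone to the states behind it. Weights on the reachable part are nonnegative so that
  contributions of different paths never cancel. For an irreducible pair both dimensions come out as
  the largest number of matched rows of \<open>[A, B]\<close>, which is why they agree.\<close>

lemma homogeneous_system_nontrivial:
  fixes M :: "'i \<Rightarrow> 'j \<Rightarrow> 'a :: field"
  assumes "finite I" "finite J" "card I < card J"
  shows "\<exists>c. (\<exists>j\<in>J. c j \<noteq> 0) \<and> (\<forall>i\<in>I. (\<Sum>j\<in>J. M i j * c j) = 0)"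
  using assms
proof (induction I arbitrary: J M rule: finite_induct)
  case empty
  then obtain j where "j \<in> J" by (metis card_gt_0_iff card.empty ex_in_conv)
  then show ?case by (intro exI[of _ "\<lambda>_. 1"]) auto
next
  case (insert i I)
  show ?case
  proof (cases "\<forall>j\<in>J. M i j = 0")
    case True
    obtain c where "\<exists>j\<in>J. c j \<noteq> 0" "\<forall>i\<in>I. (\<Sum>j\<in>J. M i j * c j) = 0"
      using insert.IH[of J M] insert.prems insert.hyps by auto
    with True show ?thesis by (intro exI[of _ c]) auto
  next
    case False
    then obtain j0 where j0: "j0 \<in> J" "M i j0 \<noteq> 0" by blast
    define J' where "J' = J - {j0}"
    have J': "finite J'" "j0 \<notin> J'" "J = insert j0 J'"
      using insert.prems j0 by (auto simp: J'_def)
    have "card I < card J'"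
      using insert.prems insert.hyps J' by auto
    then obtain c where c: "\<exists>j\<in>J'. c j \<noteq> 0"
      "\<forall>k\<in>I. (\<Sum>j\<in>J'. (M k j - M k j0 * M i j / M i j0) * c j) = 0"
      using insert.IH[of J' "\<lambda>k j. M k j - M k j0 * M i j / M i j0"] J' by blast
    \<comment> \<open>Row \<open>i\<close> is solved for the pivot variable \<open>j0\<close>;
      \<open>c\<close> solves the system that remains after eliminating it.\<close>
    define d where "d = c(j0 := - (\<Sum>j\<in>J'. M i j * c j) / M i j0)"
    have dJ: "(\<Sum>j\<in>J. M k j * d j) =
        (\<Sum>j\<in>J'. M k j * c j) - M k j0 * (\<Sum>j\<in>J'. M i j * c j) / M i j0" for k
    proof -
      have "(\<Sum>j\<in>J'. M k j * d j) = (\<Sum>j\<in>J'. M k j * c j)"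
        using J' by (intro sum.cong) (auto simp: d_def)
      then show ?thesis using J' by (simp add: d_def)
    qed
    have "(\<Sum>j\<in>J. M k j * d j) = 0" if "k \<in> I" for k
    proof -
      have "0 = (\<Sum>j\<in>J'. (M k j - M k j0 * M i j / M i j0) * c j)"
        using c(2) that by simp
      also have "\<dots> = (\<Sum>j\<in>J'. M k j * c j - M k j0 / M i j0 * (M i j * c j))"
        by (intro sum.cong) (auto simp: algebra_simps)
      also have "\<dots> = (\<Sum>j\<in>J. M k j * d j)"
        by (simp add: dJ sum_subtractf sum_distrib_left sum_divide_distrib)
      finally show ?thesis by simp
    qed
    moreover have "(\<Sum>j\<in>J. M i j * d j) = 0" using j0 by (simp add: dJ)
    moreover have "\<exists>j\<in>J. d j \<noteq> 0" using c(1) J' by (auto simp: d_def)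
    ultimately show ?thesis by (intro exI[of _ d]) auto
  qed
qed

text \<open>Linear independence of the columns, phrased as a trivial kernel. Rows and columns are
  named by arbitrary types because sums of types, such as basis vectors together with coordinates,
  serve as index sets below.\<close>

definition inj_matrix :: "'i set \<Rightarrow> 'j set \<Rightarrow> ('i \<Rightarrow> 'j \<Rightarrow> 'a :: field) \<Rightarrow> bool" where
  "inj_matrix I J M \<longleftrightarrow>
     (\<forall>c. (\<forall>i\<in>I. (\<Sum>j\<in>J. M i j * c j) = 0) \<longrightarrow> (\<forall>j\<in>J. c j = 0))"

lemma inj_matrixI:
  assumes "\<And>c j. (\<And>i. i \<in> I \<Longrightarrow> (\<Sum>j\<in>J. M i j * c j) = 0) \<Longrightarrow> j \<in> J \<Longrightarrow> c j = 0"
  shows "inj_matrix I J M"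
  using assms unfolding inj_matrix_def by blast

lemma inj_matrixD:
  assumes "inj_matrix I J M" "\<And>i. i \<in> I \<Longrightarrow> (\<Sum>j\<in>J. M i j * c j) = 0" "j \<in> J"
  shows "c j = 0"
  using assms unfolding inj_matrix_def by blast

lemma inj_matrix_card_le:
  assumes "inj_matrix I J M" "finite I" "finite J"
  shows "card J \<le> card I"
proof (rule ccontr)
  assume "\<not> card J \<le> card I"
  then obtain c where "\<exists>j\<in>J. c j \<noteq> 0" "\<forall>i\<in>I. (\<Sum>j\<in>J. M i j * c j) = 0"
    using assms homogeneous_system_nontrivial[of I J M] by auto
  with assms(1) show False unfolding inj_matrix_def by blast
qed

text \<open>A minimal set of rows that keeps the kernel trivial is square. By minimality each of its
  rows is the only one that does not annihilate a certain vector \<open>c i\<close>; these vectors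
  are independent, so there are at most \<open>card J\<close> of them.\<close>

lemma inj_matrix_square_rows:
  fixes M :: "'i \<Rightarrow> 'j \<Rightarrow> 'a :: field"
  assumes "inj_matrix I J M" "finite I" "finite J"
  shows "\<exists>I'\<subseteq>I. card I' = card J \<and> inj_matrix I' J M"
proof -
  define P where "P I' \<longleftrightarrow> I' \<subseteq> I \<and> inj_matrix I' J M" for I'
  obtain I' where I': "P I'" and min: "\<And>K. P K \<Longrightarrow> card I' \<le> card K"
    using exists_least_iff[of "\<lambda>k. \<exists>K. P K \<and> card K = k"] assms P_def
    by (metis order_refl not_le)
  have fin: "finite I'" using I' assms finite_subset P_def by blast
  have "\<exists>c. (\<forall>k\<in>I' - {i}. (\<Sum>j\<in>J. M k j * c j) = 0) \<and> (\<Sum>j\<in>J. M i j * c j) \<noteq> 0"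
    if "i \<in> I'" for i
  proof -
    have "\<not> inj_matrix (I' - {i}) J M"
      using min[of "I' - {i}"] I' card_Diff1_less[OF fin that] by (auto simp: P_def)
    then obtain c j where c: "\<forall>k\<in>I' - {i}. (\<Sum>j\<in>J. M k j * c j) = 0" "j \<in> J" "c j \<noteq> 0"
      unfolding inj_matrix_def by blast
    then have "(\<Sum>j\<in>J. M i j * c j) \<noteq> 0"
      using I' unfolding P_def inj_matrix_def by (metis DiffI singletonD)
    with c show ?thesis by blast
  qed
  then obtain c where c0: "\<And>i k. i \<in> I' \<Longrightarrow> k \<in> I' - {i} \<Longrightarrow> (\<Sum>j\<in>J. M k j * c i j) = 0"
    and c1: "\<And>i. i \<in> I' \<Longrightarrow> (\<Sum>j\<in>J. M i j * c i j) \<noteq> 0" by metis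
  have "card I' \<le> card J"
  proof (rule ccontr)
    assume "\<not> card I' \<le> card J"
    then obtain d i where i: "i \<in> I'" "d i \<noteq> 0"
      and d: "\<forall>j\<in>J. (\<Sum>i\<in>I'. c i j * d i) = 0"
      using homogeneous_system_nontrivial[of J I' "\<lambda>j i. c i j"] assms fin by auto
    have "0 = (\<Sum>j\<in>J. M i j * (\<Sum>l\<in>I'. c l j * d l))" using d by simp
    also have "\<dots> = (\<Sum>l\<in>I'. (\<Sum>j\<in>J. M i j * c l j) * d l)"
      unfolding sum_distrib_left sum_distrib_right mult.assoc by (rule sum.swap)
    also have "\<dots> = (\<Sum>l\<in>I'. if l = i then (\<Sum>j\<in>J. M i j * c i j) * d i else 0)"
      using c0[of _ i] i by (intro sum.cong) auto
    also have "\<dots> = (\<Sum>j\<in>J. M i j * c i j) * d i" using i fin by simp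
    finally show False using c1 i by simp
  qed
  moreover have "card J \<le> card I'" using inj_matrix_card_le I' fin assms P_def by blast
  ultimately show ?thesis using I' P_def by auto
qed

text \<open>Turns a trivial kernel into the nonvanishing of a polynomial in the entries. This gives
  access to transposition, to the Leibniz expansion and, later, to the polynomial behind the generic
  dimension.\<close>

lemma inj_matrix_iff_det:
  fixes M :: "'i \<Rightarrow> 'j \<Rightarrow> 'a :: field"
  assumes e: "bij_betw e {..<k} I" and g: "bij_betw g {..<k} J"
  shows "inj_matrix I J M \<longleftrightarrow> det (mat k k (\<lambda>(a, b). M (e a) (g b))) \<noteq> 0"
proof -
  let ?D = "mat k k (\<lambda>(a, b). M (e a) (g b))"
  have D: "?D \<in> carrier_mat k k" by simp
  have mv: "(?D *\<^sub>v v) $ a = (\<Sum>j\<in>J. M (e a) j * c j)"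
    if "a < k" "v \<in> carrier_vec k" "\<forall>b<k. v $ b = c (g b)" for a v c
  proof -
    have "(?D *\<^sub>v v) $ a = (\<Sum>b<k. M (e a) (g b) * c (g b))"
      using that by (auto simp: scalar_prod_def atLeast0LessThan intro!: sum.cong)
    also have "\<dots> = (\<Sum>j\<in>J. M (e a) j * c j)"
      by (rule sum.reindex_bij_betw[OF g])
    finally show ?thesis .
  qed
  have "\<not> inj_matrix I J M \<longleftrightarrow> (\<exists>v. v \<in> carrier_vec k \<and> v \<noteq> 0\<^sub>v k \<and> ?D *\<^sub>v v = 0\<^sub>v k)"
  proof
    assume "\<not> inj_matrix I J M"
    then obtain c j where c: "\<forall>i\<in>I. (\<Sum>j\<in>J. M i j * c j) = 0" "j \<in> J" "c j \<noteq> 0"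
      unfolding inj_matrix_def by blast
    obtain b where b: "b < k" "j = g b" using c(2) g by (auto simp: bij_betw_def)
    let ?v = "vec k (\<lambda>b. c (g b))"
    have "?v \<noteq> 0\<^sub>v k" using b c(3) by (metis index_vec index_zero_vec(1))
    moreover have "?D *\<^sub>v ?v = 0\<^sub>v k"
    proof (rule eq_vecI)
      fix a assume a: "a < dim_vec (0\<^sub>v k)"
      then have "e a \<in> I" using e by (auto simp: bij_betw_def)
      then show "(?D *\<^sub>v ?v) $ a = 0\<^sub>v k $ a" using mv[of a ?v c] a c(1) by simp
    qed simp
    ultimately show "\<exists>v. v \<in> carrier_vec k \<and> v \<noteq> 0\<^sub>v k \<and> ?D *\<^sub>v v = 0\<^sub>v k"
      using vec_carrier by blast
  next
    assume "\<exists>v. v \<in> carrier_vec k \<and> v \<noteq> 0\<^sub>v k \<and> ?D *\<^sub>v v = 0\<^sub>v k"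
    then obtain v where v: "v \<in> carrier_vec k" "v \<noteq> 0\<^sub>v k" "?D *\<^sub>v v = 0\<^sub>v k" by blast
    define c where "c j = v $ (the_inv_into {..<k} g j)" for j
    have cg: "\<forall>b<k. v $ b = c (g b)" using g by (auto simp: c_def bij_betw_def the_inv_into_f_f)
    have "\<forall>i\<in>I. (\<Sum>j\<in>J. M i j * c j) = 0"
    proof
      fix i assume "i \<in> I"
      then obtain a where a: "a < k" "i = e a" using e by (auto simp: bij_betw_def)
      then show "(\<Sum>j\<in>J. M i j * c j) = 0" using mv[OF a(1) v(1) cg] v(3) by simp
    qed
    moreover obtain b where "b < k" "v $ b \<noteq> 0"
      using v(1,2) by (metis carrier_vecD dim_vec eq_vecI index_zero_vec(1) zero_carrier_vec)
    ultimately show "\<not> inj_matrix I J M"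
      using cg g unfolding inj_matrix_def by (metis bij_betwE lessThan_iff)
  qed
  with det_0_iff_vec_prod_zero_field[OF D] show ?thesis by blast
qed

text \<open>A nonzero determinant has a nonzero summand in the Leibniz formula, and the permutation
  of that summand is the transversal. Here numerical rank passes into a combinatorial
  matching.\<close>

lemma inj_matrix_transversal:
  fixes M :: "'i \<Rightarrow> 'j \<Rightarrow> 'a :: field"
  assumes M: "inj_matrix I J M" and "finite I" "finite J" "card I = card J"
  shows "\<exists>h. bij_betw h I J \<and> (\<forall>i\<in>I. M i (h i) \<noteq> 0)"
proof -
  obtain e where e: "bij_betw e {..<card J} I"
    using ex_bij_betw_nat_finite[OF \<open>finite I\<close>] assms by (auto simp: atLeast0LessThan)
  obtain g where g: "bij_betw g {..<card J} J"
    using ex_bij_betw_nat_finite[OF \<open>finite J\<close>] by (auto simp: atLeast0LessThan)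
  let ?k = "card J"
  let ?D = "mat ?k ?k (\<lambda>(a, b). M (e a) (g b))"
  have "det ?D \<noteq> 0" using inj_matrix_iff_det[OF e g] M by blast
  then have "(\<Sum>p | p permutes {0..<?k}. signof p * (\<Prod>i = 0..<?k. ?D $$ (i, p i))) \<noteq> 0"
    by (simp add: det_def)
  then obtain p where p: "p permutes {0..<?k}" "(\<Prod>i = 0..<?k. ?D $$ (i, p i)) \<noteq> 0"
    by (metis (no_types, lifting) sum.neutral mem_Collect_eq mult_zero_right)
  define h where "h = g \<circ> p \<circ> the_inv_into {..<?k} e"
  have pk: "a < ?k \<Longrightarrow> p a < ?k" for a using permutes_in_image[OF p(1), of a] by simp
  have "bij_betw p {..<?k} {..<?k}" using permutes_imp_bij[OF p(1)] by (simp add: atLeast0LessThan)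
  from bij_betw_trans[OF bij_betw_trans[OF bij_betw_the_inv_into[OF e] this] g]
  have "bij_betw h I J" by (simp add: h_def comp_assoc)
  moreover have "M i (h i) \<noteq> 0" if i: "i \<in> I" for i
  proof -
    obtain a where a: "a < ?k" "i = e a" using e i by (auto simp: bij_betw_def)
    then have "h i = g (p a)" using e by (simp add: h_def bij_betw_def the_inv_into_f_f)
    moreover have "?D $$ (a, p a) \<noteq> 0" using p(2) a by auto
    ultimately show ?thesis using a pk by simp
  qed
  ultimately show ?thesis by blast
qed

text \<open>The second premise says that the \<open>v l\<close> lie in the column space of \<open>M\<close>, the orthogonal
  complement of the left kernel.\<close>

lemma independent_in_column_space_transversal:
  fixes M :: "'i \<Rightarrow> 'j \<Rightarrow> 'a :: field" and v :: "'i \<Rightarrow> 'l \<Rightarrow> 'a"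
  assumes fin: "finite I" "finite J" "finite L"
    and indep: "inj_matrix I L v"
    and col: "\<And>z l. \<forall>j\<in>J. (\<Sum>i\<in>I. M i j * z i) = 0 \<Longrightarrow> l \<in> L \<Longrightarrow> (\<Sum>i\<in>I. v i l * z i) = 0"
  shows "\<exists>R h. R \<subseteq> I \<and> card R = card L \<and> inj_on h R \<and> h ` R \<subseteq> J \<and> (\<forall>i\<in>R. M i (h i) \<noteq> 0)"
proof -
  obtain R where R: "R \<subseteq> I" "card R = card L" "inj_matrix R L v"
    using inj_matrix_square_rows[OF indep] fin by blast
  have finR: "finite R" using R fin finite_subset by blast
  \<comment> \<open>The rows \<open>R\<close> of \<open>v\<close> form an invertible square matrix,
    so its transpose has a trivial kernel too.\<close>
  have "inj_matrix L R (\<lambda>l i. v i l)"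
    unfolding inj_matrix_def
  proof (intro allI impI)
    fix z assume z: "\<forall>l\<in>L. (\<Sum>i\<in>R. v i l * z i) = 0"
    obtain e where e: "bij_betw e {..<card L} R"
      using ex_bij_betw_nat_finite[OF finR] R by (auto simp: atLeast0LessThan)
    obtain g where g: "bij_betw g {..<card L} L"
      using ex_bij_betw_nat_finite[OF fin(3)] by (auto simp: atLeast0LessThan)
    let ?D = "mat (card L) (card L) (\<lambda>(a, b). v (e a) (g b))"
    have "det ?D \<noteq> 0" using inj_matrix_iff_det[OF e g] R by blast
    then have "det (transpose_mat ?D) \<noteq> 0" by (subst det_transpose) auto
    moreover have "transpose_mat ?D = mat (card L) (card L) (\<lambda>(a, b). v (e b) (g a))"
      by (rule eq_matI) auto
    ultimately have "inj_matrix L R (\<lambda>l i. v i l)"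
      using inj_matrix_iff_det[OF g e, of "\<lambda>l i. v i l"] by simp
    then show "\<forall>i\<in>R. z i = 0" using z unfolding inj_matrix_def by blast
  qed
  moreover have "(\<Sum>i\<in>R. v i l * z i) = 0"
    if "\<forall>j\<in>J. (\<Sum>i\<in>R. M i j * z i) = 0" "l \<in> L" for z l
  proof -
    \<comment> \<open>Extension by zero turns a dependence among the rows \<open>R\<close> of
      \<open>M\<close> into a vector of the left kernel of all of \<open>M\<close>, to which
      \<open>col\<close> applies.\<close>
    define y where "y i = (if i \<in> R then z i else 0)" for i
    have "(\<Sum>i\<in>I. f i * y i) = (\<Sum>i\<in>R. f i * z i)" for f
      using R fin by (intro sum.mono_neutral_cong_right) (auto simp: y_def)
    then show ?thesis using col[of y l] that by simp
  qed
  ultimately have "inj_matrix J R (\<lambda>j i. M i j)" unfolding inj_matrix_def by blast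
  then obtain J' where J': "J' \<subseteq> J" "card J' = card R" "inj_matrix J' R (\<lambda>j i. M i j)"
    using inj_matrix_square_rows[of J R] fin finR by metis
  then obtain h where h: "bij_betw h J' R" "\<forall>j\<in>J'. M (h j) j \<noteq> 0"
    using inj_matrix_transversal[OF J'(3)] fin finR finite_subset[OF J'(1)] by metis
  let ?h = "the_inv_into J' h"
  have inv: "bij_betw ?h R J'" using bij_betw_the_inv_into[OF h(1)] .
  moreover have "M i (?h i) \<noteq> 0" if "i \<in> R" for i
    using h(2) bij_betwE[OF inv] f_the_inv_into_f_bij_betw[OF h(1)] that by metis
  ultimately show ?thesis using R J' by (intro exI[of _ R] exI[of _ ?h]) (auto simp: bij_betw_def)
qed

section \<open>Subspaces of real vectors: bases and dimension counts\<close>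

definition subspace_of :: "nat \<Rightarrow> real vec set \<Rightarrow> bool" where
  "subspace_of n W \<longleftrightarrow> W \<subseteq> carrier_vec n \<and> 0\<^sub>v n \<in> W \<and>
     (\<forall>v\<in>W. \<forall>w\<in>W. v + w \<in> W) \<and> (\<forall>c. \<forall>v\<in>W. c \<cdot>\<^sub>v v \<in> W)"

text \<open>The basis vectors themselves index the columns of a matrix, so the counting arguments
  for \<open>inj_matrix\<close> apply to them directly.\<close>

definition vec_basis :: "nat \<Rightarrow> real vec set \<Rightarrow> real vec set \<Rightarrow> bool" where
  "vec_basis n W b \<longleftrightarrow> finite b \<and> b \<subseteq> W \<and> inj_matrix {..<n} b (\<lambda>i w. w $ i) \<and>
     (\<forall>w\<in>W. \<exists>c. \<forall>i<n. w $ i = (\<Sum>v\<in>b. v $ i * c v))"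

text \<open>A largest independent subset of \<open>W\<close> spans \<open>W\<close>, since any
  vector of \<open>W\<close> outside its span could be added. This connects the dimension of a
  restricted module with explicit coordinates.\<close>

lemma subspace_basis:
  assumes W: "subspace_of n W"
  shows "\<exists>b. vec_basis n W b \<and> card b = subspace_dim n W"
proof -
  interpret vec_space "TYPE(real)" n .
  have WC: "W \<subseteq> carrier_vec n" using W by (simp add: subspace_of_def)
  define P where "P b \<longleftrightarrow> b \<subseteq> W \<and> lin_indpt b" for b
  have Pb: "finite b \<and> card b \<le> n" if "P b" for b
  proof -
    have "b \<subseteq> carrier V" using that WC by (auto simp: P_def)
    then show ?thesis using li_le_dim[of b] that dim_is_n by (auto simp: P_def)
  qed
  have "P {}" by (auto simp: P_def lin_dep_def)
  then obtain b where b: "P b" and max: "\<And>b'. P b' \<Longrightarrow> card b' \<le> card b"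
    using ex_has_greatest_nat[of P "{}" card "Suc n"] Pb by (metis less_Suc_eq_le)
  have bC: "b \<subseteq> carrier_vec n" using b WC by (auto simp: P_def)
  have fin: "finite b" using Pb b by blast
  have li: "lin_indpt b" using b by (simp add: P_def)
  have spn: "W \<subseteq> span b"
  proof
    fix w assume w: "w \<in> W"
    show "w \<in> span b"
    proof (rule ccontr)
      assume n: "w \<notin> span b"
      then have wb: "w \<notin> b" using in_own_span[OF bC] by blast
      have "lin_indpt (b \<union> {w})"
        using lin_dep_iff_in_span[OF bC li _ wb] w WC n by auto
      then have "P (b \<union> {w})" using b w by (auto simp: P_def)
      from max[OF this] wb fin show False by simp
    qed
  qed
  have "submodule class_ring W V"
    using W unfolding subspace_of_def
    by unfold_locales (auto simp: class_ring_simps module_vec_simps)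
  then have "span b \<subseteq> W" using span_is_subset b by (auto simp: P_def)
  then have eq: "span b = W" using spn by blast
  have "maximal b (\<lambda>T. T \<subseteq> b \<and> lin_indpt T)"
    using li by (auto simp: maximal_def)
  from dim_span[OF bC fin this] have card: "card b = subspace_dim n W"
    by (simp add: eq subspace_dim_def)
  have lin: "\<forall>w\<in>b. c w = 0" if "\<forall>i<n. (\<Sum>w\<in>b. w $ i * c w) = 0" for c
  proof -
    have "lincomb c b = 0\<^sub>v n"
      using that lincomb_index[of _ b c] lincomb_dim[OF fin, of c] bC
      by (intro eq_vecI) (auto simp: mult.commute)
    then show ?thesis
      using not_lindepD[OF li fin subset_refl, of c] by auto
  qed
  have "\<exists>c. \<forall>i<n. w $ i = (\<Sum>v\<in>b. v $ i * c v)" if "w \<in> W" for w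
  proof -
    have "w \<in> span b" using that spn by blast
    then obtain c where "w = lincomb c b" using finite_in_span[OF fin bC] by blast
    then show ?thesis using lincomb_index[of _ b c] bC
      by (intro exI[of _ c]) (auto simp: mult.commute)
  qed
  moreover have "inj_matrix {..<n} b (\<lambda>i w. w $ i)"
    unfolding inj_matrix_def using lin by (metis lessThan_iff)
  moreover have "b \<subseteq> W" using b by (simp add: P_def)
  ultimately have "vec_basis n W b" using fin unfolding vec_basis_def by blast
  then show ?thesis using card by blast
qed

text \<open>Source of the lower bounds on dimensions: if the inequality failed, a basis of
  \<open>W\<close> and the functionals \<open>h e\<close> together would be fewer than
  \<open>n\<close> equations and would have a common nonzero solution, against
  \<open>triv\<close>.\<close>

lemma subspace_dim_ge:
  fixes h :: "'e \<Rightarrow> nat \<Rightarrow> real"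
  assumes W: "subspace_of n W" and E: "finite E"
    and triv: "\<And>z. (\<And>w. w \<in> W \<Longrightarrow> (\<Sum>i<n. w $ i * z i) = 0) \<Longrightarrow>
      (\<And>e. e \<in> E \<Longrightarrow> (\<Sum>i<n. h e i * z i) = 0) \<Longrightarrow> \<forall>i<n. z i = 0"
  shows "n \<le> subspace_dim n W + card E"
proof (rule ccontr)
  assume lt: "\<not> ?thesis"
  obtain b where b0: "vec_basis n W b" and card: "card b = subspace_dim n W"
    using subspace_basis[OF W] by blast
  then have b: "finite b" "b \<subseteq> W" "card b = subspace_dim n W" "inj_matrix {..<n} b (\<lambda>i w. w $ i)"
    "\<forall>w\<in>W. \<exists>c. \<forall>i<n. w $ i = (\<Sum>v\<in>b. v $ i * c v)"
    unfolding vec_basis_def by blast+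
  have "card (b <+> E) < card {..<n}" using lt b E by (simp add: card_Plus)
  then obtain z where z: "\<exists>j\<in>{..<n}. z j \<noteq> 0"
    "\<forall>x\<in>b <+> E. (\<Sum>j<n. (case x of Inl v \<Rightarrow> v $ j | Inr e \<Rightarrow> h e j) * z j) = 0"
    using homogeneous_system_nontrivial[OF _ _ \<open>card (b <+> E) < card {..<n}\<close>,
        of "\<lambda>x j. case x of Inl v \<Rightarrow> v $ j | Inr e \<Rightarrow> h e j"] b E
    by (auto simp del: lessThan_iff)
  have zb: "(\<Sum>j<n. v $ j * z j) = 0" if "v \<in> b" for v using z(2) that by force
  have "(\<Sum>j<n. w $ j * z j) = 0" if w: "w \<in> W" for w
  proof -
    obtain c where c: "\<forall>i<n. w $ i = (\<Sum>v\<in>b. v $ i * c v)" using b(5) w by blast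
    have "(\<Sum>j<n. w $ j * z j) = (\<Sum>j<n. \<Sum>v\<in>b. v $ j * c v * z j)"
      using c by (simp add: sum_distrib_right)
    also have "\<dots> = (\<Sum>v\<in>b. c v * (\<Sum>j<n. v $ j * z j))"
      by (subst sum.swap) (simp add: sum_distrib_left algebra_simps)
    finally show ?thesis using zb by simp
  qed
  moreover have "(\<Sum>j<n. h e j * z j) = 0" if "e \<in> E" for e using z(2) that by force
  ultimately have "\<forall>i<n. z i = 0" by (rule triv)
  with z(1) show False by auto
qed

lemma subspace_dim_le:
  assumes "subspace_of n W"
  shows "subspace_dim n W \<le> n"
proof -
  obtain b where "vec_basis n W b" "card b = subspace_dim n W"
    using subspace_basis[OF assms] by blast
  then show ?thesis using inj_matrix_card_le[of "{..<n}" b "\<lambda>i w. w $ i"]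
    by (simp add: vec_basis_def)
qed

text \<open>Here \<open>S\<close> names coordinates whose coordinate subspace meets \<open>W\<close> trivially.\<close>

lemma subspace_dim_transversal:
  fixes M :: "nat \<Rightarrow> 'j \<Rightarrow> real"
  assumes W: "subspace_of n W" and J: "finite J" and S: "S \<subseteq> {..<n}"
    and triv: "\<And>w. w \<in> W \<Longrightarrow> \<forall>i<n. i \<notin> S \<longrightarrow> w $ i = 0 \<Longrightarrow> \<forall>i<n. w $ i = 0"
    and colW: "\<And>z w. \<forall>j\<in>J. (\<Sum>i<n. M i j * z i) = 0 \<Longrightarrow> w \<in> W \<Longrightarrow> (\<Sum>i<n. w $ i * z i) = 0"
    and colS: "\<And>z s. \<forall>j\<in>J. (\<Sum>i<n. M i j * z i) = 0 \<Longrightarrow> s \<in> S \<Longrightarrow> z s = 0"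
  shows "\<exists>R h. R \<subseteq> {..<n} \<and> card R = subspace_dim n W + card S \<and> inj_on h R \<and> h ` R \<subseteq> J \<and>
    (\<forall>i\<in>R. M i (h i) \<noteq> 0)"
proof -
  have finS: "finite S" using S finite_subset by blast
  obtain b where b0: "vec_basis n W b" and card: "card b = subspace_dim n W"
    using subspace_basis[OF W] by blast
  then have b: "finite b" "b \<subseteq> W" "card b = subspace_dim n W" "inj_matrix {..<n} b (\<lambda>i w. w $ i)"
    "\<forall>w\<in>W. \<exists>c. \<forall>i<n. w $ i = (\<Sum>v\<in>b. v $ i * c v)"
    unfolding vec_basis_def by blast+
  \<comment> \<open>The basis of \<open>W\<close> is joined by the unit vectors of \<open>S\<close>.
    \<open>triv\<close> makes the union independent, which is how \<open>card S\<close> enters the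
    count.\<close>
  define v where "v i x = (case x of Inl w \<Rightarrow> w $ i | Inr s \<Rightarrow> if i = s then 1 else (0::real))"
    for i and x :: "real vec + nat"
  have comb: "vec n (\<lambda>i. \<Sum>w\<in>b'. w $ i * c w) \<in> W" if "b' \<subseteq> b" for c b'
    using finite_subset[OF that b(1)] that
  proof (induction b' rule: finite_induct)
    case empty
    have "vec n (\<lambda>i. \<Sum>w\<in>{}. w $ i * c w) = 0\<^sub>v n" by auto
    then show ?case using W unfolding subspace_of_def by metis
  next
    case (insert w b')
    have w: "w \<in> W" "w \<in> carrier_vec n" using insert b W by (auto simp: subspace_of_def)
    have "vec n (\<lambda>i. \<Sum>w\<in>insert w b'. w $ i * c w) =
      c w \<cdot>\<^sub>v w + vec n (\<lambda>i. \<Sum>w\<in>b'. w $ i * c w)"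
      using insert w by (intro eq_vecI) auto
    then show ?case using insert w W by (simp add: subspace_of_def)
  qed
  have "inj_matrix {..<n} (b <+> S) v"
    unfolding inj_matrix_def
  proof (intro allI impI)
    fix c assume c: "\<forall>i\<in>{..<n}. (\<Sum>x\<in>b <+> S. v i x * c x) = 0"
    have eq: "(\<Sum>w\<in>b. w $ i * c (Inl w)) + (if i \<in> S then c (Inr i) else 0) = 0" if "i < n" for i
    proof -
      have "(\<Sum>s\<in>S. v i (Inr s) * c (Inr s)) = (\<Sum>s\<in>S. if i = s then c (Inr s) else 0)"
        by (intro sum.cong) (auto simp: v_def)
      then have "(\<Sum>x\<in>b <+> S. v i x * c x) =
          (\<Sum>w\<in>b. w $ i * c (Inl w)) + (\<Sum>s\<in>S. if i = s then c (Inr s) else 0)"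
        using b finS by (simp add: sum.Plus v_def)
      then show ?thesis using c that finS by simp
    qed
    let ?w = "vec n (\<lambda>i. \<Sum>w\<in>b. w $ i * c (Inl w))"
    have "?w $ i = 0" if "i < n" "i \<notin> S" for i using eq[of i] that by simp
    then have "\<forall>i<n. i \<notin> S \<longrightarrow> ?w $ i = 0" by blast
    from triv[OF comb[OF subset_refl, of "\<lambda>w. c (Inl w)"] this]
    have w0: "\<forall>i<n. (\<Sum>w\<in>b. w $ i * c (Inl w)) = 0" by simp
    have "c (Inl w) = 0" if "w \<in> b" for w
      using inj_matrixD[OF b(4), of "\<lambda>w. c (Inl w)", OF _ that] w0 by simp
    moreover have "c (Inr s) = 0" if "s \<in> S" for s using eq[of s] w0 S that by auto
    ultimately show "\<forall>x\<in>b <+> S. c x = 0" by auto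
  qed
  moreover have "(\<Sum>i<n. v i l * z i) = 0"
    if z: "\<forall>j\<in>J. (\<Sum>i<n. M i j * z i) = 0" and l: "l \<in> b <+> S" for z l
  proof (cases l)
    case (Inl w)
    then show ?thesis using colW[OF z, of w] l b(2) by (auto simp: v_def)
  next
    case (Inr s)
    then have "s \<in> S" using l by auto
    moreover have "(\<Sum>i<n. v i l * z i) = (\<Sum>i<n. if i = s then z i else 0)"
      using Inr by (intro sum.cong) (auto simp: v_def)
    ultimately show ?thesis using colS[OF z, of s] S by auto
  qed
  ultimately show ?thesis
    using independent_in_column_space_transversal[of "{..<n}" J "b <+> S" v M] b finS J
    by (simp add: card_Plus)
qed

text \<open>The right-hand side becomes an extra column named \<open>None\<close>. There are now
  more columns than rows, and in a dependence the coefficient of \<open>None\<close> cannot vanish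
  because \<open>M\<close> is injective.\<close>

lemma inj_matrix_surj:
  fixes M :: "'i \<Rightarrow> 'j \<Rightarrow> 'a :: field"
  assumes M: "inj_matrix I J M" and fin: "finite I" "finite J" and card: "card I = card J"
  shows "\<exists>c. \<forall>i\<in>I. (\<Sum>j\<in>J. M i j * c j) = b i"
proof -
  define N where "N i x = (case x of Some j \<Rightarrow> M i j | None \<Rightarrow> b i)" for i x
  have "card I < card (insert None (Some ` J))"
    using fin card by (simp add: card_image)
  then obtain c where c: "\<exists>x\<in>insert None (Some ` J). c x \<noteq> 0"
    "\<forall>i\<in>I. (\<Sum>x\<in>insert None (Some ` J). N i x * c x) = 0"
    using homogeneous_system_nontrivial[of I "insert None (Some ` J)" N] fin by auto
  have eq: "(\<Sum>j\<in>J. M i j * c (Some j)) = - b i * c None" if "i \<in> I" for i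
  proof -
    have "(\<Sum>x\<in>Some ` J. N i x * c x) = (\<Sum>j\<in>J. M i j * c (Some j))"
      by (subst sum.reindex) (auto simp: N_def)
    then have "b i * c None + (\<Sum>j\<in>J. M i j * c (Some j)) = 0"
      using c(2) that fin by (auto simp: N_def)
    then show ?thesis by (simp add: eq_neg_iff_add_eq_0 add.commute)
  qed
  have "c None \<noteq> 0"
  proof
    assume "c None = 0"
    then have "c (Some j) = 0" if "j \<in> J" for j
      using inj_matrixD[OF M, of "\<lambda>j. c (Some j)", OF _ that] eq by simp
    then show False using c(1) \<open>c None = 0\<close> by auto
  qed
  then have "(\<Sum>j\<in>J. M i j * (- c (Some j) / c None)) = b i" if "i \<in> I" for i
  proof -
    have "(\<Sum>j\<in>J. M i j * (- c (Some j) / c None)) = - (\<Sum>j\<in>J. M i j * c (Some j)) / c None"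
      by (simp add: sum_negf sum_divide_distrib)
    then show ?thesis using eq[OF that] \<open>c None \<noteq> 0\<close> by simp
  qed
  then show ?thesis by (intro exI[of _ "\<lambda>j. - c (Some j) / c None"]) blast
qed

section \<open>Trajectories and the stabilizable subspace\<close>

text \<open>Vectors are functions on an arbitrary vertex type, so that states and inputs can index
  the same matrix; the iterates \<open>mulv V G ^^ k\<close> play the role of matrix powers.\<close>

definition mulv :: "'v set \<Rightarrow> ('v \<Rightarrow> 'v \<Rightarrow> real) \<Rightarrow> ('v \<Rightarrow> real) \<Rightarrow> 'v \<Rightarrow> real" where
  "mulv V G z = (\<lambda>a. \<Sum>b\<in>V. G a b * z b)"

lemma has_derivative_halfline:
  assumes "(f has_real_derivative D) (at t within {0..})" "0 < t"
  shows "(f has_real_derivative D) (at t)"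
proof -
  have "(f has_real_derivative D) (at t within {0<..})"
    by (rule DERIV_subset[OF assms(1)]) auto
  moreover have "at t within {0<..} = at t" using assms(2) by (intro at_within_open) auto
  ultimately show ?thesis by simp
qed

lemma nondecreasing_halfline:
  fixes f :: "real \<Rightarrow> real"
  assumes f: "\<And>t. 0 \<le> t \<Longrightarrow> \<exists>D. (f has_real_derivative D) (at t within {0..}) \<and> 0 \<le> D"
    and "0 \<le> s" "s \<le> t"
  shows "f s \<le> f t"
proof (rule DERIV_nonneg_imp_increasing_open[OF \<open>s \<le> t\<close>])
  fix r assume "s < r" "r < t"
  then show "\<exists>D. (f has_real_derivative D) (at r) \<and> 0 \<le> D"
    using f[of r] has_derivative_halfline \<open>0 \<le> s\<close> by (metis less_eq_real_def order_le_less_trans)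
next
  have "continuous_on {0..} f"
    using f DERIV_continuous by (fastforce simp: continuous_on_eq_continuous_within)
  then show "continuous_on {s..t} f" by (rule continuous_on_subset) (use \<open>0 \<le> s\<close> in auto)
qed

lemma constant_halfline:
  fixes f :: "real \<Rightarrow> real"
  assumes f: "\<And>t. 0 \<le> t \<Longrightarrow> (f has_real_derivative 0) (at t within {0..})" and "0 \<le> t"
  shows "f t = f 0"
proof (rule antisym)
  show "f 0 \<le> f t"
    by (rule nondecreasing_halfline[OF _ order_refl \<open>0 \<le> t\<close>])
       (intro exI[of _ 0] conjI f order_refl)
  have "((\<lambda>t. - f t) has_real_derivative 0) (at t within {0..})" if "0 \<le> t" for t
    using DERIV_minus[OF f[OF that]] by simp
  then have "- f 0 \<le> - f t"
    by (intro nondecreasing_halfline[of "\<lambda>t. - f t", OF _ order_refl \<open>0 \<le> t\<close>]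
        exI[of _ 0] conjI order_refl)
  then show "f t \<le> f 0" by simp
qed

lemma constant_tendsto_zero:
  fixes f :: "real \<Rightarrow> real"
  assumes "\<And>t. 0 \<le> t \<Longrightarrow> f t = c" "(f \<longlongrightarrow> 0) at_top"
  shows "c = 0"
proof -
  have "eventually (\<lambda>t. f t = c) at_top"
    using eventually_ge_at_top[of 0] by eventually_elim (simp add: assms)
  then have "(f \<longlongrightarrow> c) at_top" by (rule tendsto_eventually)
  then show ?thesis using assms(2) tendsto_unique trivial_limit_at_top_linorder by blast
qed

context
  fixes n m :: nat and A B :: "real mat"
  assumes A: "A \<in> carrier_mat n n" and B: "B \<in> carrier_mat n m"
begin

lemma vector_field_index:
  assumes "i < n" "x \<in> carrier_vec n" "u \<in> carrier_vec m"
  shows "(A *\<^sub>v x + B *\<^sub>v u) $ i = (\<Sum>j<n. A $$ (i, j) * x $ j) + (\<Sum>j<m. B $$ (i, j) * u $ j)"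
  using assms carrier_matD[OF A] carrier_matD[OF B] by (simp add: scalar_prod_def atLeast0LessThan)

lemma trajectory_iff:
  "trajectory A B u x \<longleftrightarrow> (\<forall>t\<ge>0. x t \<in> carrier_vec n \<and> u t \<in> carrier_vec m \<and>
     (\<forall>i<n. ((\<lambda>s. x s $ i) has_real_derivative
        (\<Sum>j<n. A $$ (i, j) * x t $ j) + (\<Sum>j<m. B $$ (i, j) * u t $ j)) (at t within {0..})))"
proof -
  have dims: "dim_row A = n" "dim_col B = m" using A B by auto
  show ?thesis
    unfolding trajectory_def dims by (auto simp: vector_field_index simp del: index_add_vec)
qed

lemma stabilizable_iff:
  "w \<in> stabilizable_subspace A B \<longleftrightarrow> (\<exists>u x. trajectory A B u x \<and> x 0 = w \<and>
     (\<forall>i<n. ((\<lambda>t. x t $ i) \<longlongrightarrow> 0) at_top))"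
  using carrier_matD(1)[OF A] unfolding stabilizable_subspace_def by simp

lemma stabilizable_subspace_of: "subspace_of n (stabilizable_subspace A B)"
proof -
  have zero: "0\<^sub>v n \<in> stabilizable_subspace A B"
    unfolding stabilizable_iff trajectory_iff
    by (intro exI[of _ "\<lambda>_. 0\<^sub>v m"] exI[of _ "\<lambda>_. 0\<^sub>v n"]) auto
  have add: "v + w \<in> stabilizable_subspace A B"
    if vw: "v \<in> stabilizable_subspace A B" "w \<in> stabilizable_subspace A B" for v w
  proof -
    obtain u x where x: "trajectory A B u x" "x 0 = v" "\<forall>i<n. ((\<lambda>t. x t $ i) \<longlongrightarrow> 0) at_top"
      using vw(1) unfolding stabilizable_iff by blast
    obtain u' y where y: "trajectory A B u' y" "y 0 = w" "\<forall>i<n. ((\<lambda>t. y t $ i) \<longlongrightarrow> 0) at_top"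
      using vw(2) unfolding stabilizable_iff by blast
    define z where "z t = vec n (\<lambda>i. x t $ i + y t $ i)" for t
    define p where "p t = vec m (\<lambda>i. u t $ i + u' t $ i)" for t
    have "trajectory A B p z" unfolding trajectory_iff
    proof (intro allI impI conjI)
      fix t i assume t: "(0::real) \<le> t" and i: "i < n"
      have "((\<lambda>s. x s $ i + y s $ i) has_real_derivative
          ((\<Sum>j<n. A $$ (i, j) * x t $ j) + (\<Sum>j<m. B $$ (i, j) * u t $ j)) +
          ((\<Sum>j<n. A $$ (i, j) * y t $ j) + (\<Sum>j<m. B $$ (i, j) * u' t $ j))) (at t within {0..})"
        using x(1) y(1) t i unfolding trajectory_iff by (intro DERIV_add) auto
      then show "((\<lambda>s. z s $ i) has_real_derivative
          (\<Sum>j<n. A $$ (i, j) * z t $ j) + (\<Sum>j<m. B $$ (i, j) * p t $ j)) (at t within {0..})"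
        using i by (simp add: z_def p_def algebra_simps sum.distrib)
    qed (auto simp: z_def p_def)
    moreover have "z 0 = v + w" using x y unfolding trajectory_iff z_def by (intro eq_vecI) auto
    moreover have "\<forall>i<n. ((\<lambda>t. z t $ i) \<longlongrightarrow> 0) at_top"
      using x(3) y(3) by (auto simp: z_def intro!: tendsto_add_zero)
    ultimately show ?thesis unfolding stabilizable_iff by blast
  qed
  have smult: "c \<cdot>\<^sub>v v \<in> stabilizable_subspace A B" if v: "v \<in> stabilizable_subspace A B" for c v
  proof -
    obtain u x where x: "trajectory A B u x" "x 0 = v" "\<forall>i<n. ((\<lambda>t. x t $ i) \<longlongrightarrow> 0) at_top"
      using v unfolding stabilizable_iff by blast
    define z where "z t = vec n (\<lambda>i. c * x t $ i)" for t
    define p where "p t = vec m (\<lambda>i. c * u t $ i)" for t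
    have "trajectory A B p z" unfolding trajectory_iff
    proof (intro allI impI conjI)
      fix t i assume t: "(0::real) \<le> t" and i: "i < n"
      have "((\<lambda>s. c * x s $ i) has_real_derivative
          c * ((\<Sum>j<n. A $$ (i, j) * x t $ j) + (\<Sum>j<m. B $$ (i, j) * u t $ j))) (at t within {0..})"
        using x(1) t i unfolding trajectory_iff by (intro DERIV_cmult) auto
      then show "((\<lambda>s. z s $ i) has_real_derivative
          (\<Sum>j<n. A $$ (i, j) * z t $ j) + (\<Sum>j<m. B $$ (i, j) * p t $ j)) (at t within {0..})"
        using i by (simp add: z_def p_def algebra_simps sum_distrib_left)
    qed (auto simp: z_def p_def)
    moreover have "z 0 = c \<cdot>\<^sub>v v" using x unfolding trajectory_iff z_def by (intro eq_vecI) auto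
    moreover have "\<forall>i<n. ((\<lambda>t. z t $ i) \<longlongrightarrow> 0) at_top"
      using x(3) by (auto simp: z_def intro!: tendsto_mult_right_zero)
    ultimately show ?thesis unfolding stabilizable_iff by blast
  qed
  have "stabilizable_subspace A B \<subseteq> carrier_vec n"
    unfolding stabilizable_iff trajectory_iff subset_iff by fastforce
  then show ?thesis using zero add smult by (simp add: subspace_of_def)
qed

text \<open>The inner product of \<open>z\<close> with the state has derivative zero whatever the
  input is. Hence it is constant, and its limit is zero.\<close>

lemma stabilizable_left_kernel:
  assumes zA: "\<forall>j<n. (\<Sum>i<n. A $$ (i, j) * z i) = 0" and zB: "\<forall>j<m. (\<Sum>i<n. B $$ (i, j) * z i) = 0"
    and w: "w \<in> stabilizable_subspace A B"
  shows "(\<Sum>i<n. w $ i * z i) = 0"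
proof -
  obtain u x where x: "trajectory A B u x" "x 0 = w" "\<forall>i<n. ((\<lambda>t. x t $ i) \<longlongrightarrow> 0) at_top"
    using w unfolding stabilizable_iff by blast
  have "((\<lambda>s. \<Sum>i<n. x s $ i * z i) has_real_derivative 0) (at t within {0..})" if "0 \<le> t" for t
  proof -
    let ?D = "\<lambda>i. (\<Sum>j<n. A $$ (i, j) * x t $ j) + (\<Sum>j<m. B $$ (i, j) * u t $ j)"
    have "((\<lambda>s. \<Sum>i<n. x s $ i * z i) has_real_derivative (\<Sum>i<n. ?D i * z i)) (at t within {0..})"
      using x(1) that unfolding trajectory_iff
      by (intro DERIV_sum DERIV_cmult_right) auto
    moreover have "(\<Sum>i<n. ?D i * z i) =
        (\<Sum>i<n. \<Sum>j<n. A $$ (i, j) * z i * x t $ j) + (\<Sum>i<n. \<Sum>j<m. B $$ (i, j) * z i * u t $ j)"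
      by (simp add: algebra_simps sum_distrib_left sum.distrib)
    moreover have "(\<Sum>i<n. \<Sum>j<n. A $$ (i, j) * z i * x t $ j) = 0"
      by (subst sum.swap) (simp add: zA sum_distrib_right[symmetric])
    moreover have "(\<Sum>i<n. \<Sum>j<m. B $$ (i, j) * z i * u t $ j) = 0"
      by (subst sum.swap) (simp add: zB sum_distrib_right[symmetric])
    ultimately show ?thesis by simp
  qed
  then have const: "(\<Sum>i<n. x t $ i * z i) = (\<Sum>i<n. x 0 $ i * z i)" if "0 \<le> t" for t
    using constant_halfline[of "\<lambda>s. \<Sum>i<n. x s $ i * z i"] that by blast
  have "((\<lambda>t. \<Sum>i<n. x t $ i * z i) \<longlongrightarrow> (\<Sum>i<n. 0 * z i)) at_top"
    using x(3) by (intro tendsto_sum tendsto_mult_right) auto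
  then have "((\<lambda>t. \<Sum>i<n. x t $ i * z i) \<longlongrightarrow> 0) at_top" by simp
  from constant_tendsto_zero[OF const this] show ?thesis using x(2) by simp
qed

text \<open>Along a trajectory of the uncontrolled block \<open>Q\<close> the quadratic form of \<open>A\<close> has derivative
  \<open>2 |A x|\<^sup>2\<close>; it increases to its limit \<open>0\<close>, so it cannot start at a nonnegative value unless
  \<open>A x\<close> vanishes throughout.\<close>

lemma stabilizable_uncontrolled_block:
  assumes sym: "\<And>i j. i < n \<Longrightarrow> j < n \<Longrightarrow> A $$ (i, j) = A $$ (j, i)"
    and Q: "Q \<subseteq> {..<n}"
    and AQ: "\<And>i j. i \<in> Q \<Longrightarrow> j < n \<Longrightarrow> j \<notin> Q \<Longrightarrow> A $$ (i, j) = 0"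
    and BQ: "\<And>i j. i \<in> Q \<Longrightarrow> j < m \<Longrightarrow> B $$ (i, j) = 0"
    and w: "w \<in> stabilizable_subspace A B"
    and form: "0 \<le> (\<Sum>i\<in>Q. \<Sum>j\<in>Q. A $$ (i, j) * w $ i * w $ j)"
    and i: "i \<in> Q"
  shows "w $ i = 0"
proof -
  obtain u x where x: "trajectory A B u x" "x 0 = w" "\<forall>i<n. ((\<lambda>t. x t $ i) \<longlongrightarrow> 0) at_top"
    using w unfolding stabilizable_iff by blast
  have finQ: "finite Q" using Q finite_subset by blast
  define g where "g i t = (\<Sum>j\<in>Q. A $$ (i, j) * x t $ j)" for i t
  define f where "f t = (\<Sum>i\<in>Q. \<Sum>j\<in>Q. A $$ (i, j) * x t $ i * x t $ j)" for t
  have dx: "((\<lambda>s. x s $ i) has_real_derivative g i t) (at t within {0..})"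
    if "0 \<le> t" "i \<in> Q" for i t
  proof -
    have "(\<Sum>j<n. A $$ (i, j) * x t $ j) = g i t"
      unfolding g_def using Q AQ that by (intro sum.mono_neutral_right) auto
    moreover have "(\<Sum>j<m. B $$ (i, j) * u t $ j) = 0" using BQ that by simp
    moreover have "i < n" using that Q by auto
    ultimately show ?thesis using x(1) that unfolding trajectory_iff by fastforce
  qed
  \<comment> \<open>The product rule gives two sums, which symmetry of \<open>A\<close> makes
    equal.\<close>
  have df: "(f has_real_derivative 2 * (\<Sum>i\<in>Q. (g i t)\<^sup>2)) (at t within {0..})" if t: "0 \<le> t" for t
  proof -
    have "(f has_real_derivative (\<Sum>i\<in>Q. \<Sum>j\<in>Q. A $$ (i, j) * (g i t * x t $ j + g j t * x t $ i)))
        (at t within {0..})"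
      unfolding f_def mult.assoc
      by (intro DERIV_sum DERIV_cmult DERIV_mult dx t)
    moreover have "(\<Sum>i\<in>Q. \<Sum>j\<in>Q. A $$ (i, j) * (g i t * x t $ j + g j t * x t $ i)) =
        (\<Sum>i\<in>Q. \<Sum>j\<in>Q. g i t * (A $$ (i, j) * x t $ j)) + (\<Sum>i\<in>Q. \<Sum>j\<in>Q. g j t * (A $$ (i, j) * x t $ i))"
      by (simp add: algebra_simps sum.distrib)
    moreover have "(\<Sum>i\<in>Q. \<Sum>j\<in>Q. g i t * (A $$ (i, j) * x t $ j)) = (\<Sum>i\<in>Q. (g i t)\<^sup>2)"
      by (simp add: g_def power2_eq_square sum_distrib_left[symmetric])
    moreover have "(\<Sum>i\<in>Q. \<Sum>j\<in>Q. g j t * (A $$ (i, j) * x t $ i)) =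
        (\<Sum>j\<in>Q. \<Sum>i\<in>Q. g j t * (A $$ (j, i) * x t $ i))"
      by (subst sum.swap, intro sum.cong refl) (use sym Q in auto)
    ultimately show ?thesis by (simp add: g_def power2_eq_square sum_distrib_left[symmetric])
  qed
  have mono: "f s \<le> f t" if "0 \<le> s" "s \<le> t" for s t
    by (rule nondecreasing_halfline[OF _ that], intro exI conjI, erule df) (simp add: sum_nonneg)
  have lim: "(f \<longlongrightarrow> 0) at_top"
  proof -
    have "(f \<longlongrightarrow> (\<Sum>i\<in>Q. \<Sum>j\<in>Q. A $$ (i, j) * 0 * 0)) at_top"
      unfolding f_def using x(3) Q by (intro tendsto_sum tendsto_mult tendsto_const) auto
    then show ?thesis by simp
  qed
  have f0: "f t = 0" if "0 \<le> t" for t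
  proof (rule antisym)
    have "eventually (\<lambda>s. f t \<le> f s) at_top"
      using eventually_ge_at_top[of t] by eventually_elim (use mono that in auto)
    then show "f t \<le> 0" using lim tendsto_lowerbound trivial_limit_at_top_linorder by blast
    show "0 \<le> f t" using mono[of 0 t] that form x(2) by (simp add: f_def)
  qed
  \<comment> \<open>\<open>f\<close> vanishes identically, hence so does its derivative, a sum of
    squares. Two-sided derivatives exist only at positive times; time 0 is recovered below by
    continuity.\<close>
  have g0: "g i t = 0" if t: "0 < t" and i: "i \<in> Q" for i t
  proof -
    have t0: "0 \<le> t" using t by simp
    have "(f has_real_derivative 0) (at t within {0..})"
      by (rule has_field_derivative_transform_within[of "\<lambda>_. 0" _ _ _ 1]) (use f0 t0 in auto)
    then have "2 * (\<Sum>i\<in>Q. (g i t)\<^sup>2) = 0"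
      using DERIV_unique has_derivative_halfline[OF _ t] df[OF t0] by blast
    then show ?thesis using i finQ by (simp add: sum_nonneg_eq_0_iff)
  qed
  have "x t $ i = x 0 $ i" if t: "0 \<le> t" for t
  proof (cases "t = 0")
    case False
    have "continuous_on {0..} (\<lambda>s. x s $ i)"
      using dx[OF _ i] DERIV_continuous by (fastforce simp: continuous_on_eq_continuous_within)
    then have "continuous_on {0..t} (\<lambda>s. x s $ i)" by (rule continuous_on_subset) auto
    moreover have "((\<lambda>s. x s $ i) has_real_derivative 0) (at s)" if "0 < s" for s
      using has_derivative_halfline[OF dx[OF _ i] that] g0[OF that i] that by simp
    ultimately show ?thesis
      using DERIV_isconst_end[of 0 t "\<lambda>s. x s $ i"] t False by simp
  qed simp
  moreover have "((\<lambda>t. x t $ i) \<longlongrightarrow> 0) at_top" using x(3) i Q by auto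
  ultimately show ?thesis using constant_tendsto_zero x(2) by metis
qed

text \<open>An input proportional to \<open>exp (\<mu> * t)\<close> keeps the state on a fixed line.
  With \<open>w = 0\<close> this yields the eigenvectors with negative eigenvalue, with a unit
  vector \<open>w\<close> the resolvent applied to a column of \<open>B\<close>.\<close>

lemma stabilizable_exponential:
  assumes mu: "\<mu> < 0"
    and eq: "\<And>i. i < n \<Longrightarrow> \<mu> * v i = (\<Sum>j<n. A $$ (i, j) * v j) + (\<Sum>j<m. B $$ (i, j) * w j)"
  shows "vec n v \<in> stabilizable_subspace A B"
proof -
  define x where "x t = vec n (\<lambda>i. exp (\<mu> * t) * v i)" for t
  define u where "u t = vec m (\<lambda>j. exp (\<mu> * t) * w j)" for t
  have "trajectory A B u x" unfolding trajectory_iff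
  proof (intro allI impI conjI)
    fix t i assume t: "(0::real) \<le> t" and i: "i < n"
    have "((\<lambda>s. exp (\<mu> * s) * v i) has_real_derivative exp (\<mu> * t) * (\<mu> * v i)) (at t within {0..})"
      by (auto intro!: derivative_eq_intros)
    moreover have "exp (\<mu> * t) * (\<mu> * v i) =
        (\<Sum>j<n. A $$ (i, j) * x t $ j) + (\<Sum>j<m. B $$ (i, j) * u t $ j)"
      unfolding eq[OF i] by (simp add: x_def u_def distrib_left sum_distrib_left mult_ac)
    ultimately show "((\<lambda>s. x s $ i) has_real_derivative
        (\<Sum>j<n. A $$ (i, j) * x t $ j) + (\<Sum>j<m. B $$ (i, j) * u t $ j)) (at t within {0..})"
      using i by (simp add: x_def)
  qed (auto simp: x_def u_def)
  moreover have "x 0 = vec n v" by (simp add: x_def)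
  moreover have "((\<lambda>t. x t $ i) \<longlongrightarrow> 0) at_top" if "i < n" for i
  proof -
    have "((\<lambda>t. exp (\<mu> * t)) \<longlongrightarrow> 0) at_top"
      by (rule filterlim_compose[OF exp_at_bot])
         (use mu in \<open>auto intro: filterlim_tendsto_neg_mult_at_bot[OF tendsto_const _ filterlim_ident]\<close>)
    then show ?thesis using that tendsto_mult_left_zero by (simp add: x_def)
  qed
  ultimately show ?thesis unfolding stabilizable_iff by blast
qed

text \<open>The states \<open>v\<close> with \<open>(\<mu> - A) v = B e\<^sub>j\<close> are stabilizable for \<open>\<mu> < 0\<close>, and
  \<open>\<mu> v \<rightarrow> B e\<^sub>j\<close> as \<open>\<mu> \<rightarrow> -\<infinity>\<close>.\<close>

lemma orthogonal_resolvent_input: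
  assumes z: "\<And>\<mu> v w. \<mu> < 0 \<Longrightarrow>
      (\<And>i. i < n \<Longrightarrow> \<mu> * v i = (\<Sum>j<n. A $$ (i, j) * v j) + (\<Sum>j<m. B $$ (i, j) * w j)) \<Longrightarrow>
      (\<Sum>i<n. v i * z i) = 0"
    and l: "l < m"
  shows "(\<Sum>i<n. B $$ (i, l) * z i) = 0"
proof -
  define K where "K = (\<Sum>i<n. \<Sum>j<n. \<bar>A $$ (i, j)\<bar>)"
  define b where "b = (\<Sum>i<n. \<bar>B $$ (i, l)\<bar>)"
  define Z where "Z = (\<Sum>i<n. \<bar>z i\<bar>)"
  define c where "c = (\<Sum>i<n. B $$ (i, l) * z i)"
  have K0: "0 \<le> K" "0 \<le> b" "0 \<le> Z" by (auto simp: K_def b_def Z_def intro!: sum_nonneg)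
  have Av: "(\<Sum>i<n. \<bar>\<Sum>j<n. A $$ (i, j) * v j\<bar>) \<le> K * (\<Sum>j<n. \<bar>v j\<bar>)" for v
  proof -
    have "\<bar>\<Sum>j<n. A $$ (i, j) * v j\<bar> \<le> (\<Sum>j<n. \<bar>A $$ (i, j)\<bar>) * (\<Sum>j<n. \<bar>v j\<bar>)" for i
    proof -
      have "\<bar>\<Sum>j<n. A $$ (i, j) * v j\<bar> \<le> (\<Sum>j<n. \<bar>A $$ (i, j)\<bar> * \<bar>v j\<bar>)"
        by (rule order_trans[OF sum_abs]) (simp add: abs_mult)
      also have "\<dots> \<le> (\<Sum>j<n. \<bar>A $$ (i, j)\<bar> * (\<Sum>j<n. \<bar>v j\<bar>))"
        by (intro sum_mono mult_left_mono member_le_sum) auto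
      finally show ?thesis by (simp add: sum_distrib_right)
    qed
    then show ?thesis unfolding K_def sum_distrib_right by (intro sum_mono) (simp add: sum_distrib_right)
  qed
  \<comment> \<open>If \<open>v\<close> solves the resolvent equation for column \<open>l\<close>
    and is orthogonal to \<open>z\<close>, then \<open>c\<close> is minus the inner product of
    \<open>z\<close> with \<open>A v\<close>. This is of order \<open>1 / s\<close>, so letting
    \<open>s\<close> grow forces \<open>c = 0\<close>.\<close>
  have bound: "s * \<bar>c\<bar> \<le> Z * K * b" if s: "0 < s" for s
  proof -
    \<comment> \<open>\<open>K\<close> bounds the l1 operator norm of \<open>A\<close>, so the
      absolute value \<open>K + s\<close> of \<open>\<mu>\<close> leaves a margin \<open>s\<close>:
      \<open>\<mu> - A\<close> is injective and its inverse has norm at most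
      \<open>1 / s\<close>.\<close>
    define \<mu> where "\<mu> = - (K + s)"
    have mu: "\<mu> < 0" "\<bar>\<mu>\<bar> = K + s" using s K0 by (auto simp: \<mu>_def)
    have nrm: "s * (\<Sum>j<n. \<bar>v j\<bar>) \<le> (\<Sum>i<n. \<bar>f i\<bar>)"
      if v: "\<And>i. i < n \<Longrightarrow> \<mu> * v i = (\<Sum>j<n. A $$ (i, j) * v j) + f i" for v f
    proof -
      have "(K + s) * (\<Sum>j<n. \<bar>v j\<bar>) = (\<Sum>i<n. \<bar>\<mu> * v i\<bar>)"
        by (simp add: abs_mult mu sum_distrib_left)
      also have "\<dots> \<le> (\<Sum>i<n. \<bar>\<Sum>j<n. A $$ (i, j) * v j\<bar> + \<bar>f i\<bar>)"
        using v by (intro sum_mono) (auto simp: abs_triangle_ineq)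
      also have "\<dots> \<le> K * (\<Sum>j<n. \<bar>v j\<bar>) + (\<Sum>i<n. \<bar>f i\<bar>)" using Av by (simp add: sum.distrib)
      finally show ?thesis by (simp add: algebra_simps)
    qed
    let ?M = "\<lambda>i j. (if i = j then \<mu> else 0) - A $$ (i, j)"
    have M: "(\<Sum>j<n. ?M i j * v j) = \<mu> * v i - (\<Sum>j<n. A $$ (i, j) * v j)" if "i < n" for i v
    proof -
      have "(\<Sum>j<n. ?M i j * v j) = (\<Sum>j<n. (if i = j then \<mu> * v j else 0) - A $$ (i, j) * v j)"
        by (intro sum.cong) (auto simp: algebra_simps)
      then show ?thesis using that by (simp add: sum_subtractf)
    qed
    have "inj_matrix {..<n} {..<n} ?M" unfolding inj_matrix_def
    proof (intro allI impI)
      fix v assume "\<forall>i\<in>{..<n}. (\<Sum>j<n. ?M i j * v j) = 0"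
      then have "s * (\<Sum>j<n. \<bar>v j\<bar>) \<le> 0"
        using nrm[of v "\<lambda>_. 0"] M by simp
      then have "(\<Sum>j<n. \<bar>v j\<bar>) = 0"
        using s by (metis abs_ge_zero antisym mult_le_0_iff not_le sum_nonneg)
      then show "\<forall>j\<in>{..<n}. v j = 0" by (simp add: sum_nonneg_eq_0_iff)
    qed
    then obtain v where v0: "\<forall>i\<in>{..<n}. (\<Sum>j<n. ?M i j * v j) = B $$ (i, l)"
      using inj_matrix_surj[of "{..<n}" "{..<n}" ?M "\<lambda>i. B $$ (i, l)"] by auto
    have v: "\<mu> * v i = (\<Sum>j<n. A $$ (i, j) * v j) + B $$ (i, l)" if "i < n" for i
    proof -
      have "\<mu> * v i - (\<Sum>j<n. A $$ (i, j) * v j) = B $$ (i, l)"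
        using trans[OF sym[OF M[OF that, of v]] bspec[OF v0, of i]] that by simp
      then show ?thesis by linarith
    qed
    have eq: "\<mu> * v i = (\<Sum>j<n. A $$ (i, j) * v j) + (\<Sum>j<m. B $$ (i, j) * (if j = l then 1 else 0))"
      if "i < n" for i
    proof -
      have "(\<Sum>j<m. B $$ (i, j) * (if j = l then 1 else 0)) = (\<Sum>j<m. if j = l then B $$ (i, j) else 0)"
        by (intro sum.cong) auto
      then show ?thesis using v[OF that] l by simp
    qed
    have "(\<Sum>i<n. v i * z i) = 0" by (rule z[OF mu(1) eq])
    moreover have "c = \<mu> * (\<Sum>i<n. v i * z i) - (\<Sum>i<n. (\<Sum>j<n. A $$ (i, j) * v j) * z i)"
      unfolding c_def sum_distrib_left sum_subtractf[symmetric]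
    proof (intro sum.cong refl)
      fix i assume "i \<in> {..<n}"
      then have "\<mu> * v i * z i = ((\<Sum>j<n. A $$ (i, j) * v j) + B $$ (i, l)) * z i" using v by simp
      then show "B $$ (i, l) * z i = \<mu> * (v i * z i) - (\<Sum>j<n. A $$ (i, j) * v j) * z i"
        by (simp only: distrib_right mult.assoc)
    qed
    ultimately have "\<bar>c\<bar> = \<bar>\<Sum>i<n. (\<Sum>j<n. A $$ (i, j) * v j) * z i\<bar>" by simp
    also have "\<dots> \<le> (\<Sum>i<n. \<bar>\<Sum>j<n. A $$ (i, j) * v j\<bar> * Z)"
      unfolding Z_def
      by (rule order_trans[OF sum_abs], unfold abs_mult, intro sum_mono mult_left_mono member_le_sum) auto
    also have "\<dots> \<le> K * (\<Sum>j<n. \<bar>v j\<bar>) * Z"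
      unfolding sum_distrib_right[symmetric] using Av K0 by (intro mult_right_mono) auto
    finally have "s * \<bar>c\<bar> \<le> Z * K * (s * (\<Sum>j<n. \<bar>v j\<bar>))"
      using s by (simp add: mult_left_mono mult_ac)
    also have "\<dots> \<le> Z * K * b"
      unfolding b_def using nrm[of v "\<lambda>i. B $$ (i, l)"] v K0 by (intro mult_left_mono) auto
    finally show ?thesis .
  qed
  have "c = 0"
  proof (rule ccontr)
    assume "c \<noteq> 0"
    then have "(Z * K * b + 1) / \<bar>c\<bar> * \<bar>c\<bar> \<le> Z * K * b"
      using K0 by (intro bound divide_pos_pos) (auto intro: add_nonneg_pos)
    then show False using \<open>c \<noteq> 0\<close> by simp
  qed
  then show ?thesis by (simp add: c_def)
qed

text \<open>The predicate \<open>H\<close>, orthogonality to all \<open>v\<close> with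
  \<open>(\<mu> - A) v = B w\<close> for negative \<open>\<mu>\<close>, is inherited by
  \<open>A z\<close>: by symmetry the inner product of \<open>v\<close> with \<open>A z\<close> is
  that of \<open>\<mu> v - B w\<close> with \<open>z\<close>, and both terms vanish. Orthogonality
  to the stabilizable subspace starts the induction.\<close>

lemma orthogonal_stabilizable_krylov:
  assumes sym: "\<And>i j. i < n \<Longrightarrow> j < n \<Longrightarrow> A $$ (i, j) = A $$ (j, i)"
    and z: "\<And>w. w \<in> stabilizable_subspace A B \<Longrightarrow> (\<Sum>i<n. w $ i * z i) = 0" and l: "l < m"
  shows "(\<Sum>i<n. B $$ (i, l) * ((mulv {..<n} (\<lambda>i j. A $$ (i, j)) ^^ k) z) i) = 0"
proof -
  define H where "H z \<longleftrightarrow> (\<forall>\<mu> v w. \<mu> < 0 \<longrightarrow>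
      (\<forall>i<n. \<mu> * v i = (\<Sum>j<n. A $$ (i, j) * v j) + (\<Sum>j<m. B $$ (i, j) * w j)) \<longrightarrow>
      (\<Sum>i<n. v i * z i) = 0)" for z :: "nat \<Rightarrow> real"
  let ?G = "mulv {..<n} (\<lambda>i j. A $$ (i, j))"
  have Hl: "(\<Sum>i<n. B $$ (i, l) * z i) = 0" if "H z" "l < m" for z l
    using that orthogonal_resolvent_input unfolding H_def by blast
  have step: "H (?G z)" if z: "H z" for z
    unfolding H_def
  proof (intro allI impI)
    fix \<mu> v w assume mu: "\<mu> < (0::real)"
      and v: "\<forall>i<n. \<mu> * v i = (\<Sum>j<n. A $$ (i, j) * v j) + (\<Sum>j<m. B $$ (i, j) * w j)"
    have "(\<Sum>i<n. v i * ?G z i) = (\<Sum>i<n. \<Sum>j<n. A $$ (i, j) * v i * z j)"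
      by (simp add: mulv_def sum_distrib_left mult_ac)
    also have "\<dots> = (\<Sum>j<n. \<Sum>i<n. A $$ (j, i) * v i * z j)"
      by (subst sum.swap) (simp add: sym)
    also have "\<dots> = (\<Sum>j<n. (\<mu> * v j - (\<Sum>l<m. B $$ (j, l) * w l)) * z j)"
      using v by (simp add: sum_distrib_right)
    also have "\<dots> = \<mu> * (\<Sum>j<n. v j * z j) - (\<Sum>j<n. \<Sum>l<m. B $$ (j, l) * w l * z j)"
      by (simp add: algebra_simps sum_subtractf sum_distrib_left)
    also have "(\<Sum>j<n. \<Sum>l<m. B $$ (j, l) * w l * z j) = (\<Sum>l<m. w l * (\<Sum>j<n. B $$ (j, l) * z j))"
      by (subst sum.swap) (simp add: sum_distrib_left mult_ac)
    also have "(\<Sum>j<n. v j * z j) = 0" using z mu v unfolding H_def by blast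
    finally show "(\<Sum>i<n. v i * ?G z i) = 0" using Hl[OF z] by simp
  qed
  have "H z"
    unfolding H_def
  proof (intro allI impI)
    fix \<mu> v w assume mu: "\<mu> < (0::real)"
      and v: "\<forall>i<n. \<mu> * v i = (\<Sum>j<n. A $$ (i, j) * v j) + (\<Sum>j<m. B $$ (i, j) * w j)"
    show "(\<Sum>i<n. v i * z i) = 0"
      using z[OF stabilizable_exponential[OF mu, of v w]] v by simp
  qed
  then have "H ((?G ^^ k) z)" by (induction k) (auto intro: step)
  then show ?thesis using Hl l by blast
qed

end

section \<open>Limits of iterated matrix-vector products\<close>

text \<open>Bolzano-Weierstrass, one coordinate at a time: each new coordinate is thinned to a
  monotone subsequence.\<close>

lemma bounded_family_convergent_subsequence:
  fixes f :: "nat \<Rightarrow> 'v \<Rightarrow> real"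
  assumes "finite I" "\<And>b. b \<in> I \<Longrightarrow> Bseq (\<lambda>m. f m b)"
  shows "\<exists>r. strict_mono r \<and> (\<forall>b\<in>I. convergent (\<lambda>m. f (r m) b))"
  using assms
proof (induction I rule: finite_induct)
  case empty
  show ?case by (intro exI[of _ "\<lambda>m. m"]) (simp add: strict_mono_def)
next
  case (insert a I)
  then obtain r where r: "strict_mono r" "\<And>b. b \<in> I \<Longrightarrow> convergent (\<lambda>m. f (r m) b)" by auto
  obtain s :: "nat \<Rightarrow> nat" where s: "strict_mono s" "monoseq (\<lambda>m. f (r (s m)) a)"
    using seq_monosub[of "\<lambda>m. f (r m) a"] by blast
  have "Bseq (\<lambda>m. f (r (s m)) a)" using insert.prems Bseq_subseq[of "\<lambda>m. f m a" "r \<circ> s"] by simp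
  then have "convergent (\<lambda>m. f (r (s m)) a)" using s(2) Bseq_monoseq_convergent by blast
  moreover have "convergent (\<lambda>m. f (r (s m)) b)" if "b \<in> I" for b
    using convergent_subseq_convergent[OF r(2)[OF that] s(1)] by (simp add: o_def)
  moreover have "strict_mono (r \<circ> s)" using r(1) s(1) by (rule strict_mono_o)
  ultimately show ?case by (intro exI[of _ "\<lambda>m. r (s m)"]) (simp add: o_def)
qed

text \<open>Compactness of the unit sphere: if \<open>w\<close> did not tend to zero, a normalized
  subsequence would have a limit of norm 1 annihilated by all functionals \<open>p s\<close>. The
  set \<open>T\<close> may be infinite, since each functional contributes only its own
  limit.\<close>

lemma common_kernel_tendsto_zero:
  fixes w :: "nat \<Rightarrow> 'v \<Rightarrow> real" and p :: "'s \<Rightarrow> 'v \<Rightarrow> real"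
  assumes I: "finite I"
    and triv: "\<And>y. (\<And>s. s \<in> T \<Longrightarrow> (\<Sum>b\<in>I. p s b * y b) = 0) \<Longrightarrow> \<forall>b\<in>I. y b = 0"
    and lim: "\<And>s. s \<in> T \<Longrightarrow> (\<lambda>m. \<Sum>b\<in>I. p s b * w m b) \<longlonglongrightarrow> 0"
    and b: "b \<in> I"
  shows "(\<lambda>m. w m b) \<longlonglongrightarrow> 0"
proof -
  define N where "N m = (\<Sum>b\<in>I. \<bar>w m b\<bar>)" for m
  have N0: "0 \<le> N m" for m by (simp add: N_def sum_nonneg)
  have "N \<longlonglongrightarrow> 0"
  proof (rule ccontr)
    assume "\<not> N \<longlonglongrightarrow> 0"
    then obtain \<epsilon> where e: "\<epsilon> > 0" "\<And>k. \<exists>m\<ge>k. \<epsilon> \<le> N m"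
      unfolding LIMSEQ_iff using N0 by (auto simp: not_less)
    then have "infinite {m. \<epsilon> \<le> N m}" by (simp add: infinite_nat_iff_unbounded_le)
    then obtain r :: "nat \<Rightarrow> nat" where r: "strict_mono r" "\<And>k. \<epsilon> \<le> N (r k)"
      using infinite_enumerate by (metis mem_Collect_eq)
    have Npos: "0 < N (r k)" for k using r(2) e(1) less_le_trans by blast
    define y where "y k b = w (r k) b / N (r k)" for k b
    have y1: "(\<Sum>b\<in>I. \<bar>y k b\<bar>) = 1" for k
      using Npos[of k] by (simp add: y_def N_def sum_divide_distrib[symmetric])
    have "Bseq (\<lambda>k. y k b)" if "b \<in> I" for b
    proof (rule BseqI')
      fix k
      have "\<bar>y k b\<bar> \<le> (\<Sum>b\<in>I. \<bar>y k b\<bar>)" using I that by (intro member_le_sum) auto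
      then show "norm (y k b) \<le> 1" by (simp add: y1)
    qed
    from bounded_family_convergent_subsequence[of I y, OF I this]
    obtain q where q: "strict_mono q" "\<And>b. b \<in> I \<Longrightarrow> convergent (\<lambda>k. y (q k) b)" by blast
    define l where "l b = lim (\<lambda>k. y (q k) b)" for b
    have l: "(\<lambda>k. y (q k) b) \<longlonglongrightarrow> l b" if "b \<in> I" for b
      using q(2)[OF that] by (simp add: l_def convergent_LIMSEQ_iff)
    have "(\<Sum>b\<in>I. p s b * l b) = 0" if s: "s \<in> T" for s
    proof (rule LIMSEQ_unique)
      show "(\<lambda>k. \<Sum>b\<in>I. p s b * y (q k) b) \<longlonglongrightarrow> (\<Sum>b\<in>I. p s b * l b)"
        by (intro tendsto_sum tendsto_mult_left l)
      have "(\<lambda>k. \<Sum>b\<in>I. p s b * w (r (q k)) b) \<longlonglongrightarrow> 0"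
        using LIMSEQ_subseq_LIMSEQ[OF lim[OF s] strict_mono_o[OF r(1) q(1)]] by (simp add: o_def)
      \<comment> \<open>Along the subsequence the norm stays above \<open>\<epsilon>\<close>, so
        normalizing costs at most the factor \<open>1 / \<epsilon>\<close>.\<close>
      then show "(\<lambda>k. \<Sum>b\<in>I. p s b * y (q k) b) \<longlonglongrightarrow> 0"
      proof (rule tendsto_0_le[where K = "1 / \<epsilon>"], intro always_eventually allI)
        fix k
        have "(\<Sum>b\<in>I. p s b * y (q k) b) = (\<Sum>b\<in>I. p s b * w (r (q k)) b) / N (r (q k))"
          by (simp add: y_def sum_divide_distrib)
        then show "norm (\<Sum>b\<in>I. p s b * y (q k) b) \<le> norm (\<Sum>b\<in>I. p s b * w (r (q k)) b) * (1 / \<epsilon>)"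
          using r(2)[of "q k"] e(1) Npos[of "q k"] by (simp add: frac_le)
      qed
    qed
    then have "\<forall>b\<in>I. l b = 0" by (rule triv)
    moreover have "(\<lambda>k. \<Sum>b\<in>I. \<bar>y (q k) b\<bar>) \<longlonglongrightarrow> (\<Sum>b\<in>I. \<bar>l b\<bar>)"
      by (intro tendsto_sum tendsto_rabs l)
    ultimately show False using LIMSEQ_unique[of "\<lambda>_. 1::real" 1 0] by (simp add: y1)
  qed
  then show ?thesis
  proof (rule tendsto_0_le[where K = 1], intro always_eventually allI)
    fix m
    have "\<bar>w m b\<bar> \<le> N m" unfolding N_def using I b by (intro member_le_sum) auto
    then show "norm (w m b) \<le> norm (N m) * 1" by simp
  qed
qed

section \<open>Linearity of iterated products, and bounded sequences\<close>

lemma mulv_cong: "(\<And>b. b \<in> V \<Longrightarrow> y b = z b) \<Longrightarrow> mulv V G y = mulv V G z"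
  by (auto simp: mulv_def intro!: sum.cong ext)

lemma mulv_add: "mulv V G (\<lambda>b. y b + z b) = (\<lambda>a. mulv V G y a + mulv V G z a)"
  by (simp add: mulv_def distrib_left sum.distrib)

lemma mulv_cmult: "mulv V G (\<lambda>b. c * z b) = (\<lambda>a. c * mulv V G z a)"
  by (simp add: mulv_def sum_distrib_left mult_ac)

lemma mulv_sum: "finite L \<Longrightarrow> mulv V G (\<lambda>b. \<Sum>l\<in>L. c l * z l b) = (\<lambda>a. \<Sum>l\<in>L. c l * mulv V G (z l) a)"
  by (rule ext) (simp add: mulv_def sum_distrib_left sum.swap[of _ L V] mult_ac)

lemma mulv_pow_add: "(mulv V G ^^ k) (\<lambda>b. y b + z b) = (\<lambda>a. (mulv V G ^^ k) y a + (mulv V G ^^ k) z a)"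
  by (induction k) (simp_all add: mulv_add)

lemma mulv_pow_cmult: "(mulv V G ^^ k) (\<lambda>b. c * z b) = (\<lambda>a. c * (mulv V G ^^ k) z a)"
  by (induction k) (simp_all add: mulv_cmult)

lemma mulv_pow_cong:
  assumes "\<And>b. b \<in> V \<Longrightarrow> y b = z b" "a \<in> V"
  shows "(mulv V G ^^ k) y a = (mulv V G ^^ k) z a"
  using assms(2)
proof (induction k arbitrary: a)
  case (Suc k)
  have "mulv V G ((mulv V G ^^ k) y) = mulv V G ((mulv V G ^^ k) z)"
    by (rule mulv_cong) (rule Suc.IH)
  then show ?case by simp
qed (simp add: assms(1))

definition unit_fun :: "'v \<Rightarrow> 'v \<Rightarrow> real" where
  "unit_fun x = (\<lambda>a. if a = x then 1 else 0)"

text \<open>The numbers \<open>(mulv V G ^^ k) (unit_fun b) a\<close> are the entries of the k-th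
  power of \<open>G\<close>. This exhibits an iterate as a fixed linear functional of
  \<open>z\<close>, the form in which limits are taken.\<close>

lemma mulv_pow_expand:
  assumes V: "finite V" and a: "a \<in> V"
  shows "(mulv V G ^^ k) z a = (\<Sum>b\<in>V. (mulv V G ^^ k) (unit_fun b) a * z b)"
proof -
  have "(\<lambda>a. \<Sum>b\<in>V. z b * (mulv V G ^^ k) (unit_fun b) a) = (mulv V G ^^ k) (\<lambda>a. \<Sum>b\<in>V. z b * unit_fun b a)"
    by (induction k) (simp_all add: mulv_sum[OF V, symmetric])
  moreover have "(mulv V G ^^ k) (\<lambda>a. \<Sum>b\<in>V. z b * unit_fun b a) a = (mulv V G ^^ k) z a"
    using V by (intro mulv_pow_cong[OF _ a]) (simp add: unit_fun_def if_distrib cong: if_cong)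
  ultimately show ?thesis by (simp add: fun_eq_iff mult.commute)
qed

lemma Bseq_plus:
  fixes f g :: "nat \<Rightarrow> real"
  assumes "Bseq f" "Bseq g"
  shows "Bseq (\<lambda>m. f m + g m)"
proof -
  obtain K L where "\<And>m. norm (f m) \<le> K" "\<And>m. norm (g m) \<le> L"
    using assms by (metis BseqE)
  then have "norm (f m + g m) \<le> K + L" for m by (rule norm_triangle_mono)
  then show ?thesis by (rule BseqI')
qed

lemma Bseq_sum:
  fixes f :: "'b \<Rightarrow> nat \<Rightarrow> real"
  shows "(\<And>b. b \<in> B \<Longrightarrow> Bseq (f b)) \<Longrightarrow> Bseq (\<lambda>m. \<Sum>b\<in>B. f b m)"
proof (induction B rule: infinite_finite_induct)
  case (insert x F)
  then show ?case by (simp add: Bseq_plus)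
qed auto

lemma Bseq_over_Suc:
  fixes f :: "nat \<Rightarrow> real"
  assumes "Bseq f"
  shows "(\<lambda>m. f m / real (Suc m)) \<longlonglongrightarrow> 0"
proof -
  obtain K where "K > 0" and K: "\<And>m. norm (f m) \<le> K" using assms by (metis BseqE)
  show ?thesis
  proof (rule tendsto_0_le[OF LIMSEQ_inverse_real_of_nat, where K = K], intro always_eventually allI)
    fix m
    have "norm (f m / real (Suc m)) = norm (f m) * inverse (real (Suc m))" by (simp add: divide_inverse abs_mult)
    also have "\<dots> \<le> K * inverse (real (Suc m))" by (intro mult_right_mono K) simp
    finally show "norm (f m / real (Suc m)) \<le> norm (inverse (real (Suc m))) * K" by (simp add: mult.commute)
  qed
qed

section \<open>Minimum of the Rayleigh quotient on an invariant subspace\<close>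

lemma quadratic_nonneg_imp_linear_zero:
  fixes b c :: real
  assumes "\<And>t. 0 \<le> 2 * t * b + t\<^sup>2 * c"
  shows "b = 0"
proof (rule ccontr)
  assume b: "b \<noteq> 0"
  \<comment> \<open>At \<open>t = - b / K\<close> the quadratic equals
    \<open>b^2 / K^2 * (c - 2 * K)\<close>, negative as soon as \<open>2 * K\<close> exceeds
    \<open>c\<close>.\<close>
  define K where "K = \<bar>c\<bar> + 1"
  have K: "0 < K" "c < 2 * K" by (auto simp: K_def)
  have "0 \<le> 2 * (- b / K) * b + (- b / K)\<^sup>2 * c" by (rule assms)
  also have "\<dots> = b\<^sup>2 / K\<^sup>2 * (c - 2 * K)"
    using K by (simp add: field_simps power2_eq_square)
  also have "\<dots> < 0" using b K by (intro mult_pos_neg) auto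
  finally show False by simp
qed

text \<open>If the form were negative somewhere on \<open>K\<close>, its minimum over the unit
  sphere of \<open>K\<close> would be negative. At a minimizer the first variation vanishes in the
  directions of \<open>K\<close>; as \<open>K\<close> is invariant, the minimizer is an eigenvector,
  which \<open>eig\<close> excludes.\<close>

lemma rayleigh_nonneg:
  fixes A :: "'v \<Rightarrow> 'v \<Rightarrow> real" and h :: "'e \<Rightarrow> 'v \<Rightarrow> real"
  assumes I: "finite I"
    and sym: "\<And>a b. a \<in> I \<Longrightarrow> b \<in> I \<Longrightarrow> A a b = A b a"
    and K: "\<And>z. z \<in> K \<longleftrightarrow> (\<forall>e\<in>H. (\<Sum>b\<in>I. h e b * z b) = 0)"
    and inv: "\<And>z. z \<in> K \<Longrightarrow> mulv I A z \<in> K"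
    and eig: "\<And>\<mu> v. \<mu> < 0 \<Longrightarrow> v \<in> K \<Longrightarrow> \<forall>a\<in>I. mulv I A v a = \<mu> * v a \<Longrightarrow> \<forall>a\<in>I. v a = 0"
    and z: "z \<in> K"
  shows "0 \<le> (\<Sum>a\<in>I. z a * mulv I A z a)"
proof (rule ccontr)
  define q where "q z = (\<Sum>a\<in>I. z a * mulv I A z a)" for z
  define s where "s z = (\<Sum>a\<in>I. (z a)\<^sup>2)" for z :: "'v \<Rightarrow> real"
  assume "\<not> ?thesis"
  then have qz: "q z < 0" by (simp add: q_def)
  have s0: "0 \<le> s y" for y by (simp add: s_def sum_nonneg)
  have s_eq0: "s y = 0 \<longleftrightarrow> (\<forall>a\<in>I. y a = 0)" for y using I by (simp add: s_def sum_nonneg_eq_0_iff)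
  have q_eq0: "q y = 0" if "s y = 0" for y using that unfolding s_eq0 by (simp add: q_def)
  have K_add: "(\<lambda>a. x a + c * y a) \<in> K" if "x \<in> K" "y \<in> K" for x y c
  proof -
    have "(\<Sum>b\<in>I. h e b * (x b + c * y b)) = (\<Sum>b\<in>I. h e b * x b) + c * (\<Sum>b\<in>I. h e b * y b)" for e
      by (simp add: algebra_simps sum.distrib sum_distrib_left)
    then show ?thesis using that unfolding K by simp
  qed
  have K_zero: "(\<lambda>_. 0) \<in> K" by (simp add: K)
  have K_cmult: "(\<lambda>a. c * y a) \<in> K" if "y \<in> K" for c y using K_add[OF K_zero that, of c] by simp
  have q_cmult: "q (\<lambda>a. c * y a) = c\<^sup>2 * q y" for c y
    by (simp add: q_def mulv_cmult power2_eq_square sum_distrib_left mult_ac)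
  have s_cmult: "s (\<lambda>a. c * y a) = c\<^sup>2 * s y" for c y
    by (simp add: s_def power_mult_distrib sum_distrib_left)
  have swap: "(\<Sum>a\<in>I. y a * mulv I A x a) = (\<Sum>a\<in>I. x a * mulv I A y a)" for x y
  proof -
    have "(\<Sum>a\<in>I. y a * mulv I A x a) = (\<Sum>a\<in>I. \<Sum>b\<in>I. A a b * (x b * y a))"
      by (simp add: mulv_def sum_distrib_left mult_ac)
    also have "\<dots> = (\<Sum>b\<in>I. \<Sum>a\<in>I. A b a * (x b * y a))"
      by (subst sum.swap) (simp add: sym)
    also have "\<dots> = (\<Sum>a\<in>I. x a * mulv I A y a)"
      by (simp add: mulv_def sum_distrib_left mult_ac)
    finally show ?thesis .
  qed
  define R where "R = {q y |y. y \<in> K \<and> s y = 1}"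
  have "s z \<noteq> 0" using q_eq0 qz by auto
  then have sz: "0 < s z" using s0[of z] by simp
  have norm1: "s (\<lambda>a. (1 / sqrt (s y)) * y a) = 1" "q (\<lambda>a. (1 / sqrt (s y)) * y a) = q y / s y" if "0 < s y" for y
    using that unfolding s_cmult q_cmult by (simp_all add: power_divide)
  have mem: "q y / s y \<in> R" if "y \<in> K" "0 < s y" for y
    unfolding R_def using norm1[OF that(2)] K_cmult[OF that(1), of "1 / sqrt (s y)"] by (metis (mono_tags, lifting) mem_Collect_eq)
  have comp_le: "\<bar>y a\<bar> \<le> 1" if "s y = 1" "a \<in> I" for y a
  proof -
    have "(y a)\<^sup>2 \<le> s y" unfolding s_def using I that(2) by (intro member_le_sum) auto
    then show ?thesis using that(1) by (simp add: abs_square_le_1)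
  qed
  have "bdd_below R"
  proof (rule bdd_belowI)
    fix x assume "x \<in> R"
    then obtain y where y: "x = q y" "s y = 1" by (auto simp: R_def)
    have "\<bar>q y\<bar> \<le> (\<Sum>a\<in>I. \<Sum>b\<in>I. \<bar>A a b\<bar>)"
    proof -
      have "q y = (\<Sum>a\<in>I. \<Sum>b\<in>I. A a b * (y b * y a))" by (simp add: q_def mulv_def sum_distrib_left mult_ac)
      also have "\<bar>\<dots>\<bar> \<le> (\<Sum>a\<in>I. \<Sum>b\<in>I. \<bar>A a b * (y b * y a)\<bar>)"
        by (intro order_trans[OF sum_abs] sum_mono sum_abs)
      also have "\<dots> \<le> (\<Sum>a\<in>I. \<Sum>b\<in>I. \<bar>A a b\<bar>)"
        using comp_le[OF y(2)] by (intro sum_mono) (simp add: abs_mult mult_left_le mult_le_one)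
      finally show ?thesis .
    qed
    then show "- (\<Sum>a\<in>I. \<Sum>b\<in>I. \<bar>A a b\<bar>) \<le> x" using y(1) by simp
  qed
  define \<mu> where "\<mu> = Inf R"
  have low: "\<mu> \<le> x" if "x \<in> R" for x unfolding \<mu>_def using that \<open>bdd_below R\<close> by (rule cInf_lower)
  have "q z / s z < 0" using qz sz by (simp add: divide_neg_pos)
  then have mu: "\<mu> < 0" using low[OF mem[OF z sz]] by simp
  have "\<exists>y. y \<in> K \<and> s y = 1 \<and> q y < \<mu> + inverse (real (Suc m))" for m
  proof -
    have "\<exists>x\<in>R. x < \<mu> + inverse (real (Suc m))"
      unfolding \<mu>_def using mem[OF z sz] \<open>bdd_below R\<close> by (subst cInf_less_iff[symmetric]) auto
    then show ?thesis by (auto simp: R_def)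
  qed
  then obtain f where f: "\<And>m. f m \<in> K" "\<And>m. s (f m) = 1" "\<And>m. q (f m) < \<mu> + inverse (real (Suc m))" by metis
  have "Bseq (\<lambda>m. f m a)" if "a \<in> I" for a
    using comp_le[OF f(2) that] by (intro BseqI'[of _ 1]) simp
  from bounded_family_convergent_subsequence[of I f, OF I this]
  obtain r where r: "strict_mono r" "\<And>b. b \<in> I \<Longrightarrow> convergent (\<lambda>k. f (r k) b)" by blast
  define x where "x b = lim (\<lambda>k. f (r k) b)" for b
  have x: "(\<lambda>k. f (r k) b) \<longlonglongrightarrow> x b" if "b \<in> I" for b
    using r(2)[OF that] by (simp add: x_def convergent_LIMSEQ_iff)
  have xK: "x \<in> K"
    unfolding K
  proof
    fix e assume e: "e \<in> H"
    have "(\<lambda>k. \<Sum>b\<in>I. h e b * f (r k) b) \<longlonglongrightarrow> (\<Sum>b\<in>I. h e b * x b)"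
      by (intro tendsto_sum tendsto_mult_left x)
    moreover have "(\<Sum>b\<in>I. h e b * f (r k) b) = 0" for k using f(1) e unfolding K by blast
    ultimately have "(\<lambda>k. 0) \<longlonglongrightarrow> (\<Sum>b\<in>I. h e b * x b)" by simp
    from LIMSEQ_unique[OF tendsto_const this] show "(\<Sum>b\<in>I. h e b * x b) = 0" by simp
  qed
  have "(\<lambda>k. s (f (r k))) \<longlonglongrightarrow> s x" unfolding s_def by (intro tendsto_sum tendsto_power x)
  then have sx: "s x = 1" using LIMSEQ_unique[of "\<lambda>_. 1::real"] by (simp add: f(2))
  have ql: "(\<lambda>k. q (f (r k))) \<longlonglongrightarrow> q x"
    unfolding q_def mulv_def by (intro tendsto_sum tendsto_mult x tendsto_const)
  have "q x \<le> \<mu>"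
  proof (rule LIMSEQ_le[OF ql])
    have "(\<lambda>k. \<mu> + inverse (real (Suc (r k)))) \<longlonglongrightarrow> \<mu> + 0"
      using LIMSEQ_subseq_LIMSEQ[OF LIMSEQ_inverse_real_of_nat r(1)]
      by (intro tendsto_add tendsto_const) (simp add: o_def)
    then show "(\<lambda>k. \<mu> + inverse (real (Suc (r k)))) \<longlonglongrightarrow> \<mu>" by simp
  qed (use f(3) less_imp_le in blast)
  then have qx: "q x = \<mu>" using low[OF mem[OF xK]] sx by simp
  have ge: "\<mu> * s y \<le> q y" if "y \<in> K" for y
  proof (cases "s y = 0")
    case False
    then have "0 < s y" using s0[of y] by simp
    then show ?thesis using low[OF mem[OF that]] by (simp add: le_divide_eq)
  qed (simp add: q_eq0)
  \<comment> \<open>First variation: \<open>q - \<mu> * s\<close> is nonnegative on \<open>K\<close>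
    and vanishes at \<open>x\<close>, so its linear term in every direction \<open>y\<close> of
    \<open>K\<close> is zero.\<close>
  have crit: "(\<Sum>a\<in>I. y a * mulv I A x a) = \<mu> * (\<Sum>a\<in>I. y a * x a)" if y: "y \<in> K" for y
  proof -
    define b where "b = (\<Sum>a\<in>I. y a * mulv I A x a) - \<mu> * (\<Sum>a\<in>I. y a * x a)"
    have "0 \<le> 2 * t * b + t\<^sup>2 * (q y - \<mu> * s y)" for t
    proof -
      have "q (\<lambda>a. x a + t * y a) = q x + 2 * t * (\<Sum>a\<in>I. y a * mulv I A x a) + t\<^sup>2 * q y"
      proof -
        have "q (\<lambda>a. x a + t * y a) = q x + t * (\<Sum>a\<in>I. x a * mulv I A y a)
            + t * (\<Sum>a\<in>I. y a * mulv I A x a) + t\<^sup>2 * q y"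
          by (simp add: q_def mulv_add mulv_cmult algebra_simps sum.distrib sum_distrib_left power2_eq_square)
        then show ?thesis by (simp add: swap[of x y])
      qed
      moreover have "s (\<lambda>a. x a + t * y a) = s x + 2 * t * (\<Sum>a\<in>I. y a * x a) + t\<^sup>2 * s y"
        by (simp add: s_def algebra_simps sum.distrib sum_distrib_left power2_eq_square)
      ultimately show ?thesis
        using ge[OF K_add[OF xK y, of t]] by (simp add: qx sx b_def algebra_simps)
    qed
    then have "b = 0" by (rule quadratic_nonneg_imp_linear_zero)
    then show ?thesis by (simp add: b_def)
  qed
  \<comment> \<open>The residual \<open>A x - \<mu> x\<close> lies in \<open>K\<close> by
    invariance. Taken as the direction in \<open>crit\<close>, it is orthogonal to itself.\<close>
  define y where "y a = mulv I A x a + (- \<mu>) * x a" for a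
  have "y \<in> K" unfolding y_def by (rule K_add[OF inv[OF xK] xK])
  from crit[OF this] have "s y = 0"
    by (simp add: s_def y_def power2_eq_square algebra_simps sum.distrib sum_subtractf sum_distrib_left)
  then have "\<forall>a\<in>I. mulv I A x a = \<mu> * x a" unfolding s_eq0 by (simp add: y_def)
  from eig[OF mu xK this] have "s x = 0" by (simp add: s_eq0)
  then show False using sx by simp
qed

section \<open>Coupling a component to an observable system\<close>

text \<open>\<open>U\<close> holds the output vertices. In use they belong to \<open>V\<close>, so
  one symmetric \<open>G\<close> describes the states together with their outputs, and
  \<open>i = 0\<close> makes \<open>z\<close> itself vanish on \<open>U\<close>.\<close>

definition unobservable :: "'v set \<Rightarrow> 'v set \<Rightarrow> ('v \<Rightarrow> 'v \<Rightarrow> real) \<Rightarrow> ('v \<Rightarrow> real) \<Rightarrow> bool" where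
  "unobservable V U G z \<longleftrightarrow> (\<forall>i. \<forall>u\<in>U. (mulv V G ^^ i) z u = 0)"

text \<open>An unobservable vector is determined by its values on \<open>V \<inter> F\<close>, so
  the number of these vertices bounds the dimension of the unobservable space.\<close>

definition observable_modulo :: "'v set \<Rightarrow> 'v set \<Rightarrow> 'v set \<Rightarrow> ('v \<Rightarrow> 'v \<Rightarrow> real) \<Rightarrow> bool" where
  "observable_modulo V U F G \<longleftrightarrow>
     (\<forall>z. unobservable V U G z \<longrightarrow> (\<forall>a\<in>V \<inter> F. z a = 0) \<longrightarrow> (\<forall>a\<in>V. z a = 0))"

text \<open>Two blocks bridged by one undirected edge. \<open>t\<close> and \<open>e\<close> are
  separate parameters because \<open>t\<close> is sent to infinity for cycles and \<open>e\<close>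
  to zero for single vertices.\<close>

definition coupled :: "'v set \<Rightarrow> 'v set \<Rightarrow> 'v \<Rightarrow> 'v \<Rightarrow> ('v \<Rightarrow> 'v \<Rightarrow> real) \<Rightarrow> ('v \<Rightarrow> 'v \<Rightarrow> real) \<Rightarrow>
    real \<Rightarrow> real \<Rightarrow> 'v \<Rightarrow> 'v \<Rightarrow> real" where
  "coupled S C x y G N t e a b =
     (if a \<in> S \<and> b \<in> S then G a b
      else if a \<in> C \<and> b \<in> C then t * N a b
      else if a = x \<and> b = y \<or> a = y \<and> b = x then e else 0)"

context
  fixes S C U F :: "'v set" and x y :: 'v and G N :: "'v \<Rightarrow> 'v \<Rightarrow> real"
  assumes S: "finite S" and C: "finite C" and disj: "S \<inter> C = {}" and U: "U \<subseteq> S"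
    and x: "x \<in> S" and y: "y \<in> C" and obsS: "observable_modulo S U F G"
begin

lemma coupled_S:
  assumes "a \<in> S"
  shows "mulv (S \<union> C) (coupled S C x y G N t e) z a = mulv S G z a + (if a = x then e * z y else 0)"
proof -
  have bS: "b \<notin> S" if "b \<in> C" for b using disj that by blast
  have aC: "a \<notin> C" "a \<noteq> y" using assms disj y by auto
  have "(\<Sum>b\<in>C. coupled S C x y G N t e a b * z b) = (\<Sum>b\<in>C. if b = y then (if a = x then e * z y else 0) else 0)"
    by (intro sum.cong refl) (simp add: coupled_def aC bS)
  moreover have "(\<Sum>b\<in>S. coupled S C x y G N t e a b * z b) = mulv S G z a"
    unfolding mulv_def by (intro sum.cong refl) (simp add: coupled_def assms)
  ultimately show ?thesis
    using S C disj y by (simp add: mulv_def[of "S \<union> C"] sum.union_disjoint)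
qed

lemma coupled_C:
  assumes "a \<in> C"
  shows "mulv (S \<union> C) (coupled S C x y G N t e) z a = t * mulv C N z a + (if a = y then e * z x else 0)"
proof -
  have bC: "b \<notin> C" if "b \<in> S" for b using disj that by blast
  have aS: "a \<notin> S" "a \<noteq> x" using assms disj x by auto
  have "(\<Sum>b\<in>S. coupled S C x y G N t e a b * z b) = (\<Sum>b\<in>S. if b = x then (if a = y then e * z x else 0) else 0)"
    by (intro sum.cong refl) (simp add: coupled_def aS bC)
  moreover have "(\<Sum>b\<in>C. coupled S C x y G N t e a b * z b) = t * mulv C N z a"
    unfolding mulv_def sum_distrib_left
    by (intro sum.cong refl) (simp add: coupled_def aS assms mult.assoc)
  ultimately show ?thesis
    using S C disj x by (simp add: mulv_def[of "S \<union> C"] sum.union_disjoint)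
qed

text \<open>Discrete variation of constants: seen from \<open>S\<close>, the component is a signal,
  \<open>e\<close> times the value at \<open>y\<close>, that enters at \<open>x\<close> and is
  answered by the impulse response \<open>(mulv S G ^^ l) (unit_fun x)\<close>.\<close>

lemma coupled_pow_S:
  fixes t e z
  defines "W \<equiv> \<lambda>i. (mulv (S \<union> C) (coupled S C x y G N t e) ^^ i) z"
  assumes "a \<in> S"
  shows "W i a = (mulv S G ^^ i) z a + (\<Sum>l<i. e * W (i - 1 - l) y * (mulv S G ^^ l) (unit_fun x) a)"
  using assms(2)
proof (induction i arbitrary: a)
  case 0
  then show ?case by (simp add: W_def)
next
  case (Suc i)
  let ?P = "mulv S G"
  have "W (Suc i) a = ?P (W i) a + (if a = x then e * W i y else 0)"
    using coupled_S[OF Suc.prems] by (simp add: W_def)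
  also have "?P (W i) = ?P (\<lambda>a. (?P ^^ i) z a + (\<Sum>l<i. (e * W (i - 1 - l) y) * (?P ^^ l) (unit_fun x) a))"
    by (rule mulv_cong) (simp add: Suc.IH)
  also have "\<dots> = (\<lambda>a. (?P ^^ Suc i) z a + (\<Sum>l<i. (e * W (i - 1 - l) y) * (?P ^^ Suc l) (unit_fun x) a))"
    by (simp add: mulv_add mulv_sum)
  also have "(if a = x then e * W i y else 0) = e * W i y * unit_fun x a" by (simp add: unit_fun_def)
  also have "(?P ^^ Suc i) z a + (\<Sum>l<i. e * W (i - 1 - l) y * (?P ^^ Suc l) (unit_fun x) a) +
      e * W i y * unit_fun x a =
      (?P ^^ Suc i) z a + (\<Sum>l<Suc i. e * W (Suc i - 1 - l) y * (?P ^^ l) (unit_fun x) a)"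
    by (subst sum.lessThan_Suc_shift) simp
  finally show ?case .
qed

text \<open>Seen from \<open>C\<close>, one coupled step is \<open>t\<close> times a step of
  \<open>N\<close> plus a disturbance at \<open>y\<close>. Read backwards, one more power of
  \<open>N\<close> costs one more iterate and gains a factor \<open>1 / t\<close>.\<close>

lemma coupled_pow_C:
  fixes t e z
  defines "W \<equiv> \<lambda>i. (mulv (S \<union> C) (coupled S C x y G N t e) ^^ i) z"
  shows "(mulv C N ^^ s) (W (Suc j)) y =
    t * (mulv C N ^^ Suc s) (W j) y + e * W j x * (mulv C N ^^ s) (unit_fun y) y"
proof -
  have "(mulv C N ^^ s) (W (Suc j)) y =
      (mulv C N ^^ s) (\<lambda>a. t * mulv C N (W j) a + (e * W j x) * unit_fun y a) y"
    using y by (intro mulv_pow_cong) (auto simp: W_def coupled_C unit_fun_def)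
  also have "\<dots> = t * (mulv C N ^^ s) (mulv C N (W j)) y + (e * W j x) * (mulv C N ^^ s) (unit_fun y) y"
    by (simp add: mulv_pow_add mulv_pow_cmult)
  finally show ?thesis by (simp only: funpow_Suc_right o_apply)
qed

text \<open>A failing choice of \<open>(t, e)\<close> has an unobservable vector, normalized here to \<open>\<ell>\<^sub>1\<close>-norm \<open>1\<close>;
  such vectors for a whole sequence of failing choices are shown to tend to \<open>0\<close>.\<close>

lemma not_observable_unit:
  assumes "\<not> observable_modulo (S \<union> C) U F' (coupled S C x y G N t e)"
  shows "\<exists>z. unobservable (S \<union> C) U (coupled S C x y G N t e) z \<and> (\<forall>a\<in>(S \<union> C) \<inter> F'. z a = 0) \<and>
    (\<Sum>a\<in>S \<union> C. \<bar>z a\<bar>) = 1"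
proof -
  let ?M = "coupled S C x y G N t e"
  obtain z a where z: "unobservable (S \<union> C) U ?M z" "\<forall>a\<in>(S \<union> C) \<inter> F'. z a = 0" "a \<in> S \<union> C" "z a \<noteq> 0"
    using assms unfolding observable_modulo_def by blast
  define s where "s = (\<Sum>a\<in>S \<union> C. \<bar>z a\<bar>)"
  have "\<bar>z a\<bar> \<le> s" unfolding s_def using S C z(3) by (intro member_le_sum) auto
  then have s: "0 < s" using z(4) by simp
  have "unobservable (S \<union> C) U ?M (\<lambda>a. (1 / s) * z a)"
    using z(1) unfolding unobservable_def by (simp only: mulv_pow_cmult) simp
  moreover have "(\<Sum>a\<in>S \<union> C. \<bar>(1 / s) * z a\<bar>) = 1"
  proof -
    have "(\<Sum>a\<in>S \<union> C. \<bar>(1 / s) * z a\<bar>) = (\<Sum>a\<in>S \<union> C. \<bar>z a\<bar>) / s"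
      using s by (simp add: abs_mult sum_divide_distrib)
    then show ?thesis using s by (simp add: s_def)
  qed
  ultimately show ?thesis using z(2) by (intro exI[of _ "\<lambda>a. (1 / s) * z a"]) simp
qed

lemma unit_family_bounded:
  assumes "\<And>m. (\<Sum>a\<in>S \<union> C. \<bar>Z m a\<bar>) = 1" "a \<in> S \<union> C"
  shows "Bseq (\<lambda>m. Z m a :: real)"
proof (rule BseqI')
  fix m
  have "\<bar>Z m a\<bar> \<le> (\<Sum>a\<in>S \<union> C. \<bar>Z m a\<bar>)" using S C assms(2) by (intro member_le_sum) auto
  then show "norm (Z m a) \<le> 1" using assms(1) by simp
qed

text \<open>Observability of \<open>S\<close> in limit form. The outputs of the uncoupled system and
  the coordinates in \<open>F\<close> are the functionals of
  \<open>common_kernel_tendsto_zero\<close>; by \<open>obsS\<close> their common kernel is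
  trivial.\<close>

lemma S_part_tendsto_zero:
  assumes "\<And>i u. u \<in> U \<Longrightarrow> (\<lambda>m. (mulv S G ^^ i) (Z m) u) \<longlonglongrightarrow> 0"
    and "\<And>m a. a \<in> S \<inter> F \<Longrightarrow> Z m a = 0" and b: "b \<in> S"
  shows "(\<lambda>m. Z m b) \<longlonglongrightarrow> 0"
proof -
  define p where "p s b = (case s of Inl (i, u) \<Rightarrow> (mulv S G ^^ i) (unit_fun b) u
      | Inr a \<Rightarrow> unit_fun a b)" for s :: "nat \<times> 'v + 'v" and b
  define T where "T = ((UNIV :: nat set) \<times> U) <+> (S \<inter> F)"
  have pl: "(\<Sum>b\<in>S. p (Inl (i, u)) b * w b) = (mulv S G ^^ i) w u" if "u \<in> U" for i :: nat and u w
  proof -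
    have "(mulv S G ^^ i) w u = (\<Sum>b\<in>S. (mulv S G ^^ i) (unit_fun b) u * w b)"
      by (rule mulv_pow_expand[OF S]) (use that U in blast)
    then show ?thesis by (simp add: p_def)
  qed
  have pr: "(\<Sum>b\<in>S. p (Inr a) b * w b) = w a" if "a \<in> S" for a w
  proof -
    have "(\<Sum>b\<in>S. p (Inr a) b * w b) = (\<Sum>b\<in>S. if b = a then w b else 0)"
      by (intro sum.cong) (auto simp: p_def unit_fun_def)
    then show ?thesis using that S by simp
  qed
  show ?thesis
  proof (rule common_kernel_tendsto_zero[OF S, where T = T and p = p, OF _ _ b])
    fix w assume w: "\<And>s. s \<in> T \<Longrightarrow> (\<Sum>b\<in>S. p s b * w b) = 0"
    have "unobservable S U G w" unfolding unobservable_def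
    proof (intro allI ballI)
      fix i :: nat and u assume u: "u \<in> U"
      then have "Inl (i, u) \<in> T" by (auto simp: T_def)
      from w[OF this] show "(mulv S G ^^ i) w u = 0" using pl[OF u] by simp
    qed
    moreover have "w a = 0" if "a \<in> S \<inter> F" for a
    proof -
      have "Inr a \<in> T" using that by (auto simp: T_def)
      from w[OF this] show ?thesis using pr[of a] that by simp
    qed
    ultimately show "\<forall>b\<in>S. w b = 0" using obsS unfolding observable_modulo_def by blast
  next
    fix s assume "s \<in> T"
    then show "(\<lambda>m. \<Sum>b\<in>S. p s b * Z m b) \<longlonglongrightarrow> 0"
      using assms(1,2) by (auto simp: T_def pl pr)
  qed
qed

lemma mulv_pow_bounded:
  assumes "\<And>a. a \<in> S \<Longrightarrow> Bseq (\<lambda>m. Z m a)" "a \<in> S"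
  shows "Bseq (\<lambda>m. (mulv S G ^^ i) (Z m) a)"
proof -
  have "(\<lambda>m. (mulv S G ^^ i) (Z m) a) = (\<lambda>m. \<Sum>b\<in>S. (mulv S G ^^ i) (unit_fun b) a * Z m b)"
    by (rule ext) (rule mulv_pow_expand[OF S assms(2)])
  then show ?thesis by (simp only:) (intro Bseq_sum Bseq_mult assms(1) Bfun_const)
qed

lemma unit_family_not_null:
  assumes "\<And>m. (\<Sum>a\<in>S \<union> C. \<bar>Z m a\<bar>) = (1::real)" "\<And>a. a \<in> S \<union> C \<Longrightarrow> (\<lambda>m. Z m a) \<longlonglongrightarrow> 0"
  shows False
proof -
  have "(\<lambda>m. \<Sum>a\<in>S \<union> C. \<bar>Z m a\<bar>) \<longlonglongrightarrow> (\<Sum>a\<in>S \<union> C. \<bar>0\<bar>)"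
    by (intro tendsto_sum tendsto_rabs assms(2))
  then show False using assms(1) LIMSEQ_unique[of "\<lambda>_. 1::real" 1 0] by simp
qed

text \<open>Suppose all weights \<open>t = m + 1\<close> fail, with unobservable unit vectors
  \<open>Z m\<close>. Vanishing outputs bound the signal at \<open>y\<close>; dividing by
  \<open>t\<close> makes the positive powers of \<open>N\<close>, read at \<open>y\<close>, tend to
  zero, so by \<open>obsC\<close> the iterates tend to zero on \<open>C\<close>. Then
  \<open>S\<close> is no longer driven and \<open>Z m\<close> tends to zero there as well, against
  norm 1. The power 0 is absent from \<open>obsC\<close> because the argument at \<open>y\<close>
  itself yields boundedness first, and a limit only after a division by \<open>t\<close>.\<close>

lemma attach_component:
  assumes obsC: "\<And>w. (\<And>s. (mulv C N ^^ Suc s) w y = 0) \<Longrightarrow> \<forall>a\<in>C. w a = 0"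
    and link: "u \<in> U" "(mulv S G ^^ k) (unit_fun x) u \<noteq> 0"
  shows "\<exists>t>0. observable_modulo (S \<union> C) U F (coupled S C x y G N t 1)"
proof (rule ccontr)
  assume neg: "\<not> ?thesis"
  let ?M = "\<lambda>m. mulv (S \<union> C) (coupled S C x y G N (real (Suc m)) 1)"
  have "\<exists>z. unobservable (S \<union> C) U (coupled S C x y G N (real (Suc m)) 1) z \<and>
      (\<forall>a\<in>(S \<union> C) \<inter> F. z a = 0) \<and> (\<Sum>a\<in>S \<union> C. \<bar>z a\<bar>) = 1" for m
    using neg by (intro not_observable_unit) (metis of_nat_0_less_iff zero_less_Suc)
  then obtain Z where Z: "\<And>m. unobservable (S \<union> C) U (coupled S C x y G N (real (Suc m)) 1) (Z m)"
    "\<And>m a. a \<in> (S \<union> C) \<inter> F \<Longrightarrow> Z m a = 0" "\<And>m. (\<Sum>a\<in>S \<union> C. \<bar>Z m a\<bar>) = 1" by metis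
  define W where "W m i = (?M m ^^ i) (Z m)" for m i
  define P where "P = mulv S G"
  define g where "g l = (P ^^ l) (unit_fun x)" for l
  have W0: "W m i u = 0" if "u \<in> U" for m i u using Z(1)[of m] that by (auto simp: unobservable_def W_def)
  have WS: "W m i a = (P ^^ i) (Z m) a + (\<Sum>l<i. W m (i - 1 - l) y * g l a)" if "a \<in> S" for m i a
    using coupled_pow_S[OF that, where t = "real (Suc m)" and e = 1 and z = "Z m" and i = i] by (simp add: W_def P_def g_def)
  have ZB: "Bseq (\<lambda>m. Z m a)" if "a \<in> S \<union> C" for a using unit_family_bounded[OF Z(3) that] .
  have PB: "Bseq (\<lambda>m. (P ^^ i) (Z m) a)" if "a \<in> S" for i a
    unfolding P_def using ZB that by (intro mulv_pow_bounded) auto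
  \<comment> \<open>The delay of the earliest response at \<open>u\<close> to an impulse at
    \<open>x\<close>; it allows the output equation to be solved for the signal at
    \<open>y\<close>.\<close>
  define k0 where "k0 = (LEAST k. g k u \<noteq> 0)"
  have gk: "g k0 u \<noteq> 0" unfolding k0_def by (rule LeastI[of _ k]) (simp add: g_def P_def link)
  have gl: "g l u = 0" if "l < k0" for l using not_less_Least that unfolding k0_def by blast
  have uS: "u \<in> S" using link U by auto
  \<comment> \<open>In the output at iterate \<open>j + k0 + 1\<close> the signal value
    \<open>W m j y\<close> has the nonzero coefficient \<open>g k0 u\<close>, and all other signal
    values that occur have an index below \<open>j\<close>.\<close>
  have yB: "Bseq (\<lambda>m. W m j y)" for j
  proof (induction j rule: less_induct)
    case (less j)
    have "W m j y = - (1 / g k0 u) *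
        ((P ^^ (j + k0 + 1)) (Z m) u + (\<Sum>l\<in>{k0<..<j + k0 + 1}. W m (j + k0 - l) y * g l u))" for m
    proof -
      have "(\<Sum>l<j + k0 + 1. W m (j + k0 - l) y * g l u) =
          (\<Sum>l\<in>insert k0 {k0<..<j + k0 + 1}. W m (j + k0 - l) y * g l u)"
        by (rule sum.mono_neutral_right) (auto simp: gl)
      also have "\<dots> = W m j y * g k0 u + (\<Sum>l\<in>{k0<..<j + k0 + 1}. W m (j + k0 - l) y * g l u)"
        by simp
      finally have "0 = (P ^^ (j + k0 + 1)) (Z m) u + (W m j y * g k0 u +
          (\<Sum>l\<in>{k0<..<j + k0 + 1}. W m (j + k0 - l) y * g l u))"
        using WS[OF uS, of m "j + k0 + 1"] W0[OF link(1)] by simp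
      then show ?thesis using gk by (simp add: field_simps)
    qed
    moreover have "Bseq (\<lambda>m. - (1 / g k0 u) *
        ((P ^^ (j + k0 + 1)) (Z m) u + (\<Sum>l\<in>{k0<..<j + k0 + 1}. W m (j + k0 - l) y * g l u)))"
      by (intro Bseq_mult Bfun_const Bseq_plus PB uS Bseq_sum less) auto
    ultimately show ?case by simp
  qed
  have SB: "Bseq (\<lambda>m. W m i a)" if "a \<in> S" for i a
    unfolding WS[OF that] by (intro Bseq_plus Bseq_sum Bseq_mult Bfun_const yB PB that)
  have step: "(\<lambda>m. (mulv C N ^^ Suc s) (W m j) y) \<longlonglongrightarrow> 0"
    if "Bseq (\<lambda>m. (mulv C N ^^ s) (W m (Suc j)) y)" for s j
  proof -
    have "(mulv C N ^^ Suc s) (W m j) y =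
        ((mulv C N ^^ s) (W m (Suc j)) y + W m j x * - (mulv C N ^^ s) (unit_fun y) y) / real (Suc m)" for m
      using coupled_pow_C[where s = s and t = "real (Suc m)" and e = 1 and j = j and z = "Z m"] unfolding W_def
      by (simp add: field_simps del: funpow.simps of_nat_Suc)
    moreover have "(\<lambda>m. ((mulv C N ^^ s) (W m (Suc j)) y + W m j x * - (mulv C N ^^ s) (unit_fun y) y)
        / real (Suc m)) \<longlonglongrightarrow> 0"
      by (intro Bseq_over_Suc Bseq_plus Bseq_mult Bfun_const SB x that)
    ultimately show ?thesis by simp
  qed
  \<comment> \<open>The base case uses the bound at \<open>y\<close>. After that, a convergent
    sequence is bounded, so \<open>step\<close> applies again.\<close>
  have tend: "(\<lambda>m. (mulv C N ^^ Suc s) (W m j) y) \<longlonglongrightarrow> 0" for s j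
  proof (induction s arbitrary: j)
    case 0
    show ?case using step[of 0 j] yB[of "Suc j"] by simp
  next
    case (Suc s)
    have "Bseq (\<lambda>m. (mulv C N ^^ Suc s) (W m (Suc j)) y)"
      using Suc.IH[of "Suc j"] by (intro convergent_imp_Bseq convergentI)
    then show ?case by (rule step)
  qed
  have WC: "(\<lambda>m. W m j b) \<longlonglongrightarrow> 0" if b: "b \<in> C" for j b
  proof (rule common_kernel_tendsto_zero[OF C, where T = UNIV and
        p = "\<lambda>s b. (mulv C N ^^ Suc s) (unit_fun b) y", OF _ _ b])
    fix w :: "'v \<Rightarrow> real"
    assume "\<And>s. s \<in> UNIV \<Longrightarrow> (\<Sum>b\<in>C. (mulv C N ^^ Suc s) (unit_fun b) y * w b) = 0"
    then have "(mulv C N ^^ Suc s) w y = 0" for s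
      using mulv_pow_expand[OF C y, of "Suc s" N w] by (simp del: funpow.simps)
    then show "\<forall>b\<in>C. w b = 0" by (rule obsC)
  next
    fix s
    have "(\<lambda>m. (mulv C N ^^ Suc s) (W m j) y) =
        (\<lambda>m. \<Sum>b\<in>C. (mulv C N ^^ Suc s) (unit_fun b) y * W m j b)"
      by (rule ext) (rule mulv_pow_expand[OF C y])
    then show "(\<lambda>m. \<Sum>b\<in>C. (mulv C N ^^ Suc s) (unit_fun b) y * W m j b) \<longlonglongrightarrow> 0"
      using tend[of s j] by (simp only:)
  qed
  \<comment> \<open>The true outputs are zero, so the outputs of the uncoupled system equal minus
    the response to the signal, which fades.\<close>
  have "(\<lambda>m. (P ^^ i) (Z m) v) \<longlonglongrightarrow> 0" if v: "v \<in> U" for i v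
  proof -
    have "(P ^^ i) (Z m) v = - (\<Sum>l<i. W m (i - 1 - l) y * g l v)" for m
      using WS[of v m i] W0[OF v] v U by auto
    moreover have "(\<lambda>m. - (\<Sum>l<i. W m (i - 1 - l) y * g l v)) \<longlonglongrightarrow> - (\<Sum>l<i. 0 * g l v)"
      by (intro tendsto_minus tendsto_sum tendsto_mult_right WC y)
    ultimately show ?thesis by simp
  qed
  then have "(\<lambda>m. Z m b) \<longlonglongrightarrow> 0" if "b \<in> S" for b
    using S_part_tendsto_zero[of Z b] Z(2) that by (auto simp: P_def)
  moreover have "(\<lambda>m. Z m b) \<longlonglongrightarrow> 0" if "b \<in> C" for b using WC[OF that, of 0] by (simp add: W_def)
  ultimately show False using unit_family_not_null[of Z] Z(3) by blast
qed

text \<open>At \<open>e = 0\<close> observability would be plain, since \<open>y\<close> is in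
  \<open>insert y F\<close>; a positive \<open>e\<close> is wanted so that more can be attached
  through \<open>y\<close>. If \<open>e = 1 / (m + 1)\<close> failed for every \<open>m\<close>, the
  signal at \<open>y\<close> would stay bounded and the factor \<open>e\<close> would make it
  negligible on \<open>S\<close>.\<close>

lemma attach_vertex:
  assumes Cy: "C = {y}" and N: "N y y = 0"
  shows "\<exists>e>0. observable_modulo (S \<union> C) U (insert y F) (coupled S C x y G N 1 e)"
proof (rule ccontr)
  assume neg: "\<not> ?thesis"
  let ?e = "\<lambda>m. inverse (real (Suc m))"
  let ?M = "\<lambda>m. mulv (S \<union> C) (coupled S C x y G N 1 (?e m))"
  have "\<exists>z. unobservable (S \<union> C) U (coupled S C x y G N 1 (?e m)) z \<and>
      (\<forall>a\<in>(S \<union> C) \<inter> insert y F. z a = 0) \<and> (\<Sum>a\<in>S \<union> C. \<bar>z a\<bar>) = 1" for m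
    using neg by (intro not_observable_unit) (metis inverse_positive_iff_positive of_nat_0_less_iff zero_less_Suc)
  then obtain Z where Z: "\<And>m. unobservable (S \<union> C) U (coupled S C x y G N 1 (?e m)) (Z m)"
    "\<And>m a. a \<in> (S \<union> C) \<inter> insert y F \<Longrightarrow> Z m a = 0" "\<And>m. (\<Sum>a\<in>S \<union> C. \<bar>Z m a\<bar>) = 1" by metis
  define W where "W m i = (?M m ^^ i) (Z m)" for m i
  define P where "P = mulv S G"
  define g where "g l = (P ^^ l) (unit_fun x)" for l
  have W0: "W m i u = 0" if "u \<in> U" for m i u using Z(1)[of m] that by (auto simp: unobservable_def W_def)
  have WS: "W m i a = (P ^^ i) (Z m) a + (\<Sum>l<i. ?e m * W m (i - 1 - l) y * g l a)" if "a \<in> S" for m i a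
    using coupled_pow_S[OF that, where t = 1 and e = "?e m" and z = "Z m" and i = i] by (simp add: W_def P_def g_def)
  have ZB: "Bseq (\<lambda>m. Z m a)" if "a \<in> S \<union> C" for a using unit_family_bounded[OF Z(3) that] .
  have PB: "Bseq (\<lambda>m. (P ^^ i) (Z m) a)" if "a \<in> S" for i a
    unfolding P_def using ZB that by (intro mulv_pow_bounded) auto
  have eB: "Bseq ?e" using LIMSEQ_inverse_real_of_nat by (intro convergent_imp_Bseq convergentI)
  have yB: "Bseq (\<lambda>m. W m j y)" for j
  proof (induction j rule: less_induct)
    case (less j)
    show ?case
    proof (cases j)
      case 0
      then show ?thesis using ZB[of y] y by (simp add: W_def)
    next
      case (Suc i)
      \<comment> \<open>As \<open>N y y = 0\<close>, the next value at \<open>y\<close> arrives only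
        over the edge from \<open>x\<close>.\<close>
      have "W m j y = ?e m * W m i x" for m
        using coupled_C[OF y, where t = 1 and e = "?e m" and z = "W m i"] Suc Cy N by (simp add: W_def mulv_def)
      moreover have "Bseq (\<lambda>m. ?e m * W m i x)"
        unfolding WS[OF x] using Suc
        by (intro Bseq_plus Bseq_sum Bseq_mult Bfun_const eB less PB x) auto
      ultimately show ?thesis by simp
    qed
  qed
  have "(\<lambda>m. (P ^^ i) (Z m) v) \<longlonglongrightarrow> 0" if v: "v \<in> U" for i v
  proof -
    have "(P ^^ i) (Z m) v = (- (\<Sum>l<i. W m (i - 1 - l) y * g l v)) / real (Suc m)" for m
    proof -
      have "(P ^^ i) (Z m) v = - (\<Sum>l<i. ?e m * W m (i - 1 - l) y * g l v)"
        using WS[of v m i] W0[OF v] v U by auto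
      then show ?thesis by (simp add: divide_inverse mult_ac sum_distrib_left)
    qed
    moreover have "(\<lambda>m. (- (\<Sum>l<i. W m (i - 1 - l) y * g l v)) / real (Suc m)) \<longlonglongrightarrow> 0"
      unfolding sum_negf[symmetric]
      by (intro Bseq_over_Suc Bseq_sum) (simp add: Bseq_minus_iff, intro Bseq_mult yB Bfun_const)
    ultimately show ?thesis by simp
  qed
  then have "(\<lambda>m. Z m b) \<longlonglongrightarrow> 0" if "b \<in> S" for b
    using S_part_tendsto_zero[of Z b] Z(2) that by (auto simp: P_def)
  moreover have "(\<lambda>m. Z m b) \<longlonglongrightarrow> 0" if "b \<in> C" for b using Z(2)[of y] y Cy that by simp
  ultimately show False using unit_family_not_null[of Z] Z(3) by blast
qed

end

section \<open>Symmetric matrices on cycles\<close>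

text \<open>Every arc of the cyclic list enters together with its reverse, so an edge of a cycle of length
  \<open>2\<close> receives both weights and a loop receives twice its weight.\<close>

definition cycle_matrix :: "'v list \<Rightarrow> (nat \<Rightarrow> real) \<Rightarrow> 'v \<Rightarrow> 'v \<Rightarrow> real" where
  "cycle_matrix vs w a b = (\<Sum>k<length vs.
     (if a = vs ! k \<and> b = vs ! (Suc k mod length vs) then w k else 0) +
     (if b = vs ! k \<and> a = vs ! (Suc k mod length vs) then w k else 0))"

lemma cycle_matrix_sym: "cycle_matrix vs w a b = cycle_matrix vs w b a"
  unfolding cycle_matrix_def by (intro sum.cong refl add.commute)

lemma cycle_matrix_nonneg: "(\<And>k. 0 \<le> w k) \<Longrightarrow> 0 \<le> cycle_matrix vs w a b"
  unfolding cycle_matrix_def by (intro sum_nonneg) auto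

lemma cycle_matrix_nonzero:
  assumes "cycle_matrix vs w a b \<noteq> 0"
  shows "\<exists>k<length vs. (a = vs ! k \<and> b = vs ! (Suc k mod length vs)) \<or>
    (b = vs ! k \<and> a = vs ! (Suc k mod length vs))"
proof (rule ccontr)
  assume neg: "\<not> ?thesis"
  have "cycle_matrix vs w a b = 0"
    unfolding cycle_matrix_def
  proof (intro sum.neutral ballI)
    fix k assume "k \<in> {..<length vs}"
    then have "\<not> (a = vs ! k \<and> b = vs ! (Suc k mod length vs))"
      "\<not> (b = vs ! k \<and> a = vs ! (Suc k mod length vs))" using neg by blast+
    then show "(if a = vs ! k \<and> b = vs ! (Suc k mod length vs) then w k else 0) +
      (if b = vs ! k \<and> a = vs ! (Suc k mod length vs) then w k else 0) = 0" by (simp only: if_False)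
  qed
  then show False using assms by simp
qed

lemma cycle_matrix_pos:
  assumes "\<And>k. 0 < w k" "k < length vs"
  shows "0 < cycle_matrix vs w (vs ! (Suc k mod length vs)) (vs ! k)"
proof -
  let ?f = "\<lambda>i. (if vs ! (Suc k mod length vs) = vs ! i \<and> vs ! k = vs ! (Suc i mod length vs) then w i else 0) +
     (if vs ! k = vs ! i \<and> vs ! (Suc k mod length vs) = vs ! (Suc i mod length vs) then w i else 0)"
  have "0 \<le> w i" for i using assms(1)[of i] by simp
  then have "0 \<le> ?f i" for i by (intro add_nonneg_nonneg) (simp_all split: if_split)
  moreover have "0 < ?f k" using assms(1)[of k] by simp
  ultimately show ?thesis
    unfolding cycle_matrix_def using assms(2) by (intro sum_pos2[of _ k]) simp_all
qed

lemma mulv_cycle_matrix: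
  assumes "finite V" "set vs \<subseteq> V"
  shows "mulv V (cycle_matrix vs w) z a = (\<Sum>k<length vs.
     (if a = vs ! k then w k * z (vs ! (Suc k mod length vs)) else 0) +
     (if a = vs ! (Suc k mod length vs) then w k * z (vs ! k) else 0))"
proof -
  let ?n = "\<lambda>k. Suc k mod length vs"
  have mem: "vs ! k \<in> V" "vs ! ?n k \<in> V" if "k < length vs" for k
    using that assms(2) by (auto intro!: subsetD[OF assms(2)] nth_mem mod_less_divisor)
  have "mulv V (cycle_matrix vs w) z a = (\<Sum>k<length vs. \<Sum>b\<in>V.
      ((if a = vs ! k \<and> b = vs ! ?n k then w k else 0) +
       (if b = vs ! k \<and> a = vs ! ?n k then w k else 0)) * z b)"
    unfolding mulv_def cycle_matrix_def sum_distrib_right by (rule sum.swap)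
  also have "\<dots> = (\<Sum>k<length vs.
      (if a = vs ! k then w k * z (vs ! ?n k) else 0) + (if a = vs ! ?n k then w k * z (vs ! k) else 0))"
  proof (intro sum.cong refl)
    fix k assume "k \<in> {..<length vs}"
    then have k: "vs ! k \<in> V" "vs ! ?n k \<in> V" using mem by auto
    have "(\<Sum>b\<in>V. ((if a = vs ! k \<and> b = vs ! ?n k then w k else 0) +
       (if b = vs ! k \<and> a = vs ! ?n k then w k else 0)) * z b) =
       (\<Sum>b\<in>V. if b = vs ! ?n k then (if a = vs ! k then w k * z (vs ! ?n k) else 0) else 0) +
       (\<Sum>b\<in>V. if b = vs ! k then (if a = vs ! ?n k then w k * z (vs ! k) else 0) else 0)"
      unfolding sum.distrib[symmetric] by (intro sum.cong) auto
    also have "\<dots> = (if a = vs ! k then w k * z (vs ! ?n k) else 0) + (if a = vs ! ?n k then w k * z (vs ! k) else 0)"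
      using k assms(1) by simp
    finally show "(\<Sum>b\<in>V. ((if a = vs ! k \<and> b = vs ! ?n k then w k else 0) +
       (if b = vs ! k \<and> a = vs ! ?n k then w k else 0)) * z b) =
       (if a = vs ! k then w k * z (vs ! ?n k) else 0) + (if a = vs ! ?n k then w k * z (vs ! k) else 0)" .
  qed
  finally show ?thesis .
qed

lemma cycle_matrix_form:
  assumes "finite V" "set vs \<subseteq> V"
  shows "(\<Sum>a\<in>V. z a * mulv V (cycle_matrix vs w) z a) =
    2 * (\<Sum>k<length vs. w k * z (vs ! k) * z (vs ! (Suc k mod length vs)))"
proof -
  let ?n = "\<lambda>k. Suc k mod length vs"
  have mem: "vs ! k \<in> V" "vs ! ?n k \<in> V" if "k < length vs" for k
    using that assms(2) by (auto intro!: subsetD[OF assms(2)] nth_mem mod_less_divisor)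
  have "(\<Sum>a\<in>V. z a * mulv V (cycle_matrix vs w) z a) = (\<Sum>k<length vs. \<Sum>a\<in>V. z a *
     ((if a = vs ! k then w k * z (vs ! ?n k) else 0) + (if a = vs ! ?n k then w k * z (vs ! k) else 0)))"
    unfolding mulv_cycle_matrix[OF assms] sum_distrib_left by (rule sum.swap)
  also have "\<dots> = (\<Sum>k<length vs. 2 * (w k * z (vs ! k) * z (vs ! ?n k)))"
  proof (intro sum.cong refl)
    fix k assume "k \<in> {..<length vs}"
    then have k: "vs ! k \<in> V" "vs ! ?n k \<in> V" using mem by auto
    have "(\<Sum>a\<in>V. z a * ((if a = vs ! k then w k * z (vs ! ?n k) else 0) +
        (if a = vs ! ?n k then w k * z (vs ! k) else 0))) =
        (\<Sum>a\<in>V. if a = vs ! k then z (vs ! k) * (w k * z (vs ! ?n k)) else 0) +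
        (\<Sum>a\<in>V. if a = vs ! ?n k then z (vs ! ?n k) * (w k * z (vs ! k)) else 0)"
      unfolding sum.distrib[symmetric] by (intro sum.cong) (auto simp: algebra_simps)
    also have "\<dots> = 2 * (w k * z (vs ! k) * z (vs ! ?n k))"
      using k assms(1) by simp
    finally show "(\<Sum>a\<in>V. z a * ((if a = vs ! k then w k * z (vs ! ?n k) else 0) +
        (if a = vs ! ?n k then w k * z (vs ! k) else 0))) = 2 * (w k * z (vs ! k) * z (vs ! ?n k))" .
  qed
  finally show ?thesis by (simp add: sum_distrib_left)
qed

text \<open>With equal weights, the reflection about position 0 would make antisymmetric vectors
  invisible from there, and cycles of length divisible by 4 would be singular. One edge of weight 2
  at position 0 removes both defects.\<close>

definition closing_weight :: "nat \<Rightarrow> nat \<Rightarrow> real" where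
  "closing_weight L k = (if Suc k = L then 2 else 1)"

context
  fixes vs :: "'v list" and A :: "('v \<Rightarrow> real) \<Rightarrow> 'v \<Rightarrow> real" and L :: nat
  defines "L \<equiv> length vs"
    and "A \<equiv> mulv (set vs) (cycle_matrix vs (closing_weight (length vs)))"
  assumes dist: "distinct vs" and ne: "vs \<noteq> []"
begin

lemma L_pos: "0 < L" using ne by (simp add: L_def)

lemma cycle_row:
  assumes "j < L"
  shows "A z (vs ! j) = closing_weight L j * z (vs ! (Suc j mod L)) +
    closing_weight L ((j + L - 1) mod L) * z (vs ! ((j + L - 1) mod L))"
proof -
  \<comment> \<open>The predecessor of \<open>j\<close> on the cycle; adding \<open>L\<close> before
    subtracting 1 avoids truncated subtraction at \<open>j = 0\<close>.\<close>
  have pm: "(j + L - 1) mod L = (if j = 0 then L - 1 else j - 1)"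
  proof (cases j)
    case (Suc i)
    then show ?thesis using assms by simp
  qed (use L_pos in simp)
  have pred: "j = Suc k mod L \<longleftrightarrow> k = (j + L - 1) mod L" if "k < L" for k
  proof (cases "Suc k = L")
    case True
    then show ?thesis using assms unfolding pm by auto
  next
    case False
    then have "Suc k mod L = Suc k" using that by simp
    then show ?thesis using False assms unfolding pm by auto
  qed
  have eq1: "vs ! j = vs ! k \<longleftrightarrow> k = j" if "k < L" for k
    using nth_eq_iff_index_eq[OF dist, of j k] that assms by (auto simp: L_def)
  have eq2: "vs ! j = vs ! (Suc k mod L) \<longleftrightarrow> k = (j + L - 1) mod L" if "k < L" for k
    using nth_eq_iff_index_eq[OF dist, of j "Suc k mod L"] pred[OF that] assms L_pos
    by (simp add: L_def)
  have "A z (vs ! j) = (\<Sum>k<L.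
      (if vs ! j = vs ! k then closing_weight L k * z (vs ! (Suc k mod L)) else 0) +
      (if vs ! j = vs ! (Suc k mod L) then closing_weight L k * z (vs ! k) else 0))"
    unfolding A_def L_def by (rule mulv_cycle_matrix) auto
  also have "\<dots> = (\<Sum>k<L. if k = j then closing_weight L k * z (vs ! (Suc k mod L)) else 0) +
      (\<Sum>k<L. if k = (j + L - 1) mod L then closing_weight L k * z (vs ! k) else 0)"
    unfolding sum.distrib[symmetric]
  proof (intro sum.cong refl)
    fix k assume "k \<in> {..<L}"
    then have k: "k < L" by simp
    show "(if vs ! j = vs ! k then closing_weight L k * z (vs ! (Suc k mod L)) else 0) +
        (if vs ! j = vs ! (Suc k mod L) then closing_weight L k * z (vs ! k) else 0) =
        (if k = j then closing_weight L k * z (vs ! (Suc k mod L)) else 0) +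
        (if k = (j + L - 1) mod L then closing_weight L k * z (vs ! k) else 0)"
      by (simp only: eq1[OF k] eq2[OF k])
  qed
  finally show ?thesis using assms L_pos by simp
qed

lemma cycle_row_first: "2 \<le> L \<Longrightarrow> A z (vs ! 0) = z (vs ! 1) + 2 * z (vs ! (L - 1))"
proof -
  assume L2: "2 \<le> L"
  then have "(0 + L - 1) mod L = L - 1" "Suc 0 mod L = 1" by simp_all
  moreover have "Suc 0 \<noteq> L" "Suc (L - 1) = L" using L2 by auto
  ultimately show ?thesis using L2 by (subst cycle_row) (simp_all add: closing_weight_def)
qed

lemma cycle_row_last: "2 \<le> L \<Longrightarrow> A z (vs ! (L - 1)) = 2 * z (vs ! 0) + z (vs ! (L - 2))"
proof -
  assume L2: "2 \<le> L"
  then have "(L - 1 + L - 1) mod L = L - 2"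
    using mod_add_self2[of "L - 2" L] by (simp add: numeral_2_eq_2)
  moreover have "Suc (L - 1) mod L = 0" using L2 by simp
  moreover have "Suc (L - 2) \<noteq> L" "Suc (L - 1) = L" using L2 by auto
  ultimately show ?thesis using L2 by (subst cycle_row) (simp_all add: closing_weight_def)
qed

lemma cycle_row_middle:
  assumes "0 < j" "Suc j < L"
  shows "A z (vs ! j) = z (vs ! Suc j) + z (vs ! (j - 1))"
proof -
  have "(j + L - 1) mod L = j - 1" using assms mod_add_self2[of "j - 1" L] by simp
  then show ?thesis using assms by (subst cycle_row) (auto simp: closing_weight_def)
qed

text \<open>The middle rows give \<open>f (j + 2) = - f j\<close>, so up to sign only
  \<open>f 0\<close> and \<open>f 1\<close> occur. For even length the rows at the closing edge
  equate each of them with plus or minus its own double; for odd length they make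
  \<open>(-1)^l * f 1\<close> equal to both \<open>2 * f 0\<close> and
  \<open>- 2 * f 0\<close>.\<close>

lemma cycle_nonsingular:
  assumes z: "\<And>j. j < L \<Longrightarrow> A z (vs ! j) = 0"
  shows "\<forall>a\<in>set vs. z a = 0"
proof (cases "L = 1")
  case True
  then have "z (vs ! 0) = 0" using z[of 0] cycle_row[of 0 z] by (simp add: closing_weight_def)
  then show ?thesis using True by (auto simp: in_set_conv_nth L_def)
next
  case False
  then have L2: "2 \<le> L" using L_pos by simp
  define f where "f j = z (vs ! j)" for j
  have rec: "f (Suc (Suc j)) = - f j" if "Suc (Suc j) < L" for j
    using z[of "Suc j"] cycle_row_middle[of "Suc j" z] that by (simp add: f_def)
  have ev: "f (2 * i) = (-1) ^ i * f 0" if "2 * i < L" for i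
    using that by (induction i) (auto simp: rec)
  have od: "f (Suc (2 * i)) = (-1) ^ i * f 1" if "Suc (2 * i) < L" for i
    using that by (induction i) (auto simp: rec)
  have r0: "f 1 = - 2 * f (L - 1)" using z[of 0] cycle_row_first[OF L2, of z] L2 by (simp add: f_def)
  have r1: "f (L - 2) = - 2 * f 0" using z[of "L - 1"] cycle_row_last[OF L2, of z] L2 by (simp add: f_def)
  have "f 0 = 0 \<and> f 1 = 0"
  proof (cases "even L")
    case True
    then obtain l where l: "L = 2 * Suc l" using L2 by (metis dvd_def mult_0_right not0_implies_Suc not_numeral_le_zero)
    have "f 1 = - 2 * ((-1) ^ l * f 1)" using r0 od[of l] l by simp
    moreover have "(-1) ^ l * f 0 = - 2 * f 0" using r1 ev[of l] l by simp
    ultimately show ?thesis by (cases "even l") auto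
  next
    case False
    then obtain l where l: "L = Suc (2 * Suc l)" using L2
      by (metis One_nat_def Suc_1 Suc_n_not_le_n mult_0_right not0_implies_Suc oddE Suc_eq_plus1)
    have "f 1 = 2 * ((-1) ^ l * f 0)" using r0 ev[of "Suc l"] l by simp
    moreover have "(-1) ^ l * f 1 = - 2 * f 0" using r1 od[of l] l by simp
    ultimately show ?thesis by (cases "even l") auto
  qed
  then have "f j = 0" if "j < L" for j
    using ev[of "j div 2"] od[of "j div 2"] that by (cases "even j") (auto elim!: evenE oddE)
  then show ?thesis by (auto simp: in_set_conv_nth L_def f_def)
qed

text \<open>Row 0 gives the relation for \<open>j = 1\<close>. Applying the relation for
  \<open>j - 1\<close> to the next iterate moves it one step inwards from both sides of position 0,
  which is why \<open>s\<close> is general in the induction.\<close>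

lemma cycle_antisymmetric:
  assumes g: "\<And>s. (A ^^ s) g (vs ! 0) = 0" and "0 < j" "j < L"
  shows "(A ^^ s) g (vs ! j) + 2 * (A ^^ s) g (vs ! (L - j)) = 0"
  using assms(2,3)
proof (induction j arbitrary: s rule: less_induct)
  case (less j)
  define h where "h i = (A ^^ s) g (vs ! i)" for i
  have L2: "2 \<le> L" using less.prems by simp
  have h0: "h 0 = 0" using g by (simp add: h_def)
  show ?case
  proof (cases "j = 1")
    case True
    then show ?thesis using g[of "Suc s"] cycle_row_first[OF L2, of "(A ^^ s) g"] by simp
  next
    case False
    then obtain i where i: "j = Suc i" "0 < i" using less.prems by (cases j) auto
    have IH: "A ((A ^^ s) g) (vs ! i) + 2 * A ((A ^^ s) g) (vs ! (L - i)) = 0"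
      using less.IH[of i "Suc s"] i less.prems by simp
    have ri: "A ((A ^^ s) g) (vs ! i) = h (Suc i) + h (i - 1)"
      using cycle_row_middle[of i] i less.prems by (simp add: h_def)
    show ?thesis
    proof (cases "i = 1")
      case True
      then have "A ((A ^^ s) g) (vs ! (L - i)) = h (L - 2)"
        using cycle_row_last[OF L2, of "(A ^^ s) g"] h0 by (simp add: h_def)
      then show ?thesis using IH ri True i h0 by (simp add: h_def numeral_2_eq_2)
    next
      case False
      then have "A ((A ^^ s) g) (vs ! (L - i)) = h (Suc (L - i)) + h (L - i - 1)"
        using cycle_row_middle[of "L - i"] i less.prems by (simp add: h_def)
      moreover have "h (i - 1) + 2 * h (L - (i - 1)) = 0"
        using less.IH[of "i - 1" s] i False less.prems by (simp add: h_def)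
      moreover have "L - (i - 1) = Suc (L - i)" "L - i - 1 = L - j" using i less.prems by auto
      ultimately show ?thesis using IH ri i by (simp add: h_def)
    qed
  qed
qed

text \<open>The relations for \<open>j\<close> and \<open>L - j\<close> read
  \<open>a = - 2 * b\<close> and \<open>b = - 2 * a\<close>; with equal weights they would coincide.
  The premise starts at the first power, so this shows \<open>A w = 0\<close>, and
  \<open>cycle_nonsingular\<close> finishes.\<close>

lemma cycle_observable:
  assumes "\<And>s. (A ^^ Suc s) w (vs ! 0) = 0"
  shows "\<forall>a\<in>set vs. w a = 0"
proof (rule cycle_nonsingular)
  fix j assume j: "j < L"
  have g: "(A ^^ s) (A w) (vs ! 0) = 0" for s
    using assms[of s] by (simp only: funpow_Suc_right o_apply)
  show "A w (vs ! j) = 0"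
  proof (cases "j = 0")
    case True
    then show ?thesis using g[of 0] by simp
  next
    case False
    have "A w (vs ! j) + 2 * A w (vs ! (L - j)) = 0"
      using cycle_antisymmetric[OF g, of j 0] False j by simp
    moreover have "A w (vs ! (L - j)) + 2 * A w (vs ! j) = 0"
      using cycle_antisymmetric[OF g, of "L - j" 0] False j by simp
    ultimately show ?thesis by linarith
  qed
qed

end

section \<open>Negative definite subspaces for signed cycles\<close>

definition sign_weight :: "nat \<Rightarrow> nat \<Rightarrow> real" where
  "sign_weight L k = (if even L then (if even k then 1 else 0) else (if odd k then 1 else -1))"

text \<open>The \<open>L div 2\<close> equations leave a space of dimension half of \<open>L\<close>
  rounded up, on which the form given by \<open>sign_weight\<close> is negative definite. For even
  \<open>L\<close> only the edges of a perfect matching have weight 1, and the values at their ends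
  are made opposite. For odd \<open>L\<close> the signs alternate along the list, and positions
  \<open>2 * j + 1\<close> and \<open>2 * j + 2\<close> are made to have mean
  \<open>f 0\<close>.\<close>

definition cycle_equation :: "nat \<Rightarrow> nat \<Rightarrow> (nat \<Rightarrow> real) \<Rightarrow> real" where
  "cycle_equation L j f =
     (if even L then f (2 * j) + f (Suc (2 * j)) else f (Suc (2 * j)) + f (2 * Suc j) - 2 * f 0)"

lemma sum_pairs: "(\<Sum>k<2 * l. g k) = (\<Sum>j<l. g (2 * j) + g (Suc (2 * j)))" for g :: "nat \<Rightarrow> real"
proof (induction l)
  case (Suc l)
  have "2 * Suc l = Suc (Suc (2 * l))" by simp
  then show ?case using Suc by (simp only: sum.lessThan_Suc add.assoc)
qed simp

text \<open>Telescoping: \<open>a (Suc j) * (a j - a (Suc j))\<close> is half of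
  \<open>(a j)^2 - (a (Suc j))^2 - (a j - a (Suc j))^2\<close>.\<close>

lemma odd_cycle_form:
  fixes a :: "nat \<Rightarrow> real"
  assumes "a 0 = 0"
  shows "(\<Sum>j<l. (\<alpha> + a (Suc j)) * (a j - a (Suc j))) =
    - \<alpha> * a l - (\<Sum>j<l. (a j - a (Suc j))\<^sup>2) / 2 - (a l)\<^sup>2 / 2"
proof (induction l)
  case (Suc l)
  then have "(\<Sum>j<Suc l. (\<alpha> + a (Suc j)) * (a j - a (Suc j))) =
      - \<alpha> * a l - (\<Sum>j<l. (a j - a (Suc j))\<^sup>2) / 2 - (a l)\<^sup>2 / 2 + (\<alpha> + a (Suc l)) * (a l - a (Suc l))"
    by simp
  also have "\<dots> = - \<alpha> * a (Suc l) - ((\<Sum>j<l. (a j - a (Suc j))\<^sup>2) + (a l - a (Suc l))\<^sup>2) / 2 - (a (Suc l))\<^sup>2 / 2"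
    by (simp add: power2_diff add_divide_distrib diff_divide_distrib power2_eq_square algebra_simps)
  finally show ?case by simp
qed (simp add: assms)

text \<open>In the odd case put \<open>f (2 j + 1) = \<alpha> + a (j + 1)\<close> and \<open>f (2 j) = \<alpha> - a j\<close> with \<open>\<alpha> = f 0\<close>; the
  form is then \<open>- \<alpha>\<^sup>2\<close> minus a sum of squares.\<close>

lemma cycle_form_negative_definite:
  fixes f :: "nat \<Rightarrow> real"
  assumes L: "0 < L" and eqs: "\<And>j. j < L div 2 \<Longrightarrow> cycle_equation L j f = 0"
  defines "Q \<equiv> (\<Sum>k<L. sign_weight L k * f k * f (Suc k mod L))"
  shows "Q \<le> 0" and "0 \<le> Q \<Longrightarrow> k < L \<Longrightarrow> f k = 0"
proof -
  have "Q \<le> 0 \<and> (0 \<le> Q \<longrightarrow> (\<forall>k<L. f k = 0))"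
  proof (cases "even L")
    case True
    then obtain l where l: "L = 2 * l" by (elim evenE)
    have e: "f (Suc (2 * j)) = - f (2 * j)" if "j < l" for j
      using eqs[of j] that l by (simp add: cycle_equation_def)
    have "Q = (\<Sum>j<l. - (f (2 * j))\<^sup>2)"
      unfolding Q_def l sum_pairs
      by (intro sum.cong) (auto simp: sign_weight_def e power2_eq_square)
    then have Q: "Q = - (\<Sum>j<l. (f (2 * j))\<^sup>2)" by (simp add: sum_negf)
    have "\<forall>k<L. f k = 0" if "0 \<le> Q"
    proof -
      have "(\<Sum>j<l. (f (2 * j))\<^sup>2) = 0" using that Q sum_nonneg[of "{..<l}" "\<lambda>j. (f (2 * j))\<^sup>2"] by simp
      then have z: "f (2 * j) = 0" if "j < l" for j using that by (simp add: sum_nonneg_eq_0_iff)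
      show ?thesis
      proof (intro allI impI)
        fix k assume k: "k < L"
        have "f (2 * (k div 2)) = 0" "f (Suc (2 * (k div 2))) = 0" using z[of "k div 2"] e[of "k div 2"] k l by auto
        then show "f k = 0" by (cases "even k") (auto elim!: evenE oddE)
      qed
    qed
    moreover have "Q \<le> 0" unfolding Q by (simp add: sum_nonneg)
    ultimately show ?thesis by blast
  next
    case False
    then obtain l where l: "L = Suc (2 * l)" by (metis oddE Suc_eq_plus1)
    define \<alpha> where "\<alpha> = f 0"
    define a where "a j = \<alpha> - f (2 * j)" for j
    have a0: "a 0 = 0" by (simp add: a_def \<alpha>_def)
    have fe: "f (2 * j) = \<alpha> - a j" for j by (simp add: a_def)
    have fo: "f (Suc (2 * j)) = \<alpha> + a (Suc j)" if "j < l" for j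
      using eqs[of j] that l False by (simp add: cycle_equation_def a_def \<alpha>_def)
    have "(\<Sum>k<2 * l. sign_weight L k * f k * f (Suc k mod L)) =
        (\<Sum>j<l. (\<alpha> + a (Suc j)) * (a j - a (Suc j)))"
      unfolding sum_pairs
    proof (intro sum.cong refl)
      fix j assume "j \<in> {..<l}"
      then have j: "Suc (2 * j) mod L = Suc (2 * j)" "Suc (Suc (2 * j)) mod L = 2 * Suc j" "j < l" using l by auto
      show "sign_weight L (2 * j) * f (2 * j) * f (Suc (2 * j) mod L) +
          sign_weight L (Suc (2 * j)) * f (Suc (2 * j)) * f (Suc (Suc (2 * j)) mod L) =
          (\<alpha> + a (Suc j)) * (a j - a (Suc j))"
        unfolding j(1,2) fe fo[OF j(3)] using False by (simp add: sign_weight_def algebra_simps)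
    qed
    \<comment> \<open>The closing edge has the even index \<open>2 * l\<close>, hence weight -1, and
      joins \<open>f (2 * l)\<close> to \<open>f 0\<close>.\<close>
    moreover have "Q = (\<Sum>k<2 * l. sign_weight L k * f k * f (Suc k mod L)) - (\<alpha> - a l) * \<alpha>"
      unfolding Q_def l using fe[of l] by (simp add: sign_weight_def \<alpha>_def left_diff_distrib)
    ultimately have "Q = - \<alpha> * a l - (\<Sum>j<l. (a j - a (Suc j))\<^sup>2) / 2 - (a l)\<^sup>2 / 2 - (\<alpha> - a l) * \<alpha>"
      using odd_cycle_form[where a = a, OF a0] by simp
    then have Q: "Q = - \<alpha>\<^sup>2 - (\<Sum>j<l. (a j - a (Suc j))\<^sup>2) / 2 - (a l)\<^sup>2 / 2"
      by (simp add: power2_eq_square left_diff_distrib)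
    have s0: "0 \<le> (\<Sum>j<l. (a j - a (Suc j))\<^sup>2)" by (simp add: sum_nonneg)
    have "\<forall>k<L. f k = 0" if "0 \<le> Q"
    proof -
      have "\<alpha>\<^sup>2 + (\<Sum>j<l. (a j - a (Suc j))\<^sup>2) / 2 + (a l)\<^sup>2 / 2 \<le> 0" using that Q by simp
      then have "\<alpha>\<^sup>2 = 0" and sq: "(\<Sum>j<l. (a j - a (Suc j))\<^sup>2) = 0"
        using s0 zero_le_power2[of \<alpha>] zero_le_power2[of "a l"] by linarith+
      have st: "a (Suc j) = a j" if "j < l" for j
        using sq that by (simp add: sum_nonneg_eq_0_iff)
      have al0: "\<alpha> = 0" using \<open>\<alpha>\<^sup>2 = 0\<close> by simp
      have az: "a j = 0" if "j \<le> l" for j using that by (induction j) (auto simp: a0 st)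
      show ?thesis
      proof (intro allI impI)
        fix k assume k: "k < L"
        show "f k = 0"
        proof (cases "even k")
          case True
          then obtain j where "k = 2 * j" by (elim evenE)
          then show ?thesis using fe[of j] az[of j] al0 k l by simp
        next
          case False
          then obtain j where "k = Suc (2 * j)" by (metis oddE Suc_eq_plus1)
          then show ?thesis using fo[of j] az[of "Suc j"] al0 k l by simp
        qed
      qed
    qed
    moreover have "Q \<le> 0" unfolding Q using s0 zero_le_power2[of \<alpha>] zero_le_power2[of "a l"] by linarith
    ultimately show ?thesis by blast
  qed
  then show "Q \<le> 0" "0 \<le> Q \<Longrightarrow> k < L \<Longrightarrow> f k = 0" by auto
qed

section \<open>Decomposition of a matching\<close>

definition cycle_in :: "('v \<Rightarrow> 'v \<Rightarrow> bool) \<Rightarrow> 'v list \<Rightarrow> bool" where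
  "cycle_in E vs \<longleftrightarrow> vs \<noteq> [] \<and> distinct vs \<and> (\<forall>k<length vs. E (vs ! k) (vs ! (Suc k mod length vs)))"

text \<open>Allows a cycle to be entered at any vertex, observability being proved from position
  0.\<close>

lemma cycle_in_rotate:
  assumes "cycle_in E vs"
  shows "cycle_in E (rotate i vs)"
proof -
  have "E (rotate i vs ! k) (rotate i vs ! (Suc k mod length vs))" if k: "k < length vs" for k
  proof -
    have n: "0 < length vs" using k by auto
    have "rotate i vs ! (Suc k mod length vs) = vs ! (Suc ((i + k) mod length vs) mod length vs)"
      using n by (simp add: nth_rotate mod_simps)
    moreover have "rotate i vs ! k = vs ! ((i + k) mod length vs)" using k by (simp add: nth_rotate)
    ultimately show ?thesis using assms n unfolding cycle_in_def by simp
  qed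
  then show ?thesis using assms unfolding cycle_in_def by simp
qed

text \<open>The orbit of \<open>i\<close> up to its first return. The last clause makes the
  complement of the orbit invariant under \<open>\<sigma>\<close>, so the decomposition can continue
  there.\<close>

lemma permutation_orbit_cycle:
  assumes "finite I" "inj_on \<sigma> I" "\<sigma> ` I = I" "i \<in> I" and E: "\<And>k. k \<in> I \<Longrightarrow> E k (\<sigma> k)"
  shows "\<exists>vs. cycle_in E vs \<and> set vs \<subseteq> I \<and> (\<forall>k\<in>I. \<sigma> k \<in> set vs \<longrightarrow> k \<in> set vs)"
proof -
  have bij: "bij_betw (\<sigma> ^^ k) I I" for k
    using assms by (intro bij_betw_funpow) (auto simp: bij_betw_def)
  define v where "v k = (\<sigma> ^^ k) i" for k
  have vI: "v k \<in> I" for k using bij[of k] \<open>i \<in> I\<close> unfolding v_def by (auto simp: bij_betw_def)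
  have vadd: "v (a + b) = (\<sigma> ^^ a) (v b)" for a b by (simp add: v_def funpow_add)
  have cancel: "v b = i" if "v (a + b) = v a" for a b
  proof -
    have "(\<sigma> ^^ a) (v b) = (\<sigma> ^^ a) i" using that by (simp add: vadd) (simp add: v_def)
    then show ?thesis using bij[of a] vI \<open>i \<in> I\<close> unfolding bij_betw_def inj_on_def by blast
  qed
  have "\<not> inj_on v (UNIV :: nat set)"
    using vI \<open>finite I\<close> finite_imageD[of v UNIV] finite_subset[of "range v" I] infinite_UNIV_nat by blast
  then obtain a b where "a < b" "v a = v b" unfolding inj_on_def by (metis linorder_neqE_nat)
  then have "v (b - a) = i \<and> 0 < b - a" using cancel[of a "b - a"] by simp
  then have ex: "\<exists>L. v L = i \<and> 0 < L" by blast
  define L where "L = (LEAST L. v L = i \<and> 0 < L)"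
  have L: "v L = i" "0 < L" using LeastI_ex[OF ex] by (simp_all add: L_def)
  have least: "\<not> (v k = i \<and> 0 < k)" if "k < L" for k using not_less_Least that unfolding L_def by blast
  define vs where "vs = map v [0..<L]"
  have len: "length vs = L" by (simp add: vs_def)
  have nth: "vs ! k = v k" if "k < L" for k using that by (simp add: vs_def)
  have neq: "v a \<noteq> v b" if "a < b" "b < L" for a b
    using cancel[of a "b - a"] least[of "b - a"] that by auto
  have "inj_on v {0..<L}" unfolding inj_on_def by (metis atLeastLessThan_iff linorder_neqE_nat neq)
  then have dist: "distinct vs" by (simp add: vs_def distinct_map)
  have next': "vs ! (Suc k mod L) = \<sigma> (v k)" if "k < L" for k
  proof (cases "Suc k = L")
    case True
    then have "\<sigma> (v k) = i" using L(1) vadd[of 1 k] by simp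
    then show ?thesis using True L nth[of 0] by (simp add: v_def)
  next
    case False
    then show ?thesis using that nth[of "Suc k"] vadd[of 1 k] by simp
  qed
  have "cycle_in E vs"
    unfolding cycle_in_def len
  proof (intro conjI allI impI dist)
    show "vs \<noteq> []" using L(2) len by auto
    fix k assume k: "k < L"
    show "E (vs ! k) (vs ! (Suc k mod L))" unfolding next'[OF k] nth[OF k] by (rule E[OF vI])
  qed
  moreover have "set vs \<subseteq> I" using vI by (auto simp: vs_def)
  moreover have "k \<in> set vs" if k: "k \<in> I" "\<sigma> k \<in> set vs" for k
  proof -
    obtain a where a: "a < L" "\<sigma> k = v a" using k(2) by (auto simp: vs_def)
    obtain b where b: "b < L" "\<sigma> (v b) = v a"
    proof (cases a)
      case 0
      then show ?thesis using that[of "L - 1"] L vadd[of 1 "L - 1"] by (simp add: v_def)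
    next
      case (Suc c)
      then show ?thesis using that[of c] a vadd[of 1 c] by simp
    qed
    then have "k = v b" using a k(1) vI \<open>inj_on \<sigma> I\<close> unfolding inj_on_def by metis
    then show ?thesis using b(1) by (auto simp: vs_def)
  qed
  ultimately show ?thesis by blast
qed

text \<open>\<open>X\<close> collects the elements matched into \<open>U\<close>. Cycles may contain
  vertices of the image of \<open>\<sigma>\<close> outside \<open>I\<close>, so \<open>I\<close> is
  compared with the covered vertices by cardinality, not by inclusion.\<close>

definition cycle_decomposition ::
  "('v \<Rightarrow> 'v \<Rightarrow> bool) \<Rightarrow> 'v set \<Rightarrow> ('v \<Rightarrow> 'v) \<Rightarrow> 'v set \<Rightarrow> 'v set \<Rightarrow> 'v list set \<Rightarrow> bool"
where
  "cycle_decomposition E U \<sigma> I X \<C> \<longleftrightarrow> X \<subseteq> I \<and> \<sigma> ` X \<subseteq> U \<and> finite \<C> \<and>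
    (\<forall>c\<in>\<C>. cycle_in E c \<and> set c \<subseteq> (I \<union> \<sigma> ` I) - U \<and> set c \<inter> X = {}) \<and>
    (\<forall>c\<in>\<C>. \<forall>d\<in>\<C>. c \<noteq> d \<longrightarrow> set c \<inter> set d = {}) \<and> card I \<le> card (X \<union> \<Union>(set ` \<C>))"

text \<open>A vertex outside the image of \<open>\<sigma>\<close> starts a path: its first edge is split off, as a pair with an
  element of \<open>U\<close> or as a cycle of length \<open>2\<close>. Without such a vertex \<open>\<sigma>\<close> is a permutation.\<close>

lemma matching_decomposition:
  fixes E :: "'v \<Rightarrow> 'v \<Rightarrow> bool"
  assumes sym: "symp E"
    and "finite I" "inj_on \<sigma> I" "\<forall>i\<in>I. E i (\<sigma> i)" "I \<inter> U = {}"
  shows "\<exists>X \<C>. cycle_decomposition E U \<sigma> I X \<C>"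
  using assms(2-5)
proof (induction I rule: finite_psubset_induct)
  case (psubset I)
  show ?case
  proof (cases "I \<subseteq> \<sigma> ` I")
    case False
    then obtain i where i: "i \<in> I" "i \<notin> \<sigma> ` I" by blast
    define j where "j = \<sigma> i"
    \<comment> \<open>If \<open>j\<close> lies in \<open>I\<close>, its own matching edge is given
      up too. This loses at most two elements of \<open>I\<close>, and the cycle
      \<open>[i, j]\<close> covers two vertices.\<close>
    define I' where "I' = I - {i, j}"
    have sub_edge: "E k (\<sigma> k)" if "k \<in> I'" for k using psubset.prems(2) that by (auto simp: I'_def)
    have "I' \<subset> I" using i by (auto simp: I'_def)
    moreover have "inj_on \<sigma> I'" using psubset.prems(1) inj_on_subset I'_def by blast
    moreover have "I' \<inter> U = {}" using psubset.prems(3) by (auto simp: I'_def)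
    ultimately obtain X \<C> where "cycle_decomposition E U \<sigma> I' X \<C>"
      using psubset.IH[of I'] sub_edge by blast
    then have IH: "X \<subseteq> I'" "\<sigma> ` X \<subseteq> U" "finite \<C>"
      "\<And>c. c \<in> \<C> \<Longrightarrow> cycle_in E c \<and> set c \<subseteq> (I' \<union> \<sigma> ` I') - U \<and> set c \<inter> X = {}"
      "\<And>c d. c \<in> \<C> \<Longrightarrow> d \<in> \<C> \<Longrightarrow> c \<noteq> d \<Longrightarrow> set c \<inter> set d = {}"
      "card I' \<le> card (X \<union> \<Union>(set ` \<C>))"
      unfolding cycle_decomposition_def by blast+
    have ij: "i \<noteq> j" using i by (auto simp: j_def)
    have jn: "j \<notin> \<sigma> ` I'"
    proof
      assume "j \<in> \<sigma> ` I'"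
      then obtain k where "k \<in> I'" "\<sigma> k = \<sigma> i" by (auto simp: j_def)
      then show False using psubset.prems(1) i(1) by (auto simp: I'_def inj_on_def)
    qed
    have in': "i \<notin> I' \<union> \<sigma> ` I'" "j \<notin> I' \<union> \<sigma> ` I'" "I' \<union> \<sigma> ` I' \<subseteq> I \<union> \<sigma> ` I"
      using i jn by (auto simp: I'_def)
    have old: "X \<union> \<Union>(set ` \<C>) \<subseteq> I' \<union> \<sigma> ` I'" using IH(1,4) by blast
    have fin: "finite (X \<union> \<Union>(set ` \<C>))" using IH(1,3) psubset.hyps by (auto simp: I'_def intro: finite_subset)
    have cardI: "card I \<le> card I' + card ({i, j} \<inter> I)"
    proof -
      have "I = I' \<union> ({i, j} \<inter> I)" by (auto simp: I'_def)
      then show ?thesis using card_Un_le[of I' "{i, j} \<inter> I"] by simp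
    qed
    show ?thesis
    proof (cases "j \<in> U")
      case True
      have "insert i X \<union> \<Union>(set ` \<C>) = insert i (X \<union> \<Union>(set ` \<C>))" by simp
      moreover have "i \<notin> X \<union> \<Union>(set ` \<C>)" using in' old by blast
      ultimately have c: "card (insert i X \<union> \<Union>(set ` \<C>)) = Suc (card (X \<union> \<Union>(set ` \<C>)))" using fin by simp
      have "{i, j} \<inter> I = {i}" using i True psubset.prems(3) by auto
      then have "card I \<le> Suc (card I')" using cardI by simp
      then have "card I \<le> card (insert i X \<union> \<Union>(set ` \<C>))" using c IH(6) by simp
      moreover have "insert i X \<subseteq> I" using IH(1) i by (auto simp: I'_def)
      moreover have "\<sigma> ` insert i X \<subseteq> U" using IH(2) True by (auto simp: j_def)
      moreover have "cycle_in E c \<and> set c \<subseteq> (I \<union> \<sigma> ` I) - U \<and> set c \<inter> insert i X = {}" if "c \<in> \<C>" for c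
        using IH(4)[OF that] in' by blast
      ultimately have "cycle_decomposition E U \<sigma> I (insert i X) \<C>"
        unfolding cycle_decomposition_def using IH(3,5) by blast
      then show ?thesis by blast
    next
      case False
      \<comment> \<open>By symmetry of \<open>E\<close> a single edge is a cycle of length
        2.\<close>
      have cyc: "cycle_in E [i, j]"
        unfolding cycle_in_def using ij sympD[OF sym] bspec[OF psubset.prems(2) i(1)]
        by (auto simp: j_def less_Suc_eq)
      have "X \<union> \<Union>(set ` insert [i, j] \<C>) = insert i (insert j (X \<union> \<Union>(set ` \<C>)))" by auto
      moreover have "i \<notin> X \<union> \<Union>(set ` \<C>)" "j \<notin> X \<union> \<Union>(set ` \<C>)" using in' old by blast+
      ultimately have c: "card (X \<union> \<Union>(set ` insert [i, j] \<C>)) = Suc (Suc (card (X \<union> \<Union>(set ` \<C>))))"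
        using fin ij by simp
      have "card ({i, j} \<inter> I) \<le> 2" using card_mono[of "{i, j}" "{i, j} \<inter> I"] ij by simp
      then have "card I \<le> card (X \<union> \<Union>(set ` insert [i, j] \<C>))" using c IH(6) cardI by linarith
      moreover have "X \<subseteq> I" using IH(1) by (auto simp: I'_def)
      moreover have "set [i, j] \<subseteq> (I \<union> \<sigma> ` I) - U" using i False psubset.prems(3) by (auto simp: j_def)
      moreover have "set [i, j] \<inter> X = {}" using in' IH(1) by auto
      moreover have "set [i, j] \<inter> set c = {}" if "c \<in> \<C>" for c using in' IH(4)[OF that] by auto
      moreover have "cycle_in E c \<and> set c \<subseteq> (I \<union> \<sigma> ` I) - U \<and> set c \<inter> X = {}" if "c \<in> \<C>" for c
        using IH(4)[OF that] in' by blast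
      ultimately have "cycle_decomposition E U \<sigma> I X (insert [i, j] \<C>)"
        unfolding cycle_decomposition_def ball_simps
        using IH(2,3,5) cyc by (auto simp del: list.set simp: Int_commute)
      then show ?thesis by blast
    qed
  next
    case True
    show ?thesis
    proof (cases "I = {}")
      case True
      then have "cycle_decomposition E U \<sigma> I {} {}" by (simp add: cycle_decomposition_def)
      then show ?thesis by blast
    next
      case False
      then obtain i where i: "i \<in> I" by blast
      have surj: "\<sigma> ` I = I"
        using True psubset.hyps psubset.prems(1) by (metis card_image card_subset_eq finite_imageI)
      obtain vs where vs: "cycle_in E vs" "set vs \<subseteq> I" "\<forall>k\<in>I. \<sigma> k \<in> set vs \<longrightarrow> k \<in> set vs"
        using permutation_orbit_cycle[OF psubset.hyps psubset.prems(1) surj i, of E] psubset.prems(2) by blast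
      define I' where "I' = I - set vs"
      have sub_edge: "E k (\<sigma> k)" if "k \<in> I'" for k using psubset.prems(2) that by (auto simp: I'_def)
      obtain a where "a \<in> set vs" using vs(1) by (cases vs) (auto simp: cycle_in_def)
      then have "I' \<noteq> I" using vs(2) by (auto simp: I'_def)
      then have "I' \<subset> I" by (auto simp: I'_def)
      moreover have "inj_on \<sigma> I'" using psubset.prems(1) inj_on_subset I'_def by blast
      moreover have "I' \<inter> U = {}" using psubset.prems(3) by (auto simp: I'_def)
      ultimately obtain X \<C> where "cycle_decomposition E U \<sigma> I' X \<C>"
        using psubset.IH[of I'] sub_edge by blast
      then have IH: "X \<subseteq> I'" "\<sigma> ` X \<subseteq> U" "finite \<C>"
        "\<And>c. c \<in> \<C> \<Longrightarrow> cycle_in E c \<and> set c \<subseteq> (I' \<union> \<sigma> ` I') - U \<and> set c \<inter> X = {}"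
        "\<And>c d. c \<in> \<C> \<Longrightarrow> d \<in> \<C> \<Longrightarrow> c \<noteq> d \<Longrightarrow> set c \<inter> set d = {}"
        "card I' \<le> card (X \<union> \<Union>(set ` \<C>))"
        unfolding cycle_decomposition_def by blast+
      have sub: "I' \<union> \<sigma> ` I' \<subseteq> I - set vs" using vs(3) surj by (auto simp: I'_def)
      have old: "X \<union> \<Union>(set ` \<C>) \<subseteq> I - set vs" using IH(1,4) sub by blast
      have fin: "finite (X \<union> \<Union>(set ` \<C>))" using old psubset.hyps finite_subset by blast
      have "X \<union> \<Union>(set ` insert vs \<C>) = set vs \<union> (X \<union> \<Union>(set ` \<C>))" by auto
      then have "card (X \<union> \<Union>(set ` insert vs \<C>)) = card (set vs) + card (X \<union> \<Union>(set ` \<C>))"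
        using old fin by (simp only:) (subst card_Un_disjoint, auto)
      moreover have "card I = card (set vs) + card I'"
        using vs(2) psubset.hyps card_mono[OF psubset.hyps vs(2)]
        by (simp add: I'_def card_Diff_subset finite_subset[OF vs(2)])
      ultimately have "card I \<le> card (X \<union> \<Union>(set ` insert vs \<C>))" using IH(6) by linarith
      moreover have "set vs \<subseteq> (I \<union> \<sigma> ` I) - U" using vs(2) psubset.prems(3) by auto
      moreover have "set vs \<inter> X = {}" using old by auto
      moreover have "set vs \<inter> set c = {}" if "c \<in> \<C>" for c using old that by auto
      moreover have "cycle_in E c \<and> set c \<subseteq> (I \<union> \<sigma> ` I) - U \<and> set c \<inter> X = {}" if "c \<in> \<C>" for c
        using IH(4)[OF that] by (auto simp: I'_def)
      moreover have "X \<subseteq> I" using IH(1) by (auto simp: I'_def)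
      ultimately have "cycle_decomposition E U \<sigma> I X (insert vs \<C>)"
        unfolding cycle_decomposition_def ball_simps
        using IH(2,3,5) vs(1) by (auto simp: Int_commute)
      then show ?thesis by blast
    qed
  qed
qed

section \<open>Structural observability\<close>

inductive linked :: "'v set \<Rightarrow> ('v \<Rightarrow> 'v \<Rightarrow> real) \<Rightarrow> 'v \<Rightarrow> bool" for U G where
  root: "u \<in> U \<Longrightarrow> linked U G u"
| edge: "linked U G b \<Longrightarrow> 0 < G b a \<Longrightarrow> linked U G a"

lemma linked_mono:
  assumes "linked U G x" "\<And>a b. 0 < G a b \<Longrightarrow> 0 < G' a b"
  shows "linked U G' x"
  using assms(1) by induction (auto intro: linked.intros assms(2))

lemma mulv_pow_mono:
  assumes G: "\<And>a b. 0 \<le> G a b" and le: "\<And>a. a \<in> S \<Longrightarrow> y a \<le> z a" and "a \<in> S"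
  shows "(mulv S G ^^ k) y a \<le> (mulv S G ^^ k) z a"
  using assms(3)
proof (induction k arbitrary: a)
  case (Suc k)
  show ?case unfolding funpow.simps o_apply mulv_def
    by (intro sum_mono mult_left_mono G) (use Suc.IH in \<open>simp add: mulv_def\<close>)
qed (simp add: le)

text \<open>A path to \<open>U\<close> contributes a positive term that nonnegative weights cannot
  cancel. This is the nonzero impulse response demanded by \<open>attach_component\<close>.\<close>

lemma linked_imp_markov:
  assumes "linked U G x" and S: "finite S" "U \<subseteq> S" and G: "\<And>a b. 0 \<le> G a b"
    and supp: "\<And>a b. G a b \<noteq> 0 \<Longrightarrow> a \<in> S \<and> b \<in> S"
  shows "\<exists>k. \<exists>u\<in>U. 0 < (mulv S G ^^ k) (unit_fun x) u"
  using assms(1)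
proof induction
  case (root u)
  then show ?case by (intro exI[of _ 0] bexI[of _ u]) (simp_all add: unit_fun_def)
next
  case (edge b a)
  then obtain k u where u: "u \<in> U" "0 < (mulv S G ^^ k) (unit_fun b) u" by blast
  have aS: "a \<in> S" using supp[of b a] edge.hyps(2) by simp
  have col: "G b a * unit_fun b c \<le> mulv S G (unit_fun a) c" for c
  proof -
    have "mulv S G (unit_fun a) c = (\<Sum>d\<in>S. if d = a then G c d else 0)"
      unfolding mulv_def by (intro sum.cong) (auto simp: unit_fun_def)
    then have "mulv S G (unit_fun a) c = G c a" using aS S(1) by simp
    then show ?thesis using G[of c a] by (simp add: unit_fun_def)
  qed
  have "(mulv S G ^^ k) (\<lambda>c. G b a * unit_fun b c) u \<le> (mulv S G ^^ k) (mulv S G (unit_fun a)) u"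
    using u(1) S(2) by (intro mulv_pow_mono G col) auto
  moreover have "0 < (mulv S G ^^ k) (\<lambda>c. G b a * unit_fun b c) u"
    using u(2) edge.hyps(2) by (simp add: mulv_pow_cmult)
  ultimately have "0 < (mulv S G ^^ Suc k) (unit_fun a) u" by (simp only: funpow_Suc_right o_apply)
  then show ?case using u(1) by blast
qed

text \<open>The invariant of the construction. Nonnegativity and \<open>linked\<close> guarantee
  that every vertex attached so far can in turn serve as the entry point \<open>x\<close> for a
  cycle.\<close>

definition realizes :: "('v \<Rightarrow> 'v \<Rightarrow> bool) \<Rightarrow> 'v set \<Rightarrow> 'v set \<Rightarrow> 'v set \<Rightarrow> ('v \<Rightarrow> 'v \<Rightarrow> real) \<Rightarrow> bool" where
  "realizes E U F S G \<longleftrightarrow> (\<forall>a b. 0 \<le> G a b \<and> G a b = G b a) \<and>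
     (\<forall>a b. G a b \<noteq> 0 \<longrightarrow> E a b \<and> a \<in> S \<and> b \<in> S) \<and> (\<forall>x\<in>S. linked U G x) \<and> observable_modulo S U F G"

lemma coupled_properties:
  assumes G: "realizes E U F S G" and sym: "symp E"
    and N: "\<forall>a b. 0 \<le> N a b \<and> N a b = N b a \<and> (N a b \<noteq> 0 \<longrightarrow> E a b)"
    and disj: "S \<inter> C = {}" and x: "x \<in> S" and y: "y \<in> C" and xy: "E x y" and te: "0 < t" "0 < e"
  shows "0 \<le> coupled S C x y G N t e a b" "coupled S C x y G N t e a b = coupled S C x y G N t e b a"
    "coupled S C x y G N t e a b \<noteq> 0 \<Longrightarrow> E a b \<and> a \<in> S \<union> C \<and> b \<in> S \<union> C"
    "0 < G a b \<Longrightarrow> 0 < coupled S C x y G N t e a b"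
    "a \<in> C \<Longrightarrow> b \<in> C \<Longrightarrow> 0 < N a b \<Longrightarrow> 0 < coupled S C x y G N t e a b"
    "0 < coupled S C x y G N t e x y"
proof -
  have G': "0 \<le> G a b" "G a b = G b a" "G a b \<noteq> 0 \<Longrightarrow> E a b \<and> a \<in> S \<and> b \<in> S" for a b
    using G unfolding realizes_def by blast+
  have N': "0 \<le> N a b" "N a b = N b a" "N a b \<noteq> 0 \<Longrightarrow> E a b" for a b using N by blast+
  have ns: "c \<notin> S" if "c \<in> C" for c using disj that by blast
  have ne: "x \<notin> C" "y \<notin> S" "x \<noteq> y" using ns x y by blast+
  show "0 \<le> coupled S C x y G N t e a b" using G'(1) N'(1) te by (simp add: coupled_def)
  show "coupled S C x y G N t e a b = coupled S C x y G N t e b a"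
  proof (cases "a \<in> S \<and> b \<in> S")
    case True
    then show ?thesis using G'(2)[of a b] by (simp add: coupled_def)
  next
    case False
    show ?thesis
    proof (cases "a \<in> C \<and> b \<in> C")
      case True
      then show ?thesis using False N'(2)[of a b] by (simp add: coupled_def ns)
    next
      case notC: False
      have "coupled S C x y G N t e a b = (if a = x \<and> b = y \<or> a = y \<and> b = x then e else 0)"
        using False notC by (simp only: coupled_def if_False)
      moreover have "coupled S C x y G N t e b a = (if b = x \<and> a = y \<or> b = y \<and> a = x then e else 0)"
        using False notC by (simp only: coupled_def if_False conj_commute[of "b \<in> _" "a \<in> _"])
      ultimately show ?thesis by (auto split: if_split)
    qed
  qed
  show "E a b \<and> a \<in> S \<union> C \<and> b \<in> S \<union> C" if "coupled S C x y G N t e a b \<noteq> 0"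
    using that G'(3)[of a b] N'(3)[of a b] x y xy sympD[OF sym xy] by (auto simp: coupled_def split: if_splits)
  show "0 < coupled S C x y G N t e a b" if "0 < G a b"
    using that G'(3)[of a b] by (simp add: coupled_def)
  show "0 < coupled S C x y G N t e a b" if "a \<in> C" "b \<in> C" "0 < N a b"
    using that ns te by (simp add: coupled_def)
  show "0 < coupled S C x y G N t e x y" using ne te by (simp add: coupled_def)
qed

lemma realizes_markov:
  assumes G: "realizes E U F S G" and S: "finite S" "U \<subseteq> S" and x: "x \<in> S"
  shows "\<exists>k. \<exists>u\<in>U. (mulv S G ^^ k) (unit_fun x) u \<noteq> 0"
proof -
  have "\<exists>k. \<exists>u\<in>U. 0 < (mulv S G ^^ k) (unit_fun x) u"
    using G x unfolding realizes_def by (intro linked_imp_markov S) blast+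
  then show ?thesis by (metis less_irrefl)
qed

lemma realizes_attach_vertex:
  assumes G: "realizes E U F S G" and sym: "symp E" and S: "finite S" "U \<subseteq> S"
    and x: "x \<in> S" and y: "y \<notin> S" "y \<in> F" and xy: "E x y"
  shows "\<exists>G'. realizes E U F (insert y S) G'"
proof -
  have obs: "observable_modulo S U F G" using G by (simp add: realizes_def)
  have disj: "S \<inter> {y} = {}" using y by simp
  obtain e where e: "0 < e" "observable_modulo (S \<union> {y}) U (insert y F) (coupled S {y} x y G (\<lambda>_ _. 0) 1 e)"
    using attach_vertex[OF S(1) _ disj S(2) x _ obs, of y "\<lambda>_ _. 0"] by auto
  let ?J = "coupled S {y} x y G (\<lambda>_ _. 0) 1 e"
  have one: "0 < (1::real)" and y1: "y \<in> {y}" by simp_all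
  have Z: "\<forall>a b. (0::real) \<le> 0 \<and> (0::real) = 0 \<and> ((0::real) \<noteq> 0 \<longrightarrow> E a b)" by simp
  note J = coupled_properties[where N = "\<lambda>_ _. 0", OF G sym Z disj x y1 xy one e(1)]
  have lS: "linked U ?J a" if "a \<in> S" for a
  proof -
    have "linked U G a" using G that unfolding realizes_def by blast
    then show ?thesis by (rule linked_mono) (rule J(4))
  qed
  moreover have "linked U ?J y" by (rule linked.edge[OF lS[OF x] J(6)])
  ultimately have "\<forall>a\<in>insert y S. linked U ?J a" by blast
  moreover have "observable_modulo (insert y S) U F ?J" using e(2) y(2) by (simp add: insert_absorb)
  moreover have "E a b \<and> a \<in> insert y S \<and> b \<in> insert y S" if "?J a b \<noteq> 0" for a b
    using J(3)[OF that] by simp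
  ultimately have "realizes E U F (insert y S) ?J"
    unfolding realizes_def using J(1,2) by blast
  then show ?thesis by blast
qed

lemma realizes_attach_cycle:
  assumes G: "realizes E U F S G" and sym: "symp E" and S: "finite S" "U \<subseteq> S"
    and x: "x \<in> S" and c: "cycle_in E c" "set c \<inter> S = {}" and y: "y \<in> set c" and xy: "E x y"
  shows "\<exists>G'. realizes E U F (S \<union> set c) G'"
proof -
  obtain i where i: "i < length c" "c ! i = y" using y by (auto simp: in_set_conv_nth)
  \<comment> \<open>Rotated so that the entry vertex \<open>y\<close> stands at position 0.\<close>
  define vs where "vs = rotate i c"
  have cyc: "cycle_in E vs" unfolding vs_def by (rule cycle_in_rotate[OF c(1)])
  have vs: "set vs = set c" "distinct vs" "vs \<noteq> []" using cyc by (auto simp: vs_def cycle_in_def)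
  have vs0: "vs ! 0 = y" proof -
    have "0 < length c" using i(1) by linarith
    then show ?thesis using i nth_rotate[of 0 c i] by (simp add: vs_def)
  qed
  let ?N = "cycle_matrix vs (closing_weight (length vs))"
  have wpos: "0 < closing_weight (length vs) k" for k by (simp add: closing_weight_def)
  have N0: "0 \<le> ?N a b" for a b by (intro cycle_matrix_nonneg less_imp_le wpos)
  have NE: "E a b" if "?N a b \<noteq> 0" for a b
    using cycle_matrix_nonzero[OF that] cyc sympD[OF sym] unfolding cycle_in_def by metis
  have Ns: "?N a b = ?N b a" for a b by (rule cycle_matrix_sym)
  have N: "\<forall>a b. 0 \<le> ?N a b \<and> ?N a b = ?N b a \<and> (?N a b \<noteq> 0 \<longrightarrow> E a b)"
    using N0 Ns NE by blast
  have obs: "observable_modulo S U F G" using G by (simp add: realizes_def)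
  have disj: "S \<inter> set vs = {}" using c(2) vs(1) by blast
  have yv: "y \<in> set vs" using y vs by simp
  obtain k u where "u \<in> U" "(mulv S G ^^ k) (unit_fun x) u \<noteq> 0"
    using realizes_markov[OF G S x] by blast
  moreover have "\<forall>a\<in>set vs. w a = 0" if "\<And>s. (mulv (set vs) ?N ^^ Suc s) w y = 0" for w
    using cycle_observable[OF vs(2,3), of w] that unfolding vs0 by blast
  ultimately obtain t where t: "0 < t" "observable_modulo (S \<union> set vs) U F (coupled S (set vs) x y G ?N t 1)"
    using attach_component[OF S(1) finite_set disj S(2) x yv obs, of ?N u k] by blast
  let ?J = "coupled S (set vs) x y G ?N t 1"
  have one: "0 < (1::real)" by simp
  note J = coupled_properties[OF G sym N disj x yv xy t(1) one]
  have lS: "linked U ?J a" if "a \<in> S" for a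
  proof -
    have "linked U G a" using G that unfolding realizes_def by blast
    then show ?thesis by (rule linked_mono) (rule J(4))
  qed
  have lv: "linked U ?J (vs ! j)" if "j < length vs" for j
    using that
  proof (induction j)
    case 0
    show ?case unfolding vs0 by (rule linked.edge[OF lS[OF x] J(6)])
  next
    case (Suc j)
    have "0 < ?N (vs ! (Suc j mod length vs)) (vs ! j)"
      using Suc.prems by (intro cycle_matrix_pos wpos) simp
    then have "0 < ?N (vs ! j) (vs ! Suc j)" using Suc.prems by (simp add: Ns)
    then have "0 < ?J (vs ! j) (vs ! Suc j)" using Suc.prems by (intro J(5)) auto
    then show ?case by (rule linked.edge[OF Suc.IH[OF Suc_lessD[OF Suc.prems]]])
  qed
  have "linked U ?J a" if "a \<in> S \<union> set vs" for a
    using that lS lv by (auto simp: in_set_conv_nth)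
  then have "realizes E U F (S \<union> set vs) ?J"
    unfolding realizes_def using J(1-3) t(2) by blast
  then show ?thesis using vs(1) by auto
qed

text \<open>The starting point: every state of \<open>X\<close> hangs on an output of its own, which
  shows its value after one step.\<close>

lemma realizes_matched_pairs:
  assumes sym: "symp E"
    and h: "inj_on h X" "h ` X \<subseteq> U" "\<And>a. a \<in> X \<Longrightarrow> E a (h a)" "X \<inter> U = {}" and fin: "finite X" "finite U"
  shows "\<exists>G. realizes E U F (U \<union> X) G"
proof -
  define G where "G a b = (if (a \<in> X \<and> b = h a) \<or> (b \<in> X \<and> a = h b) then 1 else 0 :: real)" for a b
  have hU: "h a \<in> U" "h a \<notin> X" if "a \<in> X" for a using h that by auto
  have row: "mulv (U \<union> X) G z (h a) = z a" if a: "a \<in> X" for a z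
  proof -
    have "G (h a) b = (if b = a then 1 else 0)" if "b \<in> U \<union> X" for b
      using a hU[OF a] h(1) unfolding G_def inj_on_def by auto
    then have "mulv (U \<union> X) G z (h a) = (\<Sum>b\<in>U \<union> X. if b = a then z b else 0)"
      unfolding mulv_def by (intro sum.cong) auto
    then show ?thesis using a fin by simp
  qed
  have obs: "observable_modulo (U \<union> X) U F G"
    unfolding observable_modulo_def
  proof (intro allI impI ballI)
    fix z a assume z: "unobservable (U \<union> X) U G z" and a: "a \<in> U \<union> X"
    show "z a = 0"
    proof (cases "a \<in> U")
      case True
      have "(mulv (U \<union> X) G ^^ 0) z a = 0" using z True unfolding unobservable_def by blast
      then show ?thesis by simp
    next
      case False
      then have aX: "a \<in> X" using a by simp
      have "(mulv (U \<union> X) G ^^ 1) z (h a) = 0" using z hU(1)[OF aX] unfolding unobservable_def by blast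
      then show ?thesis using row[OF aX, of z] by simp
    qed
  qed
  have "linked U G a" if "a \<in> U \<union> X" for a
  proof (cases "a \<in> U")
    case False
    then have "a \<in> X" using that by simp
    then show ?thesis
      by (intro linked.edge[OF linked.root[OF hU(1)]]) (auto simp: G_def)
  qed (rule linked.root)
  moreover have "E a b \<and> a \<in> U \<union> X \<and> b \<in> U \<union> X" if "G a b \<noteq> 0" for a b
    using that h(2,3) sympD[OF sym] by (auto simp: G_def split: if_splits)
  ultimately have "realizes E U F (U \<union> X) G"
    unfolding realizes_def using obs by (auto simp: G_def)
  then show ?thesis by blast
qed

text \<open>Consider a largest realizable vertex set that contains \<open>U\<close> and
  \<open>X\<close> and each cycle entirely or not at all. \<open>grow\<close> supplies an edge
  leaving it; the vertex at its end lies either on a cycle, which is attached whole, or in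
  \<open>F\<close>. So the set is everything, and the order of attachment is left to
  \<open>grow\<close>.\<close>

theorem structured_observability:
  fixes E :: "'v \<Rightarrow> 'v \<Rightarrow> bool"
  assumes sym: "symp E" and fin: "finite Y" "finite U" and disj: "Y \<inter> U = {}"
    and grow: "\<And>S. U \<subseteq> S \<Longrightarrow> S \<subset> U \<union> Y \<Longrightarrow> \<exists>x\<in>S. \<exists>y\<in>Y - S. E x y"
    and I: "I \<subseteq> Y" "inj_on \<sigma> I" "\<sigma> ` I \<subseteq> Y \<union> U" "\<forall>i\<in>I. E i (\<sigma> i)"
  shows "\<exists>F G. F \<subseteq> Y \<and> card I \<le> card (Y - F) \<and> realizes E U F (U \<union> Y) G"
proof -
  have finI: "finite I" using I(1) fin(1) finite_subset by blast
  have IU: "I \<inter> U = {}" using I(1) disj by blast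
  obtain X \<C> where "cycle_decomposition E U \<sigma> I X \<C>"
    using matching_decomposition[OF sym finI I(2) I(4) IU] by blast
  then have D: "X \<subseteq> I" "\<sigma> ` X \<subseteq> U"
    "\<And>c. c \<in> \<C> \<Longrightarrow> cycle_in E c \<and> set c \<subseteq> (I \<union> \<sigma> ` I) - U \<and> set c \<inter> X = {}"
    "\<And>c d. c \<in> \<C> \<Longrightarrow> d \<in> \<C> \<Longrightarrow> c \<noteq> d \<Longrightarrow> set c \<inter> set d = {}"
    "card I \<le> card (X \<union> \<Union>(set ` \<C>))"
    unfolding cycle_decomposition_def by blast+
  define F where "F = Y - (X \<union> \<Union>(set ` \<C>))"
  have cY: "set c \<subseteq> Y" if "c \<in> \<C>" for c using D(3)[OF that] I(1,3) by blast
  have YF: "Y - F = X \<union> \<Union>(set ` \<C>)" using D(1) I(1) cY by (auto simp: F_def)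
  define P where "P S \<longleftrightarrow> U \<union> X \<subseteq> S \<and> S \<subseteq> U \<union> Y \<and> (\<forall>c\<in>\<C>. set c \<subseteq> S \<or> set c \<inter> S = {}) \<and>
    (\<exists>G. realizes E U F S G)" for S
  have "\<exists>G. realizes E U F (U \<union> X) G"
    using sym D(1,2) I finI IU fin inj_on_subset[OF I(2) D(1)] finite_subset[OF D(1) finI]
    by (intro realizes_matched_pairs[where h = \<sigma>]) auto
  moreover have "set c \<inter> (U \<union> X) = {}" if "c \<in> \<C>" for c using D(3)[OF that] by blast
  ultimately have "P (U \<union> X)" unfolding P_def using D(1) I(1) by blast
  moreover have "card S < Suc (card (U \<union> Y))" if "P S" for S
    using that fin unfolding P_def by (simp add: card_mono less_Suc_eq_le)
  ultimately obtain S where S: "P S" and max: "\<And>S'. P S' \<Longrightarrow> card S' \<le> card S"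
    using ex_has_greatest_nat[of P "U \<union> X" card "Suc (card (U \<union> Y))"] by blast
  have finS: "finite S" using S fin finite_subset unfolding P_def by (metis finite_Un)
  obtain G where G: "realizes E U F S G" using S unfolding P_def by blast
  have "S = U \<union> Y"
  proof (rule ccontr)
    assume "S \<noteq> U \<union> Y"
    then have "S \<subset> U \<union> Y" "U \<subseteq> S" using S unfolding P_def by auto
    then obtain x y where xy: "x \<in> S" "y \<in> Y - S" "E x y" using grow by blast
    have "\<exists>S'. P S' \<and> S \<subset> S'"
    proof (cases "\<exists>c\<in>\<C>. y \<in> set c")
      case True
      then obtain c where c: "c \<in> \<C>" "y \<in> set c" by blast
      then have cS: "set c \<inter> S = {}" using S xy(2) unfolding P_def by blast
      have "\<exists>G'. realizes E U F (S \<union> set c) G'"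
        by (rule realizes_attach_cycle[OF G sym finS \<open>U \<subseteq> S\<close> xy(1) _ cS c(2) xy(3)])
           (use D(3)[OF c(1)] in blast)
      moreover have "set d \<subseteq> S \<union> set c \<or> set d \<inter> (S \<union> set c) = {}" if "d \<in> \<C>" for d
        using S D(4)[OF that c(1)] that unfolding P_def by blast
      ultimately have "P (S \<union> set c)" using S cY[OF c(1)] unfolding P_def by blast
      moreover have "S \<subset> S \<union> set c" using c(2) xy(2) by blast
      ultimately show ?thesis by blast
    next
      case False
      have "y \<notin> X" using S xy(2) unfolding P_def by blast
      then have yF: "y \<in> F" using False xy(2) by (auto simp: F_def)
      have "\<exists>G'. realizes E U F (insert y S) G'"
        using realizes_attach_vertex[OF G sym finS \<open>U \<subseteq> S\<close> xy(1) _ yF xy(3)] xy(2) by blast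
      moreover have "set d \<subseteq> insert y S \<or> set d \<inter> insert y S = {}" if "d \<in> \<C>" for d
        using S that False unfolding P_def by blast
      ultimately have "P (insert y S)" using S xy(2) unfolding P_def by blast
      moreover have "S \<subset> insert y S" using xy(2) by blast
      ultimately show ?thesis by blast
    qed
    then obtain S' where "P S'" "S \<subset> S'" by blast
    moreover have "finite S'" using \<open>P S'\<close> fin finite_subset unfolding P_def by (metis finite_Un)
    ultimately show False using max[of S'] psubset_card_mono[of S' S] by simp
  qed
  moreover have "F \<subseteq> Y" by (auto simp: F_def)
  ultimately show ?thesis using G D(5) YF by auto
qed

section \<open>Generic values of the controllable dimension\<close>

lemma polynomial_in_sum:
  assumes "\<And>a. a \<in> A \<Longrightarrow> polynomial_in I (f a)"
  shows "polynomial_in I (\<lambda>\<theta>. \<Sum>a\<in>A. f a \<theta>)"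
  using assms by (induction A rule: infinite_finite_induct) (auto intro: polynomial_in.intros)

lemma polynomial_in_prod:
  assumes "\<And>a. a \<in> A \<Longrightarrow> polynomial_in I (f a)"
  shows "polynomial_in I (\<lambda>\<theta>. \<Prod>a\<in>A. f a \<theta>)"
  using assms by (induction A rule: infinite_finite_induct) (auto intro: polynomial_in.intros)

lemma polynomial_in_det:
  assumes "\<And>i j. i < r \<Longrightarrow> j < r \<Longrightarrow> polynomial_in I (\<lambda>\<theta>. f \<theta> i j)"
  shows "polynomial_in I (\<lambda>\<theta>. det (mat r r (\<lambda>(i, j). f \<theta> i j)))"
proof -
  have "det (mat r r (\<lambda>(i, j). f \<theta> i j)) =
      (\<Sum>p | p permutes {0..<r}. signof p * (\<Prod>i = 0..<r. f \<theta> i (p i)))" for \<theta>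
    unfolding det_def using permutes_in_image
    by (auto intro!: sum.cong prod.cong arg_cong2[where f = "(*)"] dest: permutes_in_image)
  then have "(\<lambda>\<theta>. det (mat r r (\<lambda>(i, j). f \<theta> i j))) =
      (\<lambda>\<theta>. \<Sum>p | p permutes {0..<r}. signof p * (\<Prod>i = 0..<r. f \<theta> i (p i)))" by blast
  moreover have "polynomial_in I (\<lambda>\<theta>. f \<theta> i (p i))" if "p permutes {0..<r}" "i \<in> {0..<r}" for p i
    using that permutes_in_image[OF that(1), of i] by (intro assms) auto
  ultimately show ?thesis
    by (simp only:) (intro polynomial_in_sum polynomial_in.mult polynomial_in.const polynomial_in_prod, blast)
qed

lemma polynomial_on_line:
  assumes "polynomial_in I f"
  shows "\<exists>p. \<forall>t. poly p t = f (\<lambda>v\<in>I. \<alpha> v + t * (\<beta> v - \<alpha> v))"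
  using assms
proof induction
  case (const c)
  show ?case by (intro exI[of _ "[:c:]"]) simp
next
  case (coord v)
  then show ?case by (intro exI[of _ "[:\<alpha> v, \<beta> v - \<alpha> v:]"]) simp
next
  case (add f g)
  then obtain p q where "\<forall>t. poly p t = f (\<lambda>v\<in>I. \<alpha> v + t * (\<beta> v - \<alpha> v))"
    "\<forall>t. poly q t = g (\<lambda>v\<in>I. \<alpha> v + t * (\<beta> v - \<alpha> v))" by blast
  then show ?case by (intro exI[of _ "p + q"] allI) (simp only: poly_add)
next
  case (mult f g)
  then obtain p q where "\<forall>t. poly p t = f (\<lambda>v\<in>I. \<alpha> v + t * (\<beta> v - \<alpha> v))"
    "\<forall>t. poly q t = g (\<lambda>v\<in>I. \<alpha> v + t * (\<beta> v - \<alpha> v))" by blast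
  then show ?case by (intro exI[of _ "p * q"] allI) (simp only: poly_mult)
qed

text \<open>On the line through \<open>\<alpha>\<close> and \<open>\<beta>\<close> both functions
  become nonzero univariate polynomials, so their product has finitely many roots.\<close>

lemma common_nonzero:
  assumes f: "polynomial_in I f" and g: "polynomial_in I g"
    and \<alpha>: "\<alpha> \<in> coord_space I" "f \<alpha> \<noteq> 0" and \<beta>: "\<beta> \<in> coord_space I" "g \<beta> \<noteq> 0"
  shows "\<exists>\<theta>\<in>coord_space I. f \<theta> \<noteq> 0 \<and> g \<theta> \<noteq> 0"
proof -
  define l where "l t = (\<lambda>v\<in>I. \<alpha> v + t * (\<beta> v - \<alpha> v))" for t
  obtain p q where p: "\<And>t. poly p t = f (l t)" and q: "\<And>t. poly q t = g (l t)"
    unfolding l_def using polynomial_on_line[OF f] polynomial_on_line[OF g] by metis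
  have "l 0 = \<alpha>" "l 1 = \<beta>" using \<alpha>(1) \<beta>(1)
    by (auto simp: l_def coord_space_def PiE_def extensional_def fun_eq_iff)
  then have "poly p 0 \<noteq> 0" "poly q 1 \<noteq> 0" using \<alpha>(2) \<beta>(2) by (simp_all add: p q)
  then have "p * q \<noteq> 0" by auto
  then have "finite {t. poly (p * q) t = 0}" by (rule poly_roots_finite)
  then obtain t where "poly (p * q) t \<noteq> 0"
    using ex_new_if_finite[OF infinite_UNIV_char_0] by blast
  then have "f (l t) \<noteq> 0" "g (l t) \<noteq> 0" using p q by auto
  moreover have "l t \<in> coord_space I" by (simp add: l_def coord_space_def)
  ultimately show ?thesis by blast
qed

text \<open>\<open>THE\<close> demands uniqueness: by \<open>common_nonzero\<close> the set where
  \<open>f\<close> is nonzero meets the complement of any proper variety, which fixes the generic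
  value.\<close>

lemma generic_value_eq:
  fixes \<rho> :: "('v \<Rightarrow> real) \<Rightarrow> nat"
  assumes le: "\<And>\<theta>. \<theta> \<in> coord_space I \<Longrightarrow> \<rho> \<theta> \<le> r"
    and f: "polynomial_in I f" "\<alpha> \<in> coord_space I" "f \<alpha> \<noteq> 0"
    and ge: "\<And>\<theta>. \<theta> \<in> coord_space I \<Longrightarrow> f \<theta> \<noteq> 0 \<Longrightarrow> r \<le> \<rho> \<theta>"
  shows "(THE d. \<exists>V. proper_variety I V \<and> (\<forall>\<theta>\<in>coord_space I - V. \<rho> \<theta> = d)) = r"
proof (rule the_equality)
  define V where "V = {\<theta> \<in> coord_space I. \<forall>g\<in>{f}. g \<theta> = 0}"
  have "variety I V" unfolding variety_def V_def using f(1) by (intro exI[of _ "{f}"]) simp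
  moreover have "V \<noteq> coord_space I" using f(2,3) by (auto simp: V_def)
  ultimately have "proper_variety I V" by (simp add: proper_variety_def)
  moreover have "\<rho> \<theta> = r" if "\<theta> \<in> coord_space I - V" for \<theta>
    using that le[of \<theta>] ge[of \<theta>] by (auto simp: V_def)
  ultimately show "\<exists>V. proper_variety I V \<and> (\<forall>\<theta>\<in>coord_space I - V. \<rho> \<theta> = r)" by blast
next
  fix d assume "\<exists>V. proper_variety I V \<and> (\<forall>\<theta>\<in>coord_space I - V. \<rho> \<theta> = d)"
  then obtain V where V: "proper_variety I V" "\<And>\<theta>. \<theta> \<in> coord_space I - V \<Longrightarrow> \<rho> \<theta> = d" by blast
  then obtain G where G: "\<forall>g\<in>G. polynomial_in I g" "V = {\<theta> \<in> coord_space I. \<forall>g\<in>G. g \<theta> = 0}"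
    unfolding proper_variety_def variety_def by blast
  moreover have "V \<noteq> coord_space I" using V(1) by (simp add: proper_variety_def)
  ultimately obtain \<beta> g where b: "\<beta> \<in> coord_space I" "g \<in> G" "g \<beta> \<noteq> 0" by blast
  then obtain \<theta> where t: "\<theta> \<in> coord_space I" "f \<theta> \<noteq> 0" "g \<theta> \<noteq> 0"
    using common_nonzero[where f = f and g = g and \<alpha> = \<alpha> and \<beta> = \<beta>] f b G(1) by blast
  then have "\<rho> \<theta> = d" using V(2)[of \<theta>] G(2) b(2) by blast
  moreover have "\<rho> \<theta> = r" using le[OF t(1)] ge[OF t(1,2)] by simp
  ultimately show "d = r" by simp
qed

section \<open>Krylov sequences and the controllable subspace\<close>

lemma mulv_adjoint:
  assumes sym: "\<And>a b. a \<in> V \<Longrightarrow> b \<in> V \<Longrightarrow> G a b = G b a"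
  shows "(\<Sum>a\<in>V. y a * (mulv V G ^^ k) z a) = (\<Sum>a\<in>V. (mulv V G ^^ k) y a * z a)"
proof (induction k arbitrary: z)
  case (Suc k)
  have one: "(\<Sum>a\<in>V. y a * mulv V G z a) = (\<Sum>a\<in>V. mulv V G y a * z a)" for y z
  proof -
    have "(\<Sum>a\<in>V. y a * mulv V G z a) = (\<Sum>a\<in>V. \<Sum>b\<in>V. G a b * (y a * z b))"
      by (simp add: mulv_def sum_distrib_left mult_ac)
    also have "\<dots> = (\<Sum>b\<in>V. \<Sum>a\<in>V. G b a * (y a * z b))"
      by (subst sum.swap) (intro sum.cong refl, simp add: sym)
    also have "\<dots> = (\<Sum>a\<in>V. mulv V G y a * z a)"
      unfolding mulv_def sum_distrib_right by (intro sum.cong refl) (simp add: mult_ac)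
    finally show ?thesis .
  qed
  have "(\<Sum>a\<in>V. y a * (mulv V G ^^ Suc k) z a) = (\<Sum>a\<in>V. y a * (mulv V G ^^ k) (mulv V G z) a)"
    by (simp only: funpow_Suc_right o_apply)
  also have "\<dots> = (\<Sum>a\<in>V. (mulv V G ^^ k) y a * mulv V G z a)" by (rule Suc.IH)
  also have "\<dots> = (\<Sum>a\<in>V. mulv V G ((mulv V G ^^ k) y) a * z a)" by (rule one)
  finally show ?case by simp
qed simp

text \<open>The first \<open>card V + 1\<close> iterates are dependent. The top index
  \<open>k0\<close> of a dependence gives a recurrence of order \<open>k0\<close>, and applying
  powers of \<open>G\<close> reduces all later iterates. Thus the powers below \<open>n\<close> in
  \<open>controllability_mat\<close> speak for all powers.\<close>

lemma krylov_truncate: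
  assumes V: "finite V" and z: "\<And>k. k < card V \<Longrightarrow> (\<Sum>a\<in>V. y a * (mulv V G ^^ k) z a) = 0"
  shows "(\<Sum>a\<in>V. y a * (mulv V G ^^ k) z a) = 0"
proof -
  define w where "w k = (mulv V G ^^ k) z" for k
  obtain c where c: "\<exists>k\<in>{..card V}. c k \<noteq> 0" "\<And>a. a \<in> V \<Longrightarrow> (\<Sum>k\<in>{..card V}. w k a * c k) = 0"
    using homogeneous_system_nontrivial[of V "{..card V}" "\<lambda>a k. w k a"] V by auto
  define k0 where "k0 = Max {k. k \<le> card V \<and> c k \<noteq> 0}"
  have fin: "finite {k. k \<le> card V \<and> c k \<noteq> 0}" by simp
  have "k0 \<in> {k. k \<le> card V \<and> c k \<noteq> 0}" unfolding k0_def using c(1) by (intro Max_in fin) auto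
  then have k0: "k0 \<le> card V" "c k0 \<noteq> 0" by auto
  have top: "c k = 0" if "k0 < k" "k \<le> card V" for k
  proof (rule ccontr)
    assume "c k \<noteq> 0"
    then have "k \<le> k0" unfolding k0_def using that by (intro Max_ge fin) simp
    then show False using that by simp
  qed
  define d where "d k = - c k / c k0" for k
  have dep: "w k0 a = (\<Sum>k<k0. d k * w k a)" if a: "a \<in> V" for a
  proof -
    have "(\<Sum>k\<in>{..card V}. w k a * c k) = (\<Sum>k\<in>{..k0}. w k a * c k)"
      using k0(1) top by (intro sum.mono_neutral_right) auto
    also have "\<dots> = (\<Sum>k<k0. w k a * c k) + w k0 a * c k0"
      by (simp add: lessThan_Suc_atMost[symmetric])
    finally have "w k0 a = - (\<Sum>k<k0. w k a * c k) / c k0"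
      using c(2)[OF a] k0(2) by (simp add: field_simps)
    also have "\<dots> = (\<Sum>k<k0. d k * w k a)"
      by (simp add: d_def sum_negf[symmetric] sum_divide_distrib mult_ac)
    finally show ?thesis .
  qed
  have shift: "w (j + k0) a = (\<Sum>k<k0. d k * w (j + k) a)" if "a \<in> V" for j a
    using that
  proof (induction j arbitrary: a)
    case (Suc j)
    have "w (Suc j + k0) = mulv V G (w (j + k0))" by (simp add: w_def)
    also have "\<dots> = mulv V G (\<lambda>a. \<Sum>k<k0. d k * w (j + k) a)" by (rule mulv_cong) (rule Suc.IH)
    also have "\<dots> = (\<lambda>a. \<Sum>k<k0. d k * w (Suc j + k) a)" by (simp add: mulv_sum w_def)
    finally show ?case by simp
  qed (simp add: dep)
  have "(\<Sum>a\<in>V. y a * w k a) = 0"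
  proof (induction k rule: less_induct)
    case (less k)
    show ?case
    proof (cases "k < card V")
      case False
      define j where "j = k - k0"
      have k: "k = j + k0" using False k0(1) by (simp add: j_def)
      have "(\<Sum>a\<in>V. y a * w k a) = (\<Sum>a\<in>V. \<Sum>i<k0. d i * (y a * w (j + i) a))"
        unfolding k by (intro sum.cong refl) (simp add: shift sum_distrib_left mult_ac)
      also have "\<dots> = (\<Sum>i<k0. d i * (\<Sum>a\<in>V. y a * w (j + i) a))"
        by (subst sum.swap) (simp add: sum_distrib_left)
      also have "\<dots> = 0" using less k by (intro sum.neutral) auto
      finally show ?thesis .
    qed (simp add: w_def z)
  qed
  then show ?thesis by (simp add: w_def)
qed

lemma pow_mat_mult_index:
  assumes A: "A \<in> carrier_mat n n" and "B \<in> carrier_mat n m" "i < n" "j < m"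
  shows "(A ^\<^sub>m k * B) $$ (i, j) = (mulv {..<n} (\<lambda>i j. A $$ (i, j)) ^^ k) (\<lambda>i. B $$ (i, j)) i"
  using assms(2,3)
proof (induction k arbitrary: B i)
  case 0
  then show ?case using assms by simp
next
  case (Suc k)
  have AB: "A * B \<in> carrier_mat n m" using A Suc.prems by simp
  have "A ^\<^sub>m Suc k * B = A ^\<^sub>m k * (A * B)"
    using A Suc.prems(1) by (simp add: assoc_mult_mat[of _ n n _ n _ m])
  then have "(A ^\<^sub>m Suc k * B) $$ (i, j) =
      (mulv {..<n} (\<lambda>i j. A $$ (i, j)) ^^ k) (\<lambda>i. (A * B) $$ (i, j)) i"
    using Suc.IH[OF AB Suc.prems(2)] by simp
  also have "\<dots> = (mulv {..<n} (\<lambda>i j. A $$ (i, j)) ^^ k)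
      (mulv {..<n} (\<lambda>i j. A $$ (i, j)) (\<lambda>i. B $$ (i, j))) i"
  proof (rule mulv_pow_cong)
    fix b assume "b \<in> {..<n}"
    then show "(A * B) $$ (b, j) = mulv {..<n} (\<lambda>i j. A $$ (i, j)) (\<lambda>i. B $$ (i, j)) b"
      using A Suc.prems(1) \<open>j < m\<close> by (simp add: mulv_def scalar_prod_def atLeast0LessThan)
  qed (use Suc.prems in simp)
  finally show ?case by (simp only: funpow_Suc_right o_apply)
qed

lemma orthogonal_to_span:
  assumes X: "X \<subseteq> carrier_vec n" and z: "\<And>x. x \<in> X \<Longrightarrow> (\<Sum>i<n. x $ i * z i) = 0"
    and w: "w \<in> LinearCombinations.module.span class_ring (module_vec TYPE(real) n) X"
  shows "(\<Sum>i<n. w $ i * z i) = 0"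
proof -
  interpret vec_space "TYPE(real)" n .
  define K where "K = {w \<in> carrier_vec n. (\<Sum>i<n. w $ i * z i) = 0}"
  have "submodule class_ring K V"
    unfolding K_def
    by unfold_locales (auto simp: class_ring_simps module_vec_simps algebra_simps sum.distrib sum_distrib_left[symmetric])
  moreover have "X \<subseteq> K" using X z by (auto simp: K_def)
  ultimately have "span X \<subseteq> K" using span_is_subset by blast
  then show ?thesis using w by (auto simp: K_def)
qed

context
  fixes n m :: nat and A B :: "real mat"
  assumes A: "A \<in> carrier_mat n n" and B: "B \<in> carrier_mat n m"
    and sym: "\<And>i j. i < n \<Longrightarrow> j < n \<Longrightarrow> A $$ (i, j) = A $$ (j, i)"
begin

definition controllable_subspace :: "real vec set" where
  "controllable_subspace = LinearCombinations.module.span class_ring (module_vec TYPE(real) n)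
     (set (cols (controllability_mat A B)))"

lemma controllability_cols:
  "set (cols (controllability_mat A B)) = {col (A ^\<^sub>m k * B) l |k l. k < n \<and> l < m}"
proof -
  have AB: "A ^\<^sub>m k * B \<in> carrier_mat n m" for k
    using A B by (intro mult_carrier_mat[of _ n n] pow_carrier_mat)
  have "set (cols (A ^\<^sub>m k * B)) = {col (A ^\<^sub>m k * B) l |l. l < m}" for k
    using carrier_matD(2)[OF AB[of k]] by (auto simp: cols_def)
  then have eq: "set (concat (map (\<lambda>k. cols (A ^\<^sub>m k * B)) [0..<n])) = {col (A ^\<^sub>m k * B) l |k l. k < n \<and> l < m}"
    by auto blast
  have dim: "dim_row A = n" using A by simp
  have "set (concat (map (\<lambda>k. cols (A ^\<^sub>m k * B)) [0..<n])) \<subseteq> carrier_vec n"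
    using cols_dim[of "A ^\<^sub>m _ * B"] carrier_matD(1)[OF AB] by fastforce
  then show ?thesis unfolding controllability_mat_def dim using eq by (subst cols_mat_of_cols) auto
qed

lemma col_index: "i < n \<Longrightarrow> l < m \<Longrightarrow>
    col (A ^\<^sub>m k * B) l $ i = (mulv {..<n} (\<lambda>i j. A $$ (i, j)) ^^ k) (\<lambda>i. B $$ (i, l)) i"
  using pow_mat_mult_index[OF A B, of i l k] A B by simp

lemma cols_carrier: "set (cols (controllability_mat A B)) \<subseteq> carrier_vec n"
  unfolding controllability_cols using A B by (auto intro!: carrier_vecI)

lemma controllable_subspace_of: "subspace_of n controllable_subspace"
proof -
  interpret vec_space "TYPE(real)" n .
  let ?X = "set (cols (controllability_mat A B))"
  have X: "?X \<subseteq> carrier_vec n" by (rule cols_carrier)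
  have "submodule class_ring (span ?X) V" using X by (intro span_is_submodule) simp
  then show ?thesis
    unfolding subspace_of_def controllable_subspace_def submodule_def
    by (auto simp: class_ring_simps module_vec_simps)
qed

lemma rank_controllability_mat:
  "vec_space.rank n (controllability_mat A B) = subspace_dim n controllable_subspace"
  by (simp add: vec_space.rank_def subspace_dim_def controllable_subspace_def)

text \<open>Symmetry moves the power of \<open>A\<close> from the columns of \<open>B\<close> to
  \<open>z\<close>, so orthogonality becomes unobservability. Powers from \<open>n\<close> on come
  from \<open>krylov_truncate\<close>.\<close>

lemma orthogonal_controllable_iff:
  "(\<forall>w\<in>controllable_subspace. (\<Sum>i<n. w $ i * z i) = 0) \<longleftrightarrow>
    (\<forall>k. \<forall>l<m. (\<Sum>i<n. B $$ (i, l) * (mulv {..<n} (\<lambda>i j. A $$ (i, j)) ^^ k) z i) = 0)"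
  (is "?L \<longleftrightarrow> ?R")
proof -
  let ?G = "\<lambda>i j. A $$ (i, j)"
  have adj: "(\<Sum>i<n. col (A ^\<^sub>m k * B) l $ i * z i) = (\<Sum>i<n. B $$ (i, l) * (mulv {..<n} ?G ^^ k) z i)"
    if "l < m" for k l
  proof -
    have "(\<Sum>i<n. col (A ^\<^sub>m k * B) l $ i * z i) = (\<Sum>i<n. (mulv {..<n} ?G ^^ k) (\<lambda>i. B $$ (i, l)) i * z i)"
      using that col_index by (intro sum.cong) auto
    also have "\<dots> = (\<Sum>i<n. B $$ (i, l) * (mulv {..<n} ?G ^^ k) z i)"
      using sym by (intro mulv_adjoint[symmetric]) auto
    finally show ?thesis .
  qed
  show ?thesis
  proof
    assume L: ?L
    show ?R
    proof (intro allI impI)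
      fix k l assume l: "l < m"
      have "(\<Sum>i<n. B $$ (i, l) * (mulv {..<n} ?G ^^ k) z i) = 0" if "k < n" for k
      proof -
        have "col (A ^\<^sub>m k * B) l \<in> set (cols (controllability_mat A B))"
          unfolding controllability_cols using that l by blast
        moreover have "set (cols (controllability_mat A B)) \<subseteq> controllable_subspace"
          unfolding controllable_subspace_def using cols_carrier
          by (intro module.in_own_span[OF vec_module]) (simp add: module_vec_simps)
        ultimately show ?thesis using L adj[OF l, of k] by auto
      qed
      then show "(\<Sum>i<n. B $$ (i, l) * (mulv {..<n} ?G ^^ k) z i) = 0"
        using krylov_truncate[of "{..<n}" "\<lambda>i. B $$ (i, l)" ?G z k] by simp
    qed
  next
    assume R: ?R
    show ?L
    proof
      fix w assume "w \<in> controllable_subspace"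
      then show "(\<Sum>i<n. w $ i * z i) = 0"
        unfolding controllable_subspace_def
      proof (rule orthogonal_to_span[OF cols_carrier, rotated])
        fix x assume "x \<in> set (cols (controllability_mat A B))"
        then obtain k l where "x = col (A ^\<^sub>m k * B) l" "l < m" unfolding controllability_cols by blast
        then show "(\<Sum>i<n. x $ i * z i) = 0" using adj R by simp
      qed
    qed
  qed
qed

end

section \<open>Bounds on the stabilizable dimension\<close>

text \<open>Undirected counterpart of \<open>pair_digraph\<close>: entries of \<open>B\<close> count
  in both directions, which gives the symmetry that \<open>matching_decomposition\<close>
  requires.\<close>

definition star_edge :: "pattern \<Rightarrow> pattern \<Rightarrow> vertex \<Rightarrow> vertex \<Rightarrow> bool" where
  "star_edge A B a b = (case (a, b) of
     (State i, State j) \<Rightarrow> i < dim_row A \<and> j < dim_row A \<and> A $$ (i, j) = Star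
   | (State i, Input l) \<Rightarrow> i < dim_row B \<and> l < dim_col B \<and> B $$ (i, l) = Star
   | (Input l, State i) \<Rightarrow> i < dim_row B \<and> l < dim_col B \<and> B $$ (i, l) = Star
   | (Input _, Input _) \<Rightarrow> False)"

text \<open>Matchings of rows of \<open>[A, B]\<close> from \<open>R\<close>, with the columns named
  by vertices; their largest size is the term rank of these rows, expressed without
  reindexing.\<close>

definition row_matching :: "pattern \<Rightarrow> pattern \<Rightarrow> nat set \<Rightarrow> nat \<Rightarrow> bool" where
  "row_matching A B R k \<longleftrightarrow> (\<exists>I \<sigma>. I \<subseteq> R \<and> card I = k \<and> inj_on \<sigma> I \<and>
     (\<forall>i\<in>I. star_edge A B (State i) (\<sigma> i)))"

definition separated :: "nat \<Rightarrow> nat \<Rightarrow> pattern \<Rightarrow> pattern \<Rightarrow> nat set \<Rightarrow> bool" where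
  "separated n m A B R \<longleftrightarrow> R \<subseteq> {..<n} \<and> (\<forall>i\<in>R. \<forall>j<n. j \<notin> R \<longrightarrow> A $$ (i, j) \<noteq> Star) \<and>
     (\<forall>i<n. i \<notin> R \<longrightarrow> (\<forall>l<m. B $$ (i, l) \<noteq> Star))"

text \<open>Reachability in terms of cuts, exactly the premise \<open>grow\<close> of
  \<open>structured_observability\<close>.\<close>

definition reaches :: "nat \<Rightarrow> pattern \<Rightarrow> pattern \<Rightarrow> nat set \<Rightarrow> bool" where
  "reaches m A B R \<longleftrightarrow> (\<forall>S. Input ` {..<m} \<subseteq> S \<longrightarrow> S \<subset> Input ` {..<m} \<union> State ` R \<longrightarrow>
     (\<exists>x\<in>S. \<exists>y\<in>State ` R - S. star_edge A B x y))"

definition state_edge :: "pattern \<Rightarrow> nat set \<Rightarrow> nat \<Rightarrow> nat \<Rightarrow> bool" where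
  "state_edge A Q i j \<longleftrightarrow> i \<in> Q \<and> j \<in> Q \<and> A $$ (i, j) = Star"

context
  fixes n m :: nat and A B :: pattern
  assumes A: "sym_structured n A" and B: "B \<in> carrier_mat n m"
begin

lemma pattern_dims: "dim_row A = n" "dim_col A = n" "dim_row B = n" "dim_col B = m"
  using A B by (auto simp: sym_structured_def)

lemma pattern_sym:
  assumes "i < n" "j < n"
  shows "A $$ (i, j) = A $$ (j, i)"
proof -
  have "transpose_mat A = A" using A by (simp add: sym_structured_def)
  then have "A $$ (i, j) = transpose_mat A $$ (i, j)" by simp
  then show ?thesis using assms pattern_dims by simp
qed

lemma realize_A_carrier: "realize_A A \<theta> \<in> carrier_mat n n"
  by (simp add: realize_A_def sym_realization_def pattern_dims)

lemma realize_B_carrier: "realize_B B \<theta> \<in> carrier_mat n m"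
  by (simp add: realize_B_def struct_realization_def pattern_dims)

lemma realize_A_index:
  "i < n \<Longrightarrow> j < n \<Longrightarrow> realize_A A \<theta> $$ (i, j) =
    (if A $$ (i, j) = Star then \<theta> (Inl (min i j, max i j)) else 0)"
  by (simp add: realize_A_def sym_realization_def pattern_dims)

lemma realize_B_index:
  "i < n \<Longrightarrow> l < m \<Longrightarrow> realize_B B \<theta> $$ (i, l) = (if B $$ (i, l) = Star then \<theta> (Inr (i, l)) else 0)"
  by (simp add: realize_B_def struct_realization_def pattern_dims)

lemma realize_A_sym: "i < n \<Longrightarrow> j < n \<Longrightarrow> realize_A A \<theta> $$ (i, j) = realize_A A \<theta> $$ (j, i)"
  using pattern_sym[of i j] by (simp add: realize_A_index min.commute max.commute)

lemma star_mem_params: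
  assumes "i < n" "j < n" "A $$ (i, j) = Star"
  shows "Inl (min i j, max i j) \<in> pair_params A B"
proof -
  have "A $$ (min i j, max i j) = Star"
    using assms pattern_sym[of i j] by (cases "i \<le> j") (auto simp: min_def max_def)
  then show ?thesis using assms by (auto simp: pair_params_def sym_params_def pattern_dims)
qed

lemma star_mem_params_B:
  assumes "i < n" "l < m" "B $$ (i, l) = Star"
  shows "Inr (i, l) \<in> pair_params A B"
  using assms by (auto simp: pair_params_def struct_params_def pattern_dims)

lemma realization_exists:
  fixes a b :: "nat \<Rightarrow> nat \<Rightarrow> real"
  assumes a: "\<And>i j. a i j = a j i" "\<And>i j. i < n \<Longrightarrow> j < n \<Longrightarrow> a i j \<noteq> 0 \<Longrightarrow> A $$ (i, j) = Star"
    and b: "\<And>i l. i < n \<Longrightarrow> l < m \<Longrightarrow> b i l \<noteq> 0 \<Longrightarrow> B $$ (i, l) = Star"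
  shows "\<exists>\<theta>\<in>coord_space (pair_params A B).
    (\<forall>i<n. \<forall>j<n. realize_A A \<theta> $$ (i, j) = a i j) \<and> (\<forall>i<n. \<forall>l<m. realize_B B \<theta> $$ (i, l) = b i l)"
proof -
  define \<theta> where "\<theta> = (\<lambda>p\<in>pair_params A B. case p of Inl (i, j) \<Rightarrow> a i j | Inr (i, l) \<Rightarrow> b i l)"
  have "\<theta> \<in> coord_space (pair_params A B)" by (simp add: \<theta>_def coord_space_def)
  moreover have "realize_A A \<theta> $$ (i, j) = a i j" if "i < n" "j < n" for i j
  proof (cases "A $$ (i, j) = Star")
    case True
    then have "realize_A A \<theta> $$ (i, j) = a (min i j) (max i j)"
      using that star_mem_params by (simp add: realize_A_index \<theta>_def)
    then show ?thesis using a(1)[of i j] by (cases "i \<le> j") (auto simp: min_def max_def)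
  next
    case False
    then show ?thesis using that a(2)[of i j] by (auto simp: realize_A_index)
  qed
  moreover have "realize_B B \<theta> $$ (i, l) = b i l" if "i < n" "l < m" for i l
    using that b[of i l] star_mem_params_B[of i l] by (auto simp: realize_B_index \<theta>_def)
  ultimately show ?thesis by blast
qed

lemma polynomial_in_realize_A:
  "i < n \<Longrightarrow> j < n \<Longrightarrow> polynomial_in (pair_params A B) (\<lambda>\<theta>. realize_A A \<theta> $$ (i, j))"
  using star_mem_params[of i j] by (cases "A $$ (i, j) = Star") (simp_all add: realize_A_index polynomial_in.coord polynomial_in.const)

lemma polynomial_in_realize_B:
  "i < n \<Longrightarrow> l < m \<Longrightarrow> polynomial_in (pair_params A B) (\<lambda>\<theta>. realize_B B \<theta> $$ (i, l))"
  using star_mem_params_B[of i l] by (cases "B $$ (i, l) = Star") (simp_all add: realize_B_index polynomial_in.coord polynomial_in.const)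

lemma polynomial_in_krylov:
  assumes "i < n" "l < m"
  shows "polynomial_in (pair_params A B)
    (\<lambda>\<theta>. (mulv {..<n} (\<lambda>i j. realize_A A \<theta> $$ (i, j)) ^^ k) (\<lambda>i. realize_B B \<theta> $$ (i, l)) i)"
  using assms(1)
proof (induction k arbitrary: i)
  case 0
  then show ?case using assms by (simp add: polynomial_in_realize_B)
next
  case (Suc k)
  show ?case unfolding funpow.simps o_apply mulv_def[of _ _ "(mulv _ _ ^^ k) _"]
    by (intro polynomial_in_sum polynomial_in.mult polynomial_in_realize_A Suc) (use Suc.prems in auto)
qed

text \<open>The columns \<open>Inr q\<close> are unit columns for the rows outside \<open>R\<close>.\<close>

lemma subspace_dim_row_matching:
  fixes M :: "nat \<Rightarrow> vertex + nat \<Rightarrow> real"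
  assumes W: "subspace_of n W" and R: "R \<subseteq> {..<n}" and S: "S \<subseteq> {..<n} - R"
    and triv: "\<And>w. w \<in> W \<Longrightarrow> \<forall>i<n. i \<notin> S \<longrightarrow> w $ i = 0 \<Longrightarrow> \<forall>i<n. w $ i = 0"
    and ker: "\<And>z w. w \<in> W \<Longrightarrow> \<forall>i. i \<notin> R \<longrightarrow> z i = 0 \<Longrightarrow>
      \<forall>j<n. (\<Sum>i<n. realize_A A \<theta> $$ (i, j) * z i) = 0 \<Longrightarrow>
      \<forall>l<m. (\<Sum>i<n. realize_B B \<theta> $$ (i, l) * z i) = 0 \<Longrightarrow> (\<Sum>i<n. w $ i * z i) = 0"
  shows "\<exists>k. row_matching A B R k \<and> subspace_dim n W + card S + card R \<le> k + n"
proof -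
  define Q where "Q = {..<n} - R"
  \<comment> \<open>Rows outside \<open>R\<close> keep only their unit column, so the left kernel of
    \<open>M\<close> consists of the vectors supported in \<open>R\<close> that annihilate all
    columns of \<open>A\<close> and \<open>B\<close>.\<close>
  define M where "M i x = (case x of
      Inl (State j) \<Rightarrow> if i \<in> R then realize_A A \<theta> $$ (i, j) else 0
    | Inl (Input l) \<Rightarrow> if i \<in> R then realize_B B \<theta> $$ (i, l) else 0
    | Inr q \<Rightarrow> if i = q then 1 else 0)" for i x
  define J where "J = (State ` {..<n} \<union> Input ` {..<m}) <+> Q"
  have finQ: "finite Q" by (simp add: Q_def)
  have MQ: "(\<Sum>i<n. M i (Inr q) * z i) = z q" if "q \<in> Q" for q z
  proof -
    have "(\<Sum>i<n. M i (Inr q) * z i) = (\<Sum>i<n. if i = q then z i else 0)"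
      by (intro sum.cong) (auto simp: M_def)
    then show ?thesis using that by (simp add: Q_def)
  qed
  have kerM: "(\<forall>q\<in>Q. z q = 0) \<and> (\<forall>j<n. (\<Sum>i<n. realize_A A \<theta> $$ (i, j) * z i) = 0) \<and>
      (\<forall>l<m. (\<Sum>i<n. realize_B B \<theta> $$ (i, l) * z i) = 0)"
    if z: "\<forall>x\<in>J. (\<Sum>i<n. M i x * z i) = 0" for z
  proof (intro conjI ballI allI impI)
    have zQ: "z q = 0" if q: "q \<in> Q" for q
    proof -
      have "Inr q \<in> J" using q by (auto simp: J_def)
      from bspec[OF z this] show ?thesis using MQ[OF q, of z] by simp
    qed
    then show "z q = 0" if "q \<in> Q" for q using that .
    have zn: "z i = 0" if "i \<in> {..<n}" "i \<notin> R" for i using zQ that by (simp add: Q_def)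
    fix j assume j: "j < n"
    have "Inl (State j) \<in> J" using j by (auto simp: J_def)
    then have "(\<Sum>i<n. M i (Inl (State j)) * z i) = 0" using z by blast
    moreover have "(\<Sum>i<n. M i (Inl (State j)) * z i) = (\<Sum>i<n. realize_A A \<theta> $$ (i, j) * z i)"
      using zn by (intro sum.cong refl) (auto simp: M_def)
    ultimately show "(\<Sum>i<n. realize_A A \<theta> $$ (i, j) * z i) = 0" by simp
  next
    have zn: "z i = 0" if i: "i \<in> {..<n}" "i \<notin> R" for i
    proof -
      have q: "i \<in> Q" using i by (simp add: Q_def)
      then have "Inr i \<in> J" by (auto simp: J_def)
      from bspec[OF z this] show ?thesis using MQ[OF q, of z] by simp
    qed
    fix l assume l: "l < m"
    have "Inl (Input l) \<in> J" using l by (auto simp: J_def)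
    then have "(\<Sum>i<n. M i (Inl (Input l)) * z i) = 0" using z by blast
    moreover have "(\<Sum>i<n. M i (Inl (Input l)) * z i) = (\<Sum>i<n. realize_B B \<theta> $$ (i, l) * z i)"
      using zn by (intro sum.cong refl) (auto simp: M_def)
    ultimately show "(\<Sum>i<n. realize_B B \<theta> $$ (i, l) * z i) = 0" by simp
  qed
  have "\<exists>R' h. R' \<subseteq> {..<n} \<and> card R' = subspace_dim n W + card S \<and> inj_on h R' \<and> h ` R' \<subseteq> J \<and>
    (\<forall>i\<in>R'. M i (h i) \<noteq> 0)"
  proof (rule subspace_dim_transversal[OF W])
    show "finite J" by (simp add: J_def finQ)
    show "S \<subseteq> {..<n}" using S by blast
    show "\<forall>i<n. w $ i = 0" if "w \<in> W" "\<forall>i<n. i \<notin> S \<longrightarrow> w $ i = 0" for w by (rule triv[OF that])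
    show "z s = 0" if "\<forall>x\<in>J. (\<Sum>i<n. M i x * z i) = 0" "s \<in> S" for z s
      using kerM[OF that(1)] that(2) S by (auto simp: Q_def)
    show "(\<Sum>i<n. w $ i * z i) = 0" if z: "\<forall>x\<in>J. (\<Sum>i<n. M i x * z i) = 0" and w: "w \<in> W" for z w
    proof -
      define y where "y i = (if i \<in> R then z i else 0)" for i
      have yz: "y i = z i" if "i < n" for i using kerM[OF z] that by (auto simp: y_def Q_def)
      have s: "(\<Sum>i<n. f i * y i) = (\<Sum>i<n. f i * z i)" for f
        by (intro sum.cong refl) (simp add: yz)
      have "\<forall>i. i \<notin> R \<longrightarrow> y i = 0" by (simp add: y_def)
      then have "(\<Sum>i<n. w $ i * y i) = 0"
        using kerM[OF z] by (intro ker[OF w]) (simp_all add: s)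
      then show ?thesis by (simp add: yz)
    qed
  qed
  then obtain R' h where h: "R' \<subseteq> {..<n}" "card R' = subspace_dim n W + card S" "inj_on h R'" "h ` R' \<subseteq> J"
    "\<And>i. i \<in> R' \<Longrightarrow> M i (h i) \<noteq> 0" by blast
  \<comment> \<open>At most \<open>n - card R\<close> rows of the transversal lie outside
    \<open>R\<close>; those inside cannot use unit columns and form the matching.\<close>
  define I where "I = R' \<inter> R"
  have hI: "\<exists>v. h i = Inl v \<and> star_edge A B (State i) v" if i: "i \<in> I" for i
  proof (cases "h i")
    case (Inr q)
    have "h i \<in> J" using h(4) i unfolding I_def by blast
    then have "q \<in> Q" using Inr by (auto simp: J_def)
    moreover have "i = q" using h(5)[of i] i Inr by (auto simp: I_def M_def split: if_splits)
    ultimately show ?thesis using i by (simp add: I_def Q_def)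
  next
    case (Inl v)
    have iR: "i \<in> R" "i < n" using i R by (auto simp: I_def)
    have "h i \<in> J" using h(4) i unfolding I_def by blast
    then have vJ: "v \<in> State ` {..<n} \<union> Input ` {..<m}" using Inl by (auto simp: J_def)
    have nz: "M i (Inl v) \<noteq> 0" using h(5)[of i] i Inl by (simp add: I_def)
    have "star_edge A B (State i) v"
    proof (cases v)
      case (State j)
      then have "j < n" using vJ by auto
      then show ?thesis using nz State iR by (auto simp: M_def star_edge_def pattern_dims realize_A_index split: if_splits)
    next
      case (Input l)
      then have "l < m" using vJ by auto
      then show ?thesis using nz Input iR by (auto simp: M_def star_edge_def pattern_dims realize_B_index split: if_splits)
    qed
    then show ?thesis using Inl by blast
  qed
  define \<sigma> where "\<sigma> i = projl (h i)" for i
  have "inj_on \<sigma> I"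
  proof (rule inj_onI)
    fix i j assume ij: "i \<in> I" "j \<in> I" "\<sigma> i = \<sigma> j"
    then have "h i = h j" using hI[of i] hI[of j] by (auto simp: \<sigma>_def)
    then show "i = j" using h(3) ij by (auto simp: I_def inj_on_def)
  qed
  moreover have "star_edge A B (State i) (\<sigma> i)" if "i \<in> I" for i using hI[OF that] by (auto simp: \<sigma>_def)
  moreover have "I \<subseteq> R" by (simp add: I_def)
  ultimately have "row_matching A B R (card I)" unfolding row_matching_def by blast
  moreover have "card R' + card R \<le> card I + n"
  proof -
    have "R' \<union> R \<subseteq> {..<n}" using h(1) R by blast
    then have "card (R' \<union> R) \<le> n" using card_mono[of "{..<n}" "R' \<union> R"] by simp
    moreover have "card R' + card R = card (R' \<union> R) + card (R' \<inter> R)"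
      using h(1) R by (intro card_Un_Int) (auto intro: finite_subset)
    ultimately show ?thesis by (simp add: I_def)
  qed
  ultimately show ?thesis using h(2) by (intro exI[of _ "card I"]) simp
qed

lemma stabilizable_dim_upper:
  assumes sep: "separated n m A B R"
    and S: "S \<subseteq> {..<n} - R" "\<And>i j. i \<in> S \<Longrightarrow> j \<in> S \<Longrightarrow> A $$ (i, j) \<noteq> Star"
  shows "\<exists>k. row_matching A B R k \<and>
    subspace_dim n (stabilizable_subspace (realize_A A \<theta>) (realize_B B \<theta>)) + card S + card R \<le> k + n"
proof (rule subspace_dim_row_matching[OF _ _ S(1)])
  note AB = realize_A_carrier[of \<theta>] realize_B_carrier[of \<theta>]
  show "subspace_of n (stabilizable_subspace (realize_A A \<theta>) (realize_B B \<theta>))"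
    by (rule stabilizable_subspace_of[OF AB])
  show R: "R \<subseteq> {..<n}" using sep by (simp add: separated_def)
  fix w assume w: "w \<in> stabilizable_subspace (realize_A A \<theta>) (realize_B B \<theta>)"
  {
    assume wS: "\<forall>i<n. i \<notin> S \<longrightarrow> w $ i = 0"
    have "w $ i = 0" if i: "i \<in> {..<n} - R" for i
    proof (rule stabilizable_uncontrolled_block[OF AB realize_A_sym _ _ _ w _ i])
      show "realize_A A \<theta> $$ (i, j) = 0" if "i \<in> {..<n} - R" "j < n" "j \<notin> {..<n} - R" for i j
        using that sep pattern_sym[of i j] by (auto simp: realize_A_index separated_def)
      show "realize_B B \<theta> $$ (i, j) = 0" if "i \<in> {..<n} - R" "j < m" for i j
        using that sep by (auto simp: realize_B_index separated_def)
      have "realize_A A \<theta> $$ (i, j) * w $ i * w $ j = 0" if "i \<in> {..<n} - R" "j \<in> {..<n} - R" for i j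
      proof (cases "i \<in> S \<and> j \<in> S")
        case True
        then show ?thesis using S(2)[of i j] that by (simp add: realize_A_index)
      next
        case False
        then show ?thesis using wS that by auto
      qed
      then have "(\<Sum>i\<in>{..<n} - R. \<Sum>j\<in>{..<n} - R. realize_A A \<theta> $$ (i, j) * w $ i * w $ j) = 0"
        by (intro sum.neutral ballI)
      then show "0 \<le> (\<Sum>i\<in>{..<n} - R. \<Sum>j\<in>{..<n} - R. realize_A A \<theta> $$ (i, j) * w $ i * w $ j)"
        by simp
    qed auto
    then show "\<forall>i<n. w $ i = 0" using wS S(1) by blast
  }
  fix z assume "\<forall>j<n. (\<Sum>i<n. realize_A A \<theta> $$ (i, j) * z i) = 0"
    "\<forall>l<m. (\<Sum>i<n. realize_B B \<theta> $$ (i, l) * z i) = 0"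
  then show "(\<Sum>i<n. w $ i * z i) = 0" by (rule stabilizable_left_kernel[OF AB _ _ w])
qed

text \<open>The same count with all rows in \<open>R\<close> and \<open>S\<close> empty. By symmetry
  a vector \<open>z\<close> of the left kernel satisfies \<open>A z = 0\<close>, so all its further
  iterates vanish and it is orthogonal to the controllable subspace.\<close>

lemma controllable_rank_upper:
  "\<exists>k. row_matching A B {..<n} k \<and>
    vec_space.rank n (controllability_mat (realize_A A \<theta>) (realize_B B \<theta>)) \<le> k"
proof -
  note AB = realize_A_carrier[of \<theta>] realize_B_carrier[of \<theta>]
  let ?W = "controllable_subspace n (realize_A A \<theta>) (realize_B B \<theta>)"
  have "\<exists>k. row_matching A B {..<n} k \<and> subspace_dim n ?W + card ({} :: nat set) + card {..<n} \<le> k + n"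
  proof (rule subspace_dim_row_matching)
    show "subspace_of n ?W" by (rule controllable_subspace_of[OF AB realize_A_sym])
    fix w z assume w: "w \<in> ?W"
      and zA: "\<forall>j<n. (\<Sum>i<n. realize_A A \<theta> $$ (i, j) * z i) = 0"
      and zB: "\<forall>l<m. (\<Sum>i<n. realize_B B \<theta> $$ (i, l) * z i) = 0"
    let ?G = "\<lambda>i j. realize_A A \<theta> $$ (i, j)"
    have Az: "mulv {..<n} ?G z i = 0" if "i < n" for i
    proof -
      have "mulv {..<n} ?G z i = (\<Sum>j<n. realize_A A \<theta> $$ (j, i) * z j)"
        unfolding mulv_def using that by (intro sum.cong refl) (simp add: realize_A_sym[of i])
      then show ?thesis using zA that by simp
    qed
    have pow: "(mulv {..<n} ?G ^^ Suc k) z i = 0" if "i < n" for k i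
      using that
    proof (induction k arbitrary: i)
      case (Suc k)
      have "(mulv {..<n} ?G ^^ Suc (Suc k)) z i = (\<Sum>j<n. ?G i j * (mulv {..<n} ?G ^^ Suc k) z j)"
        by (simp add: mulv_def)
      also have "\<dots> = 0" using Suc.IH by (intro sum.neutral) simp
      finally show ?case .
    qed (simp add: Az)
    have "(\<Sum>i<n. realize_B B \<theta> $$ (i, l) * (mulv {..<n} ?G ^^ k) z i) = 0" if "l < m" for k l
    proof (cases k)
      case 0
      then show ?thesis using zB that by simp
    next
      case (Suc j)
      then show ?thesis using pow by (intro sum.neutral) (simp del: funpow.simps)
    qed
    then show "(\<Sum>i<n. w $ i * z i) = 0"
      using orthogonal_controllable_iff[OF AB realize_A_sym, of z] w by blast
  qed auto
  then show ?thesis using rank_controllability_mat[OF AB realize_A_sym] by auto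
qed

end

section \<open>Realizations for the lower bound\<close>

context
  fixes n m :: nat and A B :: pattern
  assumes A: "sym_structured n A" and B: "B \<in> carrier_mat n m"
begin

text \<open>In use, \<open>G\<close> lives on the vertices reachable from inputs and the signed
  cycles on the other states, so the sum is block diagonal.\<close>

definition block_realization ::
  "nat set \<Rightarrow> (vertex \<Rightarrow> vertex \<Rightarrow> real) \<Rightarrow> nat list set \<Rightarrow> (param \<Rightarrow> real) \<Rightarrow> bool"
where
  "block_realization R G \<D> \<theta> \<longleftrightarrow> \<theta> \<in> coord_space (pair_params A B) \<and>
     (\<forall>i<n. \<forall>j<n. realize_A A \<theta> $$ (i, j) =
        G (State i) (State j) + (\<Sum>c\<in>\<D>. cycle_matrix c (sign_weight (length c)) i j)) \<and>
     (\<forall>i<n. \<forall>l<m. realize_B B \<theta> $$ (i, l) = G (State i) (Input l))"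

definition cycle_family :: "nat set \<Rightarrow> nat list set \<Rightarrow> bool" where
  "cycle_family Q \<D> \<longleftrightarrow> finite \<D> \<and> (\<forall>c\<in>\<D>. cycle_in (state_edge A Q) c) \<and>
     (\<forall>c\<in>\<D>. \<forall>d\<in>\<D>. c \<noteq> d \<longrightarrow> set c \<inter> set d = {})"

lemma star_edge_symp: "symp (star_edge A B)"
  unfolding symp_def star_edge_def
  using pattern_sym[OF A B] pattern_dims[OF A B] by (auto split: vertex.splits)

lemma cycle_family_subset:
  assumes "cycle_family Q \<D>" "c \<in> \<D>"
  shows "set c \<subseteq> Q"
proof
  fix a assume "a \<in> set c"
  then obtain k where "k < length c" "a = c ! k" by (auto simp: in_set_conv_nth)
  then show "a \<in> Q" using assms unfolding cycle_family_def cycle_in_def state_edge_def by blast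
qed

lemma block_realization_exists:
  assumes G: "realizes (star_edge A B) U F S G" and Q: "Q \<subseteq> {..<n}" and \<D>: "cycle_family Q \<D>"
  shows "\<exists>\<theta>. block_realization R G \<D> \<theta>"
proof -
  have G': "G a b = G b a" "G a b \<noteq> 0 \<Longrightarrow> star_edge A B a b" for a b
    using G unfolding realizes_def by blast+
  define a where "a i j = G (State i) (State j) + (\<Sum>c\<in>\<D>. cycle_matrix c (sign_weight (length c)) i j)" for i j
  have cs: "A $$ (i, j) = Star" if c: "c \<in> \<D>" "cycle_matrix c w i j \<noteq> 0" for c w i j
  proof -
    have cyc: "cycle_in (state_edge A Q) c" using \<D> c(1) by (simp add: cycle_family_def)
    obtain k where k: "k < length c" "(i = c ! k \<and> j = c ! (Suc k mod length c)) \<or>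
        (j = c ! k \<and> i = c ! (Suc k mod length c))"
      using cycle_matrix_nonzero[OF c(2)] by blast
    then have "state_edge A Q i j \<or> state_edge A Q j i" using cyc unfolding cycle_in_def by blast
    then show ?thesis using pattern_sym[OF A B, of i j] subsetD[OF Q, of i] subsetD[OF Q, of j]
      unfolding state_edge_def by auto
  qed
  have "a i j = a j i" for i j unfolding a_def by (simp add: G'(1)[of "State i"] cycle_matrix_sym[of _ _ i])
  moreover have "A $$ (i, j) = Star" if "i < n" "j < n" "a i j \<noteq> 0" for i j
  proof (cases "G (State i) (State j) = 0")
    case True
    then have "(\<Sum>c\<in>\<D>. cycle_matrix c (sign_weight (length c)) i j) \<noteq> 0" using that by (simp add: a_def)
    then obtain c where "c \<in> \<D>" "cycle_matrix c (sign_weight (length c)) i j \<noteq> 0"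
      by (rule sum.not_neutral_contains_not_neutral)
    then show ?thesis by (rule cs)
  next
    case False
    then show ?thesis using G'(2) by (force simp: star_edge_def)
  qed
  moreover have "B $$ (i, l) = Star" if "G (State i) (Input l) \<noteq> 0" for i l
    using G'(2)[OF that] by (simp add: star_edge_def)
  ultimately obtain \<theta> where "\<theta> \<in> coord_space (pair_params A B)"
    "\<forall>i<n. \<forall>j<n. realize_A A \<theta> $$ (i, j) = a i j" "\<forall>i<n. \<forall>l<m. realize_B B \<theta> $$ (i, l) = G (State i) (Input l)"
    using realization_exists[OF A B, of a "\<lambda>i l. G (State i) (Input l)"] by blast
  then show ?thesis unfolding block_realization_def a_def by blast
qed

context
  fixes R F :: "nat set" and G :: "vertex \<Rightarrow> vertex \<Rightarrow> real" and \<D> :: "nat list set" and \<theta> :: "param \<Rightarrow> real"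
  assumes sep: "separated n m A B R" and F: "F \<subseteq> R"
    and G: "realizes (star_edge A B) (Input ` {..<m}) (State ` F) (Input ` {..<m} \<union> State ` R) G"
    and fam: "cycle_family ({..<n} - R) \<D>" and \<theta>: "block_realization R G \<D> \<theta>"
begin

abbreviation (input) GA :: "nat \<Rightarrow> nat \<Rightarrow> real" where "GA \<equiv> \<lambda>i j. realize_A A \<theta> $$ (i, j)"

lemma R_sub: "R \<subseteq> {..<n}" using sep by (simp add: separated_def)

lemma G_outside: "a \<notin> State ` R \<Longrightarrow> a \<notin> Input ` {..<m} \<Longrightarrow> G a b = 0" "G a b = G b a"
  using G unfolding realizes_def by blast+

lemma cycle_outside:
  assumes "c \<in> \<D>" "i \<in> R"
  shows "cycle_matrix c w i j = 0" "cycle_matrix c w j i = 0"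
proof -
  have sub: "set c \<subseteq> {..<n} - R" by (rule cycle_family_subset[OF fam assms(1)])
  have "cycle_matrix c w i j = 0" for j
  proof (rule ccontr)
    assume "cycle_matrix c w i j \<noteq> 0"
    from cycle_matrix_nonzero[OF this]
    obtain k where k: "k < length c" "i = c ! k \<or> i = c ! (Suc k mod length c)" by blast
    moreover have "Suc k mod length c < length c" using k(1) by (intro mod_less_divisor) linarith
    ultimately have "i \<in> set c" by auto
    then show False using sub assms(2) by blast
  qed
  then show "cycle_matrix c w i j = 0" "cycle_matrix c w j i = 0" using cycle_matrix_sym[of c w j i] by simp_all
qed

lemma GA_R: "i \<in> R \<Longrightarrow> j < n \<Longrightarrow> GA i j = G (State i) (State j)"
  using \<theta> R_sub cycle_outside(1) by (auto simp: block_realization_def subset_iff)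

lemma GB: "i < n \<Longrightarrow> l < m \<Longrightarrow> realize_B B \<theta> $$ (i, l) = G (State i) (Input l)"
  using \<theta> by (simp add: block_realization_def)

text \<open>\<open>z\<close> is extended by zero to the input vertices. The value that an iterate
  produces at an input is the inner product of that column of \<open>B\<close> with an iterate of
  \<open>z\<close>, hence zero: inputs never feed back, the extension is unobservable, and
  observability modulo \<open>F\<close> applies.\<close>

lemma krylov_orthogonal_zero_on_R:
  assumes kry: "\<And>k l. l < m \<Longrightarrow> (\<Sum>i<n. realize_B B \<theta> $$ (i, l) * (mulv {..<n} GA ^^ k) z i) = 0"
    and zF: "\<And>i. i \<in> F \<Longrightarrow> z i = 0" and i: "i \<in> R"
  shows "z i = 0"
proof -
  let ?V = "Input ` {..<m} \<union> State ` R"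
  define Z where "Z a = (case a of State i \<Rightarrow> z i | Input l \<Rightarrow> 0)" for a
  have finR: "finite R" using R_sub finite_subset by blast
  have split: "mulv ?V G y a = (\<Sum>l<m. G a (Input l) * y (Input l)) + (\<Sum>j\<in>R. G a (State j) * y (State j))" for y a
  proof -
    have "mulv ?V G y a = (\<Sum>b\<in>Input ` {..<m}. G a b * y b) + (\<Sum>b\<in>State ` R. G a b * y b)"
      unfolding mulv_def using finR by (intro sum.union_disjoint) auto
    then show ?thesis by (simp add: sum.reindex inj_on_def)
  qed
  have restrict: "(\<Sum>j<n. G a (State j) * f j) = (\<Sum>j\<in>R. G a (State j) * f j)" for a f
  proof (rule sum.mono_neutral_right)
    show "\<forall>j\<in>{..<n} - R. G a (State j) * f j = 0"
    proof
      fix j assume "j \<in> {..<n} - R"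
      then have "G (State j) a = 0" by (intro G_outside(1)) auto
      then show "G a (State j) * f j = 0" using G_outside(2)[of a] by simp
    qed
  qed (use R_sub in auto)
  have pow: "(\<forall>i\<in>R. (mulv ?V G ^^ k) Z (State i) = (mulv {..<n} GA ^^ k) z i) \<and>
      (\<forall>l<m. (mulv ?V G ^^ k) Z (Input l) = 0)" for k
  proof (induction k)
    case (Suc k)
    define y where "y = (mulv ?V G ^^ k) Z"
    have y: "y (State i) = (mulv {..<n} GA ^^ k) z i" if "i \<in> R" for i using Suc that by (simp add: y_def)
    have y0: "y (Input l) = 0" if "l < m" for l using Suc that by (simp add: y_def)
    have row: "mulv ?V G y a = (\<Sum>j<n. G a (State j) * (mulv {..<n} GA ^^ k) z j)" for a
      unfolding split restrict using y y0 by simp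
    have "mulv ?V G y (State i) = mulv {..<n} GA ((mulv {..<n} GA ^^ k) z) i" if "i \<in> R" for i
      unfolding row mulv_def[of _ _ "(mulv {..<n} GA ^^ k) z"] using that by (intro sum.cong refl) (simp add: GA_R)
    moreover have "mulv ?V G y (Input l) = 0" if "l < m" for l
    proof -
      have "mulv ?V G y (Input l) = (\<Sum>j<n. realize_B B \<theta> $$ (j, l) * (mulv {..<n} GA ^^ k) z j)"
        unfolding row using that by (intro sum.cong refl) (simp add: GB G_outside(2)[of "Input l"])
      then show ?thesis using kry[OF that, of k] by simp
    qed
    ultimately show ?case by (simp add: y_def)
  qed (simp add: Z_def)
  have "unobservable ?V (Input ` {..<m}) G Z" unfolding unobservable_def using pow by auto
  moreover have "\<forall>a\<in>?V \<inter> State ` F. Z a = 0" using zF by (auto simp: Z_def)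
  ultimately have "Z (State i) = 0"
    using G i unfolding realizes_def observable_modulo_def by blast
  then show ?thesis by (simp add: Z_def)
qed

text \<open>The common orthogonal complement of these and of \<open>krylov_vectors\<close> is
  invariant under \<open>A\<close>; it is the subspace to which \<open>rayleigh_nonneg\<close> is
  applied.\<close>

definition negative_vectors :: "(nat \<Rightarrow> real) set" where
  "negative_vectors = {v. \<exists>\<mu><0. \<forall>a\<in>{..<n}. mulv {..<n} GA v a = \<mu> * v a}"

definition krylov_vectors :: "(nat \<Rightarrow> real) set" where
  "krylov_vectors = {(mulv {..<n} GA ^^ k) (\<lambda>i. realize_B B \<theta> $$ (i, l)) |k l. l < m}"

text \<open>An eigenvector with negative eigenvalue that lies in the complement is orthogonal to
  itself, so \<open>A\<close> has no such eigenvector there.\<close>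

lemma form_nonneg:
  assumes z: "\<forall>h\<in>negative_vectors \<union> krylov_vectors. (\<Sum>i\<in>{..<n}. h i * z i) = 0"
  shows "0 \<le> (\<Sum>i<n. z i * mulv {..<n} GA z i)"
proof -
  define K where "K = {z. \<forall>h\<in>negative_vectors \<union> krylov_vectors. (\<Sum>i\<in>{..<n}. h i * z i) = 0}"
  have sym: "GA a b = GA b a" if "a \<in> {..<n}" "b \<in> {..<n}" for a b
    using realize_A_sym[OF A B, of a b \<theta>] that by simp
  have adj: "(\<Sum>i<n. h i * mulv {..<n} GA y i) = (\<Sum>i<n. mulv {..<n} GA h i * y i)" for h y
    using mulv_adjoint[of "{..<n}" GA h 1 y] sym by simp
  show ?thesis
  proof (rule rayleigh_nonneg[where K = K and h = "\<lambda>h. h" and H = "negative_vectors \<union> krylov_vectors"])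
    show "mulv {..<n} GA y \<in> K" if y: "y \<in> K" for y
      unfolding K_def
    proof (rule CollectI, rule ballI)
      fix h assume h: "h \<in> negative_vectors \<union> krylov_vectors"
      have "(\<Sum>i<n. mulv {..<n} GA h i * y i) = 0"
      proof (cases "h \<in> krylov_vectors")
        case True
        then obtain k l where "l < m" "h = (mulv {..<n} GA ^^ k) (\<lambda>i. realize_B B \<theta> $$ (i, l))"
          unfolding krylov_vectors_def by blast
        then have "mulv {..<n} GA h = (mulv {..<n} GA ^^ Suc k) (\<lambda>i. realize_B B \<theta> $$ (i, l))" "l < m" by simp_all
        then have "mulv {..<n} GA h \<in> krylov_vectors" unfolding krylov_vectors_def by blast
        then show ?thesis using y unfolding K_def by blast
      next
        case False
        then have hn: "h \<in> negative_vectors" using h by blast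
        then obtain \<mu> where "\<forall>a\<in>{..<n}. mulv {..<n} GA h a = \<mu> * h a" unfolding negative_vectors_def by blast
        then have "(\<Sum>i<n. mulv {..<n} GA h i * y i) = \<mu> * (\<Sum>i<n. h i * y i)"
          by (simp add: sum_distrib_left mult_ac)
        also have "(\<Sum>i<n. h i * y i) = 0" using y hn unfolding K_def by blast
        finally show ?thesis by simp
      qed
      then show "(\<Sum>i\<in>{..<n}. h i * mulv {..<n} GA y i) = 0" by (simp add: adj)
    qed
    show "\<forall>a\<in>{..<n}. v a = 0" if "\<mu> < 0" "v \<in> K" "\<forall>a\<in>{..<n}. mulv {..<n} GA v a = \<mu> * v a" for \<mu> v
    proof -
      have "v \<in> negative_vectors" using that unfolding negative_vectors_def by blast
      then have "(\<Sum>i<n. v i * v i) = 0" using that(2) unfolding K_def by blast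
      then show ?thesis by (simp add: sum_nonneg_eq_0_iff)
    qed
  qed (use sym z in \<open>auto simp: K_def\<close>)
qed

lemma orthogonal_stabilizable:
  assumes z: "\<And>w. w \<in> stabilizable_subspace (realize_A A \<theta>) (realize_B B \<theta>) \<Longrightarrow> (\<Sum>i<n. w $ i * z i) = 0"
  shows "l < m \<Longrightarrow> (\<Sum>i<n. realize_B B \<theta> $$ (i, l) * (mulv {..<n} GA ^^ k) z i) = 0"
    and "\<forall>h\<in>negative_vectors \<union> krylov_vectors. (\<Sum>i\<in>{..<n}. h i * z i) = 0"
proof -
  note AB = realize_A_carrier[OF A B, of \<theta>] realize_B_carrier[OF A B, of \<theta>]
  note sym = realize_A_sym[OF A B, of _ _ \<theta>]
  show kry: "(\<Sum>i<n. realize_B B \<theta> $$ (i, l) * (mulv {..<n} GA ^^ k) z i) = 0" if "l < m" for k l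
    by (rule orthogonal_stabilizable_krylov[OF AB sym z that])
  show "\<forall>h\<in>negative_vectors \<union> krylov_vectors. (\<Sum>i\<in>{..<n}. h i * z i) = 0"
  proof
    fix h assume h: "h \<in> negative_vectors \<union> krylov_vectors"
    show "(\<Sum>i\<in>{..<n}. h i * z i) = 0"
    proof (cases "h \<in> krylov_vectors")
      case True
      then obtain k l where l: "l < m" "h = (mulv {..<n} GA ^^ k) (\<lambda>i. realize_B B \<theta> $$ (i, l))"
        unfolding krylov_vectors_def by blast
      have "(\<Sum>i\<in>{..<n}. h i * z i) = (\<Sum>i<n. realize_B B \<theta> $$ (i, l) * (mulv {..<n} GA ^^ k) z i)"
        unfolding l(2) using sym by (intro mulv_adjoint[symmetric]) auto
      then show ?thesis using kry[OF l(1)] by simp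
    next
      case False
      then obtain \<mu> where mu: "\<mu> < 0" "\<forall>a\<in>{..<n}. mulv {..<n} GA h a = \<mu> * h a"
        using h unfolding negative_vectors_def by blast
      have "vec n h \<in> stabilizable_subspace (realize_A A \<theta>) (realize_B B \<theta>)"
        by (rule stabilizable_exponential[OF AB mu(1), where w = "\<lambda>_. 0"]) (use mu(2) in \<open>simp add: mulv_def\<close>)
      from z[OF this] show ?thesis by simp
    qed
  qed
qed

lemma form_on_unreachable:
  assumes zR: "\<And>i. i \<in> R \<Longrightarrow> z i = 0"
  shows "(\<Sum>i<n. z i * mulv {..<n} GA z i) =
    (\<Sum>c\<in>\<D>. 2 * (\<Sum>k<length c. sign_weight (length c) k * z (c ! k) * z (c ! (Suc k mod length c))))"
proof -
  have fin: "finite \<D>" using fam by (simp add: cycle_family_def)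
  have "z i * mulv {..<n} GA z i = (\<Sum>c\<in>\<D>. z i * mulv {..<n} (cycle_matrix c (sign_weight (length c))) z i)"
    if i: "i < n" for i
  proof (cases "i \<in> R")
    case False
    have "G (State i) b = 0" for b using False by (intro G_outside(1)) auto
    then have "mulv {..<n} GA z i = (\<Sum>j<n. \<Sum>c\<in>\<D>. cycle_matrix c (sign_weight (length c)) i j * z j)"
      unfolding mulv_def using \<theta> i
      by (intro sum.cong refl) (simp add: block_realization_def sum_distrib_right)
    also have "\<dots> = (\<Sum>c\<in>\<D>. mulv {..<n} (cycle_matrix c (sign_weight (length c))) z i)"
      unfolding mulv_def by (rule sum.swap)
    finally show ?thesis by (simp add: sum_distrib_left)
  qed (simp add: zR)
  then have "(\<Sum>i<n. z i * mulv {..<n} GA z i) =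
      (\<Sum>i<n. \<Sum>c\<in>\<D>. z i * mulv {..<n} (cycle_matrix c (sign_weight (length c))) z i)" by simp
  also have "\<dots> = (\<Sum>c\<in>\<D>. \<Sum>i<n. z i * mulv {..<n} (cycle_matrix c (sign_weight (length c))) z i)"
    by (rule sum.swap)
  also have "\<dots> = (\<Sum>c\<in>\<D>. 2 * (\<Sum>k<length c. sign_weight (length c) k * z (c ! k) * z (c ! (Suc k mod length c))))"
    using cycle_family_subset[OF fam] by (intro sum.cong refl cycle_matrix_form) auto
  finally show ?thesis .
qed

text \<open>A vector that is orthogonal to the stabilizable subspace and zero on \<open>F\<close> is
  zero on \<open>R\<close>. The form is nonnegative at it, while under the cycle equations every
  cycle contributes a nonpositive amount; so all contributions are zero, and definiteness makes the
  vector vanish.\<close>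

lemma stabilizable_dim_ge:
  "card R - card F + (\<Sum>c\<in>\<D>. (length c + 1) div 2) \<le>
    subspace_dim n (stabilizable_subspace (realize_A A \<theta>) (realize_B B \<theta>))"
proof -
  let ?W = "stabilizable_subspace (realize_A A \<theta>) (realize_B B \<theta>)"
  define Y where "Y = \<Union>(set ` \<D>)"
  define P where "P = (SIGMA c:\<D>. {..<length c div 2})"
  \<comment> \<open>One equation for each state of \<open>F\<close>, one for each state outside
    \<open>R\<close> on no cycle, and \<open>length c div 2\<close> for each cycle; \<open>n\<close>
    minus their number is the bound.\<close>
  define E where "E = (F \<union> ({..<n} - R - Y)) <+> P"
  define h where "h e i = (case e of Inl a \<Rightarrow> if i = a then 1 else 0
    | Inr (c, j) \<Rightarrow> cycle_equation (length c) j (\<lambda>k. if c ! k = i then 1 else 0))" for e :: "nat + nat list \<times> nat" and i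
  have finD: "finite \<D>" using fam by (simp add: cycle_family_def)
  have finR: "finite R" using R_sub finite_subset by blast
  have finF: "finite F" using F finR finite_subset by blast
  have cQ: "set c \<subseteq> {..<n} - R" if "c \<in> \<D>" for c by (rule cycle_family_subset[OF fam that])
  have cne: "0 < length c" "distinct c" if "c \<in> \<D>" for c
    using fam that unfolding cycle_family_def cycle_in_def by auto
  have finE: "finite E" by (simp add: E_def P_def finD finF)
  have hl: "(\<Sum>i<n. h (Inl a) i * z i) = z a" if "a < n" for a z
  proof -
    have "(\<Sum>i<n. h (Inl a) i * z i) = (\<Sum>i<n. if i = a then z i else 0)"
      by (intro sum.cong) (auto simp: h_def)
    then show ?thesis using that by simp
  qed
  have hr: "(\<Sum>i<n. h (Inr (c, j)) i * z i) = cycle_equation (length c) j (\<lambda>k. z (c ! k))"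
    if c: "c \<in> \<D>" and j: "j < length c div 2" for c j z
  proof -
    have nth: "c ! k < n" if "k < length c" for k using cQ[OF c] nth_mem[OF that] by auto
    have one: "(\<Sum>i<n. (if c ! k = i then 1 else 0) * z i) = z (c ! k)" if "k < length c" for k
    proof -
      have "(\<Sum>i<n. (if c ! k = i then 1 else 0) * z i) = (\<Sum>i<n. if i = c ! k then z i else 0)"
        by (intro sum.cong) auto
      then show ?thesis using nth[OF that] by simp
    qed
    show ?thesis
    proof (cases "even (length c)")
      case True
      then have "2 * j < length c" "Suc (2 * j) < length c" using j by auto
      then show ?thesis using True
        by (simp add: h_def cycle_equation_def distrib_right sum.distrib one)
    next
      case False
      then obtain l where "length c = 2 * l + 1" by (elim oddE)
      then have "Suc (2 * j) < length c" "2 * Suc j < length c" "0 < length c" using j by simp_all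
      then show ?thesis using False
        by (simp add: h_def cycle_equation_def distrib_right left_diff_distrib sum.distrib sum_subtractf
            one mult.assoc sum_distrib_left[symmetric] del: mult_Suc_right)
    qed
  qed
  have "n \<le> subspace_dim n ?W + card E"
  proof (rule subspace_dim_ge[OF _ finE, where h = h])
    show "subspace_of n ?W" by (rule stabilizable_subspace_of[OF realize_A_carrier[OF A B] realize_B_carrier[OF A B]])
    fix z assume zW: "\<And>w. w \<in> ?W \<Longrightarrow> (\<Sum>i<n. w $ i * z i) = 0"
      and zE: "\<And>e. e \<in> E \<Longrightarrow> (\<Sum>i<n. h e i * z i) = 0"
    have zl: "z a = 0" if "a \<in> F \<union> ({..<n} - R - Y)" for a
    proof -
      have "a < n" using that F R_sub by auto
      then show ?thesis using zE[of "Inl a"] hl[of a z] that by (auto simp: E_def)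
    qed
    have zR: "z i = 0" if "i \<in> R" for i
      by (rule krylov_orthogonal_zero_on_R[OF orthogonal_stabilizable(1)[OF zW] zl that]) auto
    define q where "q c = (\<Sum>k<length c. sign_weight (length c) k * z (c ! k) * z (c ! (Suc k mod length c)))" for c
    have eqs: "cycle_equation (length c) j (\<lambda>k. z (c ! k)) = 0" if "c \<in> \<D>" "j < length c div 2" for c j
      using zE[of "Inr (c, j)"] hr[OF that, of z] that by (auto simp: E_def P_def)
    have qle: "q c \<le> 0" if "c \<in> \<D>" for c
      unfolding q_def by (rule cycle_form_negative_definite(1)[OF cne(1)[OF that] eqs[OF that]])
    have "0 \<le> (\<Sum>c\<in>\<D>. 2 * q c)"
      using form_nonneg[OF orthogonal_stabilizable(2)[OF zW]] form_on_unreachable[OF zR] by (simp add: q_def)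
    then have "(\<Sum>c\<in>\<D>. - q c) \<le> 0" by (simp add: sum_distrib_left[symmetric] sum_negf)
    then have "(\<Sum>c\<in>\<D>. - q c) = 0" using qle by (intro antisym sum_nonneg) auto
    then have q0: "q c = 0" if "c \<in> \<D>" for c using that qle finD by (simp add: sum_nonneg_eq_0_iff)
    have zY: "z a = 0" if a: "a \<in> Y" for a
    proof -
      obtain c k where c: "c \<in> \<D>" "k < length c" "a = c ! k" using a by (auto simp: Y_def in_set_conv_nth)
      show ?thesis
        unfolding c(3)
      proof (rule cycle_form_negative_definite(2)[where f = "\<lambda>k. z (c ! k)" and L = "length c" and k = k])
        show "0 \<le> (\<Sum>k<length c. sign_weight (length c) k * z (c ! k) * z (c ! (Suc k mod length c)))"
          using q0[OF c(1)] by (simp add: q_def)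
      qed (use cne(1)[OF c(1)] eqs[OF c(1)] c(2) in auto)
    qed
    show "\<forall>i<n. z i = 0"
      using zl zR zY by (metis DiffI UnCI lessThan_iff)
  qed
  moreover have "card E = card F + (n - card R - (\<Sum>c\<in>\<D>. length c)) + (\<Sum>c\<in>\<D>. length c div 2)"
    and "(\<Sum>c\<in>\<D>. length c) \<le> n - card R"
  proof -
    have cardY: "card Y = (\<Sum>c\<in>\<D>. length c)"
    proof -
      have "card Y = (\<Sum>c\<in>\<D>. card (set c))"
        unfolding Y_def using fam finD by (intro card_UN_disjoint) (auto simp: cycle_family_def)
      then show ?thesis using cne(2) by (simp add: distinct_card)
    qed
    have YQ: "Y \<subseteq> {..<n} - R" using cQ by (auto simp: Y_def)
    have cQ': "card ({..<n} - R) = n - card R" using R_sub finR by (simp add: card_Diff_subset)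
    show "(\<Sum>c\<in>\<D>. length c) \<le> n - card R" using card_mono[OF _ YQ] cardY cQ' by simp
    have "card ({..<n} - R - Y) = n - card R - card Y"
      using YQ cQ' by (simp add: card_Diff_subset finite_subset[OF YQ])
    moreover have "card (F \<union> ({..<n} - R - Y)) = card F + card ({..<n} - R - Y)"
      using F finF by (intro card_Un_disjoint) auto
    moreover have "card P = (\<Sum>c\<in>\<D>. length c div 2)" using finD by (simp add: P_def)
    ultimately show "card E = card F + (n - card R - (\<Sum>c\<in>\<D>. length c)) + (\<Sum>c\<in>\<D>. length c div 2)"
      using finF finD by (simp add: E_def card_Plus P_def cardY)
  qed
  moreover have "(\<Sum>c\<in>\<D>. length c) = (\<Sum>c\<in>\<D>. length c div 2) + (\<Sum>c\<in>\<D>. (length c + 1) div 2)"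
    unfolding sum.distrib[symmetric] by (intro sum.cong) auto
  moreover have "card F \<le> card R" using F finR by (rule card_mono[rotated])
  moreover have "card R \<le> n" using card_mono[OF _ R_sub] by simp
  ultimately show ?thesis by linarith
qed

end

end

section \<open>The maximal stabilizable and the generic controllable dimension\<close>

text \<open>\<open>Max\<close> is meaningful only for a finite set of dimensions, so the uniform
  bound \<open>k\<close> supports both conclusions.\<close>

lemma m_dim_le:
  assumes A: "sym_structured n A" and B: "B \<in> carrier_mat n m"
    and le: "\<And>\<theta>. \<theta> \<in> coord_space (pair_params A B) \<Longrightarrow>
      subspace_dim n (stabilizable_subspace (realize_A A \<theta>) (realize_B B \<theta>)) \<le> k"
  shows "m_dim A B \<le> k"
    and "\<theta> \<in> coord_space (pair_params A B) \<Longrightarrow>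
      subspace_dim n (stabilizable_subspace (realize_A A \<theta>) (realize_B B \<theta>)) \<le> m_dim A B"
proof -
  let ?S = "{subspace_dim (dim_row A) (stabilizable_subspace (realize_A A \<theta>) (realize_B B \<theta>)) | \<theta>.
    \<theta> \<in> coord_space (pair_params A B)}"
  note dims = pattern_dims[OF A B]
  have sub: "?S \<subseteq> {..k}" using le by (auto simp: dims)
  then have fin: "finite ?S" using finite_subset by blast
  have "(\<lambda>p\<in>pair_params A B. 0) \<in> coord_space (pair_params A B)" by (simp add: coord_space_def)
  then have "?S \<noteq> {}" by blast
  then show "m_dim A B \<le> k" unfolding m_dim_def using sub fin by (intro Max.boundedI) auto
  show "subspace_dim n (stabilizable_subspace (realize_A A \<theta>) (realize_B B \<theta>)) \<le> m_dim A B"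
    if "\<theta> \<in> coord_space (pair_params A B)"
    unfolding m_dim_def using that fin dims(1) by (intro Max_ge) auto
qed

lemma m_dim_ge:
  assumes A: "sym_structured n A" and B: "B \<in> carrier_mat n m" and t: "\<theta> \<in> coord_space (pair_params A B)"
  shows "subspace_dim n (stabilizable_subspace (realize_A A \<theta>) (realize_B B \<theta>)) \<le> m_dim A B"
  by (rule m_dim_le(2)[OF A B _ t, where k = n], rule subspace_dim_le,
      rule stabilizable_subspace_of[OF realize_A_carrier[OF A B] realize_B_carrier[OF A B]])

lemma optimal_realization_exists:
  assumes A: "sym_structured n A" and B: "B \<in> carrier_mat n m"
    and sep: "separated n m A B R" and reach: "reaches m A B R" and mat: "row_matching A B R k"
    and fam: "cycle_family A ({..<n} - R) \<D>"
  shows "\<exists>F G \<theta>. F \<subseteq> R \<and> k \<le> card R - card F \<and>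
    realizes (star_edge A B) (Input ` {..<m}) (State ` F) (Input ` {..<m} \<union> State ` R) G \<and>
    block_realization n m A B R G \<D> \<theta>"
proof -
  have Rn: "R \<subseteq> {..<n}" using sep by (simp add: separated_def)
  then have finR: "finite R" using finite_subset by blast
  obtain I \<sigma> where I: "I \<subseteq> R" "card I = k" "inj_on \<sigma> I" "\<And>i. i \<in> I \<Longrightarrow> star_edge A B (State i) (\<sigma> i)"
    using mat unfolding row_matching_def by blast
  define \<tau> where "\<tau> v = (case v of State i \<Rightarrow> \<sigma> i | Input l \<Rightarrow> v)" for v
  \<comment> \<open>Separation keeps the partner of a row of \<open>R\<close> within
    \<open>R\<close> or among the inputs.\<close>
  have range: "\<sigma> i \<in> State ` R \<union> Input ` {..<m}" if i: "i \<in> I" for i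
  proof (cases "\<sigma> i")
    case (State j)
    then have "j < n" "A $$ (i, j) = Star" using I(4)[OF i] pattern_dims[OF A B] by (auto simp: star_edge_def)
    then have "j \<in> R" using sep i I(1) by (auto simp: separated_def)
    then show ?thesis using State by simp
  next
    case (Input l)
    then show ?thesis using I(4)[OF i] pattern_dims[OF A B] by (auto simp: star_edge_def)
  qed
  have "\<exists>F' G. F' \<subseteq> State ` R \<and> card (State ` I) \<le> card (State ` R - F') \<and>
      realizes (star_edge A B) (Input ` {..<m}) F' (Input ` {..<m} \<union> State ` R) G"
  proof (rule structured_observability[where \<sigma> = \<tau>])
    show "\<exists>x\<in>S. \<exists>y\<in>State ` R - S. star_edge A B x y"
      if "Input ` {..<m} \<subseteq> S" "S \<subset> Input ` {..<m} \<union> State ` R" for S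
      using reach that unfolding reaches_def by blast
    show "inj_on \<tau> (State ` I)" using I(3) by (auto simp: \<tau>_def inj_on_def)
    have "\<tau> ` State ` I = \<sigma> ` I" by (simp add: \<tau>_def image_image)
    moreover have "\<sigma> ` I \<subseteq> State ` R \<union> Input ` {..<m}" by (rule image_subsetI) (rule range)
    ultimately show "\<tau> ` State ` I \<subseteq> State ` R \<union> Input ` {..<m}" by (simp only:)
    show "\<forall>i\<in>State ` I. star_edge A B i (\<tau> i)" using I(4) by (auto simp: \<tau>_def)
  qed (use star_edge_symp[OF A B] finR I(1) in auto)
  then obtain F' G where F': "F' \<subseteq> State ` R" "card (State ` I) \<le> card (State ` R - F')"
    "realizes (star_edge A B) (Input ` {..<m}) F' (Input ` {..<m} \<union> State ` R) G" by blast
  define F where "F = {i \<in> R. State i \<in> F'}"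
  have F: "F \<subseteq> R" "State ` F = F'" using F'(1) by (auto simp: F_def)
  have injS: "inj_on State X" for X by (simp add: inj_on_def)
  have "card (State ` R - F') = card (State ` (R - F))"
    using F(2) injS[of R] F(1) by (metis inj_on_image_set_diff order_refl Diff_subset)
  then have "card (State ` R - F') = card R - card F"
    using finR F(1) finite_subset[OF F(1) finR] by (simp add: card_image[OF injS] card_Diff_subset)
  moreover have "card (State ` I) = k" using I(2) by (simp add: card_image[OF injS])
  ultimately have "k \<le> card R - card F" using F'(2) by simp
  moreover obtain \<theta> where "block_realization n m A B R G \<D> \<theta>"
    using block_realization_exists[OF A B F'(3) _ fam] by blast
  ultimately show ?thesis using F F'(3) by blast
qed

lemma m_dim_lower:
  assumes A: "sym_structured n A" and B: "B \<in> carrier_mat n m"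
    and sep: "separated n m A B R" and reach: "reaches m A B R" and mat: "row_matching A B R k"
    and fam: "cycle_family A ({..<n} - R) \<D>"
  shows "k + (\<Sum>c\<in>\<D>. (length c + 1) div 2) \<le> m_dim A B"
proof -
  obtain F G \<theta> where o: "F \<subseteq> R" "k \<le> card R - card F"
    "realizes (star_edge A B) (Input ` {..<m}) (State ` F) (Input ` {..<m} \<union> State ` R) G"
    "block_realization n m A B R G \<D> \<theta>"
    using optimal_realization_exists[OF assms] by blast
  have "\<theta> \<in> coord_space (pair_params A B)" using o(4) unfolding block_realization_def[OF A B] by blast
  from m_dim_ge[OF A B this] stabilizable_dim_ge[OF A B sep o(1,3) fam o(4)] o(2) show ?thesis by linarith
qed

lemma m_dim_upper:
  assumes A: "sym_structured n A" and B: "B \<in> carrier_mat n m" and sep: "separated n m A B R"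
    and S: "S \<subseteq> {..<n} - R" "\<And>i j. i \<in> S \<Longrightarrow> j \<in> S \<Longrightarrow> A $$ (i, j) \<noteq> Star"
    and max: "\<And>k. row_matching A B R k \<Longrightarrow> k \<le> r"
  shows "m_dim A B + card S + card R \<le> r + n"
proof -
  have "m_dim A B \<le> r + n - (card S + card R)"
  proof (rule m_dim_le(1)[OF A B])
    fix \<theta>
    obtain k where "row_matching A B R k"
      "subspace_dim n (stabilizable_subspace (realize_A A \<theta>) (realize_B B \<theta>)) + card S + card R \<le> k + n"
      using stabilizable_dim_upper[OF A B sep S] by blast
    then show "subspace_dim n (stabilizable_subspace (realize_A A \<theta>) (realize_B B \<theta>)) \<le> r + n - (card S + card R)"
      using max[of k] by linarith
  qed
  moreover have "card S + card R \<le> n"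
  proof -
    have R: "R \<subseteq> {..<n}" using sep by (simp add: separated_def)
    have "card S + card R = card (S \<union> R)"
      using S(1) R by (intro card_Un_disjoint[symmetric]) (auto intro: finite_subset)
    also have "\<dots> \<le> card {..<n}" using S(1) R by (intro card_mono) auto
    finally show ?thesis by simp
  qed
  ultimately show ?thesis by linarith
qed

text \<open>No realization exceeds rank \<open>r\<close>. Conversely, one realization
  \<open>\<alpha>\<close> observable modulo \<open>F\<close> has a nonzero minor of its Krylov
  matrix; this minor is a polynomial in the parameters, and wherever it is nonzero the rank is at
  least \<open>r\<close>.\<close>

lemma generic_controllable_dim_eq:
  assumes A: "sym_structured n A" and B: "B \<in> carrier_mat n m"
    and reach: "reaches m A B {..<n}" and mat: "row_matching A B {..<n} r"
    and max: "\<And>k. row_matching A B {..<n} k \<Longrightarrow> k \<le> r"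
  shows "generic_controllable_dim A B = r"
proof -
  have sep: "separated n m A B {..<n}" by (simp add: separated_def)
  have fam: "cycle_family A ({..<n} - {..<n}) {}" by (simp add: cycle_family_def[OF A B])
  obtain F G \<alpha> where o: "F \<subseteq> {..<n}" "r \<le> card {..<n} - card F"
    "realizes (star_edge A B) (Input ` {..<m}) (State ` F) (Input ` {..<m} \<union> State ` {..<n}) G"
    "block_realization n m A B {..<n} G {} \<alpha>"
    using optimal_realization_exists[OF A B sep reach mat fam] by blast
  have \<alpha>: "\<alpha> \<in> coord_space (pair_params A B)" using o(4) unfolding block_realization_def[OF A B] by blast
  define M where "M \<theta> x i = (mulv {..<n} (\<lambda>i j. realize_A A \<theta> $$ (i, j)) ^^ fst x) (\<lambda>i. realize_B B \<theta> $$ (i, snd x)) i"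
    for \<theta> and x :: "nat \<times> nat" and i
  define J where "J = {..<n} \<times> {..<m}"
  \<comment> \<open>Observability modulo \<open>F\<close> makes the Krylov matrix at
    \<open>\<alpha>\<close> injective on vectors supported in \<open>P\<close>.\<close>
  define P where "P = {..<n} - F"
  define s where "s = card P"
  have finF: "finite F" using o(1) finite_subset by blast
  have sF: "s = n - card F" using o(1) finF by (simp add: s_def P_def card_Diff_subset)
  have adj: "(\<Sum>i<n. M \<theta> (k, l) i * z i) =
      (\<Sum>i<n. realize_B B \<theta> $$ (i, l) * (mulv {..<n} (\<lambda>i j. realize_A A \<theta> $$ (i, j)) ^^ k) z i)" for \<theta> k l z
    unfolding M_def fst_conv snd_conv
    by (rule mulv_adjoint[symmetric]) (simp add: realize_A_sym[OF A B])
  have restr: "(\<Sum>i<n. f i * (if i \<in> P then c i else 0)) = (\<Sum>i\<in>P. f i * c i)" for f c :: "nat \<Rightarrow> real"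
    by (rule sum.mono_neutral_cong_right) (auto simp: P_def)
  have "inj_matrix J P (M \<alpha>)"
  proof (rule inj_matrixI)
    fix c i assume c: "\<And>x. x \<in> J \<Longrightarrow> (\<Sum>i\<in>P. M \<alpha> x i * c i) = 0" and i: "i \<in> P"
    define z where "z i = (if i \<in> P then c i else 0)" for i
    have K: "(\<Sum>i<n. realize_B B \<alpha> $$ (i, l) * (mulv {..<n} (\<lambda>i j. realize_A A \<alpha> $$ (i, j)) ^^ k) z i) = 0"
      if "l < m" for k l
    proof (rule krylov_truncate)
      fix k assume "k < card {..<n}"
      then have "(k, l) \<in> J" using that by (simp add: J_def)
      from c[OF this] show "(\<Sum>i<n. realize_B B \<alpha> $$ (i, l) * (mulv {..<n} (\<lambda>i j. realize_A A \<alpha> $$ (i, j)) ^^ k) z i) = 0"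
        unfolding adj[symmetric] z_def restr .
    qed simp
    have zF: "z i = 0" if "i \<in> F" for i using that by (simp add: z_def P_def)
    have iR: "i \<in> {..<n}" using i by (simp add: P_def)
    have "z i = 0" by (rule krylov_orthogonal_zero_on_R[OF A B sep o(1,3) fam o(4) K zF iR])
    then show "c i = 0" using i by (simp add: z_def)
  qed
  then obtain J' where J': "J' \<subseteq> J" "card J' = s" "inj_matrix J' P (M \<alpha>)"
    using inj_matrix_square_rows[of J P "M \<alpha>"] by (auto simp: J_def P_def s_def)
  have finJ': "finite J'" using J'(1) by (rule finite_subset) (simp add: J_def)
  obtain e where e: "bij_betw e {..<s} J'"
    using ex_bij_betw_nat_finite[OF finJ'] J'(2) by (auto simp: atLeast0LessThan)
  obtain g where g: "bij_betw g {..<s} P"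
    using ex_bij_betw_nat_finite[of P] by (auto simp: atLeast0LessThan s_def P_def)
  \<comment> \<open>The rows \<open>J'\<close>, pairs of a power and an input, are chosen at
    \<open>\<alpha>\<close> and then kept for all \<open>\<theta>\<close>.\<close>
  define f where "f \<theta> = det (mat s s (\<lambda>(a, b). M \<theta> (e a) (g b)))" for \<theta>
  have f_iff: "inj_matrix J' P (M \<theta>) \<longleftrightarrow> f \<theta> \<noteq> 0" for \<theta>
    unfolding f_def by (rule inj_matrix_iff_det[OF e g])
  have fpoly: "polynomial_in (pair_params A B) f"
    unfolding f_def
  proof (rule polynomial_in_det)
    fix a b assume ab: "a < s" "b < s"
    then have "e a \<in> J" "g b \<in> P" using e g J'(1) by (auto simp: bij_betw_def)
    then show "polynomial_in (pair_params A B) (\<lambda>\<theta>. M \<theta> (e a) (g b))"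
      unfolding M_def by (intro polynomial_in_krylov[OF A B]) (auto simp: J_def P_def)
  qed
  define \<rho> where "\<rho> \<theta> = vec_space.rank n (controllability_mat (realize_A A \<theta>) (realize_B B \<theta>))" for \<theta>
  have "(THE d. \<exists>V. proper_variety (pair_params A B) V \<and> (\<forall>\<theta>\<in>coord_space (pair_params A B) - V. \<rho> \<theta> = d)) = r"
  proof (rule generic_value_eq[OF _ fpoly \<alpha>])
    show "\<rho> \<theta> \<le> r" for \<theta>
      using controllable_rank_upper[OF A B, of \<theta>] max unfolding \<rho>_def by (meson le_trans)
    show "f \<alpha> \<noteq> 0" using J'(3) f_iff by blast
    fix \<theta> assume "f \<theta> \<noteq> 0"
    then have inj: "inj_matrix J' P (M \<theta>)" using f_iff by blast
    note AB = realize_A_carrier[OF A B, of \<theta>] realize_B_carrier[OF A B, of \<theta>]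
    let ?W = "controllable_subspace n (realize_A A \<theta>) (realize_B B \<theta>)"
    have unit: "(\<Sum>i<n. (if i = a then 1 else 0) * z i) = z a" if "a \<in> F" for a and z :: "nat \<Rightarrow> real"
    proof -
      have "(\<Sum>i<n. (if i = a then 1 else 0) * z i) = (\<Sum>i<n. if i = a then z i else 0)"
        by (intro sum.cong) auto
      then show ?thesis using that o(1) by auto
    qed
    have "n \<le> subspace_dim n ?W + card F"
    proof (rule subspace_dim_ge[where h = "\<lambda>a i. if i = a then 1 else 0"])
      show "subspace_of n ?W" by (rule controllable_subspace_of[OF AB realize_A_sym[OF A B]])
      show "finite F" by (rule finF)
      fix z assume zW: "\<And>w. w \<in> ?W \<Longrightarrow> (\<Sum>i<n. w $ i * z i) = 0"
        and zF: "\<And>a. a \<in> F \<Longrightarrow> (\<Sum>i<n. (if i = a then 1 else 0) * z i) = 0"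
      have z0: "z a = 0" if "a \<in> F" for a using zF[OF that] unit[OF that, of z] by simp
      have kry: "(\<Sum>i<n. M \<theta> (k, l) i * z i) = 0" if "l < m" for k l
        unfolding adj using orthogonal_controllable_iff[OF AB realize_A_sym[OF A B], of z] zW that by blast
      have "z i = 0" if "i \<in> P" for i
      proof (rule inj_matrixD[OF inj _ that])
        fix x assume "x \<in> J'"
        then obtain k l where x: "x = (k, l)" "l < m" using J'(1) by (auto simp: J_def)
        have "(\<Sum>i\<in>P. M \<theta> x i * z i) = (\<Sum>i<n. M \<theta> x i * z i)"
          using z0 by (intro sum.mono_neutral_left) (auto simp: P_def)
        then show "(\<Sum>i\<in>P. M \<theta> x i * z i) = 0" using kry[OF x(2)] x(1) by simp
      qed
      then show "\<forall>i<n. z i = 0" using z0 by (auto simp: P_def)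
    qed
    then have "s \<le> \<rho> \<theta>"
      using sF rank_controllability_mat[OF AB realize_A_sym[OF A B]] by (simp add: \<rho>_def)
    then show "r \<le> \<rho> \<theta>" using o(2) sF by simp
  qed
  then show ?thesis
    unfolding generic_controllable_dim_def pattern_dims(1)[OF A B] \<rho>_def .
qed

section \<open>Irreducible pairs\<close>

lemma entry_neq_Star: "x \<noteq> Star \<Longrightarrow> x = (0 :: entry)"
  by (cases x) (auto simp: zero_entry_def)

text \<open>The permutation lists \<open>R\<close> first. Symmetry of the pattern turns one
  vanishing off-diagonal block into two.\<close>

lemma separated_imp_block_form:
  assumes A: "sym_structured n A" and B: "B \<in> carrier_mat n m" and sep: "separated n m A B R" and "R \<noteq> {..<n}"
  shows "reducible n m A B"
proof -
  have R: "R \<subset> {..<n}" using sep assms(4) by (auto simp: separated_def)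
  then have finR: "finite R" using finite_subset by blast
  define p where "p = card R"
  have p: "p < n" using psubset_card_mono[OF _ R] by (simp add: p_def)
  obtain f where f: "bij_betw f {..<p} R"
    using ex_bij_betw_nat_finite[OF finR] by (auto simp: p_def atLeast0LessThan)
  have "card ({..<n} - R) = card {p..<n}" using R finR by (simp add: p_def card_Diff_subset)
  then obtain g where g: "bij_betw g {p..<n} ({..<n} - R)"
    by (metis bij_betw_iff_card finite_Diff finite_atLeastLessThan finite_lessThan)
  define \<pi> where "\<pi> i = (if i < p then f i else if i < n then g i else i)" for i
  have bf: "bij_betw \<pi> {..<p} R" using f by (rule bij_betw_cong[THEN iffD1, rotated]) (simp add: \<pi>_def)
  have bg: "bij_betw \<pi> {p..<n} ({..<n} - R)"
    using g by (rule bij_betw_cong[THEN iffD1, rotated]) (simp add: \<pi>_def)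
  have "bij_betw \<pi> ({..<p} \<union> {p..<n}) (R \<union> ({..<n} - R))" using bf bg by (rule bij_betw_combine) auto
  moreover have "{..<p} \<union> {p..<n} = {..<n}" "R \<union> ({..<n} - R) = {..<n}" using p R by auto
  ultimately have bij: "bij_betw \<pi> {..<n} {..<n}" by simp
  have perm: "\<pi> permutes {..<n}" using p by (intro bij_imp_permutes[OF bij]) (simp add: \<pi>_def)
  have inR: "\<pi> i \<in> R" if "i < p" for i using bf that by (auto simp: bij_betw_def)
  have notR: "\<pi> i \<in> {..<n} - R" if "p \<le> i" "i < n" for i
  proof -
    have "i \<in> {p..<n}" using that by simp
    then show ?thesis using bg unfolding bij_betw_def by blast
  qed
  note dims = pattern_dims[OF A B]
  have zero1: "A $$ (\<pi> i, \<pi> j) = 0" if "i < p" "p \<le> j" "j < n" for i j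
    using sep inR[OF that(1)] notR[OF that(2,3)] by (intro entry_neq_Star) (auto simp: separated_def)
  have zero2: "A $$ (\<pi> j, \<pi> i) = 0" if "i < p" "p \<le> j" "j < n" for i j
    using zero1[OF that] pattern_sym[OF A B, of "\<pi> i" "\<pi> j"] inR[OF that(1)] notR[OF that(2,3)] R by auto
  have zeroB: "B $$ (\<pi> j, l) = 0" if "p \<le> j" "j < n" "l < m" for j l
    using sep notR[OF that(1,2)] that(3) by (intro entry_neq_Star) (auto simp: separated_def)
  define A11 where "A11 = mat p p (\<lambda>(i, j). A $$ (\<pi> i, \<pi> j))"
  define A22 where "A22 = mat (n - p) (n - p) (\<lambda>(i, j). A $$ (\<pi> (p + i), \<pi> (p + j)))"
  define B1 where "B1 = mat p m (\<lambda>(i, l). B $$ (\<pi> i, l))"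
  have "perm_conj \<pi> A = four_block_mat A11 (0\<^sub>m p (n - p)) (0\<^sub>m (n - p) p) A22"
    using p by (intro eq_matI) (auto simp: perm_conj_def A11_def A22_def dims zero1 zero2)
  moreover have "perm_rows \<pi> B = B1 @\<^sub>r 0\<^sub>m (n - p) m"
    using p by (intro eq_matI) (auto simp: perm_rows_def B1_def dims zeroB append_rows_def)
  ultimately have "block_form n m p \<pi> A B A11 A22 B1"
    unfolding block_form_def using p perm by (simp add: A11_def A22_def B1_def)
  then show ?thesis unfolding reducible_def by blast
qed

text \<open>The states of a cut without outgoing edge form a separated proper subset, hence give a
  block form; an empty one is the case \<open>p = 0\<close>.\<close>

lemma irreducible_reaches:
  assumes A: "sym_structured n A" and B: "B \<in> carrier_mat n m" and irr: "\<not> reducible n m A B"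
  shows "reaches m A B {..<n}"
  unfolding reaches_def
proof (intro allI impI, rule ccontr)
  fix S assume S: "Input ` {..<m} \<subseteq> S" "S \<subset> Input ` {..<m} \<union> State ` {..<n}"
    and no: "\<not> (\<exists>x\<in>S. \<exists>y\<in>State ` {..<n} - S. star_edge A B x y)"
  define R where "R = {i. i < n \<and> State i \<in> S}"
  note dims = pattern_dims[OF A B]
  have "A $$ (i, j) \<noteq> Star" if "i \<in> R" "j < n" "j \<notin> R" for i j
  proof
    assume "A $$ (i, j) = Star"
    then have "star_edge A B (State i) (State j)" using that by (simp add: star_edge_def dims R_def)
    then show False using no that by (auto simp: R_def)
  qed
  moreover have "B $$ (i, l) \<noteq> Star" if "i < n" "i \<notin> R" "l < m" for i l
  proof
    assume "B $$ (i, l) = Star"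
    then have "star_edge A B (Input l) (State i)" using that by (simp add: star_edge_def dims)
    moreover have "Input l \<in> S" using S(1) that by auto
    ultimately show False using no that by (auto simp: R_def)
  qed
  ultimately have "separated n m A B R" unfolding separated_def by (auto simp: R_def)
  moreover have "R \<noteq> {..<n}"
  proof
    assume "R = {..<n}"
    then have "State ` {..<n} \<subseteq> S" by (auto simp: R_def)
    then show False using S by blast
  qed
  ultimately show False using separated_imp_block_form[OF A B] irr by blast
qed

text \<open>Both dimensions equal the largest row matching \<open>r\<close>: with all states in
  \<open>R\<close>, the independence set and the cycle family of the two bounds are empty.\<close>

lemma irreducible_case:
  assumes A: "sym_structured n A" and B: "B \<in> carrier_mat n m" and irr: "\<not> reducible n m A B"
  shows "m_dim A B = generic_controllable_dim A B"
proof -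
  have reach: "reaches m A B {..<n}" by (rule irreducible_reaches[OF assms])
  have sep: "separated n m A B {..<n}" by (simp add: separated_def)
  have bound: "k \<le> n" if "row_matching A B {..<n} k" for k
    using that card_mono[of "{..<n}"] unfolding row_matching_def by fastforce
  have "row_matching A B {..<n} 0" unfolding row_matching_def by (intro exI[of _ "{}"]) auto
  then obtain r where r: "row_matching A B {..<n} r" "\<And>k. row_matching A B {..<n} k \<Longrightarrow> k \<le> r"
    using ex_has_greatest_nat[of "row_matching A B {..<n}" 0 "\<lambda>k. k" "Suc n"] bound by (metis less_Suc_eq_le)
  have "m_dim A B + card ({} :: nat set) + card {..<n} \<le> r + n"
    by (rule m_dim_upper[OF A B sep]) (use r(2) in auto)
  moreover have "r + (\<Sum>c\<in>({} :: nat list set). (length c + 1) div 2) \<le> m_dim A B"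
    by (rule m_dim_lower[OF A B sep reach r(1), where \<D> = "{}"]) (simp add: cycle_family_def[OF A B])
  ultimately show ?thesis using generic_controllable_dim_eq[OF A B reach r] by simp
qed

section \<open>Reducible pairs\<close>

lemma awalk_verts_closed:
  assumes "pre_digraph.cas (with_proj G) u q v"
  shows "pre_digraph.awalk_verts (with_proj G) u q = u # map snd q"
    and "\<And>k. k < length q \<Longrightarrow> fst (q ! k) = (u # map snd q) ! k"
    and "(u # map snd q) ! length q = v"
  using assms
proof (induction q arbitrary: u)
  case Nil
  { case 1 then show ?case by (simp add: pre_digraph.awalk_verts.simps) }
  { case (2 k) then show ?case by simp }
  { case 3 then show ?case by (simp add: pre_digraph.cas.simps) }
next
  case (Cons e es)
  { case 1 then show ?case using Cons.IH(1)[of "snd e"] by (simp add: pre_digraph.awalk_verts.simps pre_digraph.cas.simps) }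
  { case (2 k) then show ?case using Cons.IH(2)[of "k - 1" "snd e"]
      by (cases k) (simp_all add: pre_digraph.cas.simps) }
  { case 3 then show ?case using Cons.IH(3)[of "snd e"] by (simp add: pre_digraph.cas.simps) }
qed

text \<open>The list consists of the heads of the arcs because \<open>cycle\<close> demands
  distinctness of the walk's vertices after the first; as the walk is closed, heads and tails run
  through the same set.\<close>

lemma cycle_vertex_list:
  assumes "pre_digraph.cycle (with_proj G) q"
  shows "map snd q \<noteq> []" "distinct (map snd q)" "set (map snd q) = cycle_verts q"
    and "k < length q \<Longrightarrow> (map snd q ! k, map snd q ! (Suc k mod length q)) \<in> parcs G"
proof -
  obtain u where u: "pre_digraph.awalk (with_proj G) u q u"
    "distinct (tl (pre_digraph.awalk_verts (with_proj G) u q))" "q \<noteq> []"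
    using assms unfolding pre_digraph.cycle_def by blast
  then have cas: "pre_digraph.cas (with_proj G) u q u" and arcs: "set q \<subseteq> parcs G"
    unfolding pre_digraph.awalk_def by simp_all
  note aw = awalk_verts_closed[OF cas]
  have pos: "0 < length q" using u(3) by simp
  have step: "fst (q ! (Suc k mod length q)) = map snd q ! k" if k: "k < length q" for k
  proof (cases "Suc k = length q")
    case True
    moreover have "fst (q ! 0) = u" using aw(2)[OF pos] by simp
    moreover have "map snd q ! k = u" using aw(3) unfolding True[symmetric] by simp
    ultimately show ?thesis by simp
  next
    case False
    then have "Suc k < length q" using k by simp
    then show ?thesis using aw(2)[of "Suc k"] by simp
  qed
  show "map snd q \<noteq> []" using u(3) by simp
  show "distinct (map snd q)" using u(2) by (simp add: aw(1))
  show "(map snd q ! k, map snd q ! (Suc k mod length q)) \<in> parcs G" if k: "k < length q"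
  proof -
    have m: "Suc k mod length q < length q" using pos by simp
    have "q ! (Suc k mod length q) = (map snd q ! k, map snd q ! (Suc k mod length q))"
      using step[OF k] m by (simp add: prod_eq_iff)
    then show ?thesis using arcs nth_mem[OF m] by auto
  qed
  show "set (map snd q) = cycle_verts q"
  proof
    show "set (map snd q) \<subseteq> cycle_verts q"
    proof
      fix a assume "a \<in> set (map snd q)"
      then obtain k where k: "k < length q" "a = map snd q ! k" by (auto simp: in_set_conv_nth)
      have "q ! (Suc k mod length q) \<in> set q" using pos by simp
      then show "a \<in> cycle_verts q"
        unfolding cycle_verts_def k(2) step[OF k(1), symmetric] by (rule imageI)
    qed
    show "cycle_verts q \<subseteq> set (map snd q)"
    proof
      fix a assume "a \<in> cycle_verts q"
      then obtain j where j: "j < length q" "a = fst (q ! j)" by (auto simp: cycle_verts_def in_set_conv_nth)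
      then have a: "a = (u # map snd q) ! j" using aw(2) by simp
      show "a \<in> set (map snd q)"
      proof (cases j)
        case 0
        then have "a = (u # map snd q) ! length q" using a aw(3) by simp
        then show ?thesis using pos by (cases "length q") (auto simp: nth_map)
      next
        case (Suc i)
        then show ?thesis using a j(1) by simp
      qed
    qed
  qed
qed

context
  fixes n m p :: nat and \<pi> :: "nat \<Rightarrow> nat" and A B A11 A22 B1 :: pattern
  assumes A: "sym_structured n A" and B: "B \<in> carrier_mat n m"
    and bf: "block_form n m p \<pi> A B A11 A22 B1"
begin

lemma block_dims: "p < n" "\<pi> permutes {..<n}" "A11 \<in> carrier_mat p p" "A22 \<in> carrier_mat (n - p) (n - p)"
  "B1 \<in> carrier_mat p m"
  using bf by (simp_all add: block_form_def)

lemma perm_lt: "\<pi> i < n \<longleftrightarrow> i < n"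
  using permutes_in_image[OF block_dims(2), of i] by simp

lemma perm_inv: "\<pi> (inv_into UNIV \<pi> i) = i" "inv_into UNIV \<pi> (\<pi> i) = i" "inv_into UNIV \<pi> i < n \<longleftrightarrow> i < n"
  using permutes_inverses[OF block_dims(2)] perm_lt[of "inv_into UNIV \<pi> i"] by simp_all

lemma perm_inj: "\<pi> i = \<pi> j \<longleftrightarrow> i = j"
  using permutes_inj[OF block_dims(2)] by (simp add: inj_eq)

lemma A_block_index:
  assumes "i < n" "j < n"
  shows "A $$ (\<pi> i, \<pi> j) = (if i < p then if j < p then A11 $$ (i, j) else 0
    else if j < p then 0 else A22 $$ (i - p, j - p))"
proof -
  have "A $$ (\<pi> i, \<pi> j) = perm_conj \<pi> A $$ (i, j)"
    using assms by (simp add: perm_conj_def pattern_dims[OF A B])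
  also have "\<dots> = four_block_mat A11 (0\<^sub>m p (n - p)) (0\<^sub>m (n - p) p) A22 $$ (i, j)"
    using bf by (simp add: block_form_def)
  finally show ?thesis using assms block_dims by auto
qed

lemma B_block_index:
  assumes "i < n" "l < m"
  shows "B $$ (\<pi> i, l) = (if i < p then B1 $$ (i, l) else 0)"
proof -
  have "B $$ (\<pi> i, l) = perm_rows \<pi> B $$ (i, l)"
    using assms by (simp add: perm_rows_def pattern_dims[OF A B])
  also have "\<dots> = (B1 @\<^sub>r 0\<^sub>m (n - p) m) $$ (i, l)"
    using bf by (simp add: block_form_def)
  finally show ?thesis using assms block_dims by (auto simp: append_rows_def)
qed

lemma mem_block: "i \<in> \<pi> ` {..<p} \<longleftrightarrow> inv_into UNIV \<pi> i < p"
proof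
  assume "i \<in> \<pi> ` {..<p}"
  then obtain j where "j < p" "i = \<pi> j" by blast
  then show "inv_into UNIV \<pi> i < p" by (simp add: perm_inv(2))
next
  assume "inv_into UNIV \<pi> i < p"
  then have "\<pi> (inv_into UNIV \<pi> i) \<in> \<pi> ` {..<p}" by simp
  then show "i \<in> \<pi> ` {..<p}" by (simp only: perm_inv(1))
qed

lemma block_rows_lt: "\<pi> ` {..<p} \<subseteq> {..<n}"
proof
  fix i assume "i \<in> \<pi> ` {..<p}"
  then obtain j where "j < p" "i = \<pi> j" by blast
  then show "i \<in> {..<n}" using perm_lt[of j] block_dims(1) by simp
qed

lemma card_block: "card (\<pi> ` {..<p}) = p"
  using card_image[of \<pi> "{..<p}"] by (simp add: inj_on_def perm_inj)

lemma block_separated: "separated n m A B (\<pi> ` {..<p})"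
  unfolding separated_def
proof (intro conjI ballI allI impI)
  show "\<pi> ` {..<p} \<subseteq> {..<n}" by (rule block_rows_lt)
next
  fix i j assume "i \<in> \<pi> ` {..<p}" "j < n" "j \<notin> \<pi> ` {..<p}"
  then have "inv_into UNIV \<pi> i < p" "inv_into UNIV \<pi> j < n" "\<not> inv_into UNIV \<pi> j < p" by (simp_all add: mem_block perm_inv)
  then have "A $$ (\<pi> (inv_into UNIV \<pi> i), \<pi> (inv_into UNIV \<pi> j)) = 0" using A_block_index[of "inv_into UNIV \<pi> i" "inv_into UNIV \<pi> j"] block_dims(1) by simp
  then show "A $$ (i, j) \<noteq> Star" by (simp add: perm_inv zero_entry_def)
next
  fix i l assume "i < n" "i \<notin> \<pi> ` {..<p}" "l < m"
  then have "inv_into UNIV \<pi> i < n" "\<not> inv_into UNIV \<pi> i < p" "l < m" by (simp_all add: mem_block perm_inv)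
  then have "B $$ (\<pi> (inv_into UNIV \<pi> i), l) = 0" using B_block_index[of "inv_into UNIV \<pi> i" l] by simp
  then show "B $$ (i, l) \<noteq> Star" by (simp add: perm_inv zero_entry_def)
qed

text \<open>Separation keeps arcs from leaving the block, so a cut without outgoing edge would be
  closed under all arcs. The path from an input to a missing state would then stay inside
  it.\<close>

lemma block_reaches:
  assumes reach: "\<And>i. i < p \<Longrightarrow> input_reachable A B (\<pi> i)"
  shows "reaches m A B (\<pi> ` {..<p})"
  unfolding reaches_def
proof (intro allI impI, rule ccontr)
  let ?R = "\<pi> ` {..<p}"
  fix S assume S: "Input ` {..<m} \<subseteq> S" "S \<subset> Input ` {..<m} \<union> State ` ?R"
    and no: "\<not> (\<exists>x\<in>S. \<exists>y\<in>State ` ?R - S. star_edge A B x y)"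
  obtain i where i: "i < p" "State (\<pi> i) \<notin> S" using S by auto
  note dims = pattern_dims[OF A B]
  obtain l where l: "l < m" "reachable (with_proj (pair_digraph A B)) (Input l) (State (\<pi> i))"
    using reach[OF i(1)] unfolding input_reachable_def dims by blast
  have closed: "b \<in> S" if a: "a \<in> S" and ab: "(a, b) \<in> parcs (pair_digraph A B)" for a b
  proof (rule ccontr)
    assume nb: "b \<notin> S"
    have e: "star_edge A B a b" "\<exists>k<n. b = State k"
      using ab pattern_sym[OF A B] by (auto simp: pair_digraph_def star_edge_def dims)
    then obtain k where k: "k < n" "b = State k" by blast
    have "k \<in> ?R"
    proof (cases a)
      case (State j)
      then have "j \<in> ?R" using a S(2) by auto
      moreover have "A $$ (j, k) = Star" using e(1) State k by (simp add: star_edge_def)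
      ultimately show ?thesis using block_separated k(1) unfolding separated_def by blast
    next
      case (Input q)
      then have "B $$ (k, q) = Star" "q < m" using e(1) k by (simp_all add: star_edge_def dims)
      then show ?thesis using block_separated k(1) unfolding separated_def by blast
    qed
    then show False using no a nb e(1) k(2) by blast
  qed
  have "State (\<pi> i) \<in> S"
    using l(2) unfolding reachable_def
  proof (induction rule: rtrancl_on_induct)
    case base
    then show ?case using S(1) l(1) by blast
  next
    case (step y z)
    then show ?case using closed[of y z] by simp
  qed
  then show False using i(2) by simp
qed

lemma append_cols_index:
  assumes "i < p" "j < p + m"
  shows "append_cols A11 B1 $$ (i, j) = (if j < p then A11 $$ (i, j) else B1 $$ (i, j - p))"
  using assms block_dims by (simp add: append_cols_def)

lemma append_cols_dims: "dim_row (append_cols A11 B1) = p" "dim_col (append_cols A11 B1) = p + m"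
  using block_dims by (simp_all add: append_cols_def)

definition is_transversal :: "nat \<Rightarrow> bool" where
  "is_transversal k \<longleftrightarrow> (\<exists>r c. inj_on r {..<k} \<and> inj_on c {..<k} \<and>
     (\<forall>l<k. r l < p \<and> c l < p + m \<and> append_cols A11 B1 $$ (r l, c l) = Star))"

lemma t_rank_transversal:
  "is_transversal (t_rank (append_cols A11 B1))"
  "is_transversal k \<Longrightarrow> k \<le> t_rank (append_cols A11 B1)"
proof -
  have eq: "t_rank (append_cols A11 B1) = Max {k. is_transversal k}"
    unfolding t_rank_def append_cols_dims is_transversal_def ..
  have "{k. is_transversal k} \<subseteq> {..p}"
  proof
    fix k assume "k \<in> {k. is_transversal k}"
    then obtain r where r: "inj_on r {..<k}" "r ` {..<k} \<subseteq> {..<p}" unfolding is_transversal_def by auto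
    then show "k \<in> {..p}" using card_inj_on_le[OF r] by simp
  qed
  then have fin: "finite {k. is_transversal k}" using finite_subset by blast
  have "is_transversal 0" by (simp add: is_transversal_def)
  then have "t_rank (append_cols A11 B1) \<in> {k. is_transversal k}" unfolding eq by (intro Max_in fin) blast
  then show "is_transversal (t_rank (append_cols A11 B1))" by simp
  show "k \<le> t_rank (append_cols A11 B1)" if "is_transversal k"
    unfolding eq using that by (intro Max_ge fin) simp
qed

lemma row_matching_imp_transversal:
  assumes "row_matching A B (\<pi> ` {..<p}) k"
  shows "is_transversal k"
proof -
  obtain I \<sigma> where I: "I \<subseteq> \<pi> ` {..<p}" "card I = k" "inj_on \<sigma> I" "\<And>i. i \<in> I \<Longrightarrow> star_edge A B (State i) (\<sigma> i)"
    using assms unfolding row_matching_def by blast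
  have "finite I" using I(1) by (rule finite_subset) simp
  then obtain e where e: "bij_betw e {..<k} I"
    using ex_bij_betw_nat_finite[of I] I(2) by (auto simp: atLeast0LessThan)
  \<comment> \<open>Column numbers in \<open>[A11, B1]\<close>: states first, in block order, then
    the inputs shifted by \<open>p\<close>.\<close>
  define col where "col v = (case v of State j \<Rightarrow> inv_into UNIV \<pi> j | Input q \<Rightarrow> p + q)" for v
  \<comment> \<open>The last clause keeps the two ranges of columns apart, for the injectivity
    argument below.\<close>
  have star: "inv_into UNIV \<pi> i < p \<and> col (\<sigma> i) < p + m \<and> append_cols A11 B1 $$ (inv_into UNIV \<pi> i, col (\<sigma> i)) = Star \<and>
      ((\<exists>j. \<sigma> i = State j) \<longleftrightarrow> col (\<sigma> i) < p)" if i: "i \<in> I" for i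
  proof -
    have ip: "inv_into UNIV \<pi> i < p" using I(1) i mem_block by blast
    then have i_n: "inv_into UNIV \<pi> i < n" using block_dims(1) by simp
    show ?thesis
    proof (cases "\<sigma> i")
      case (State j)
      then have j: "j < n" "A $$ (i, j) = Star" using I(4)[OF i] by (simp_all add: star_edge_def pattern_dims[OF A B])
      then have "A $$ (\<pi> (inv_into UNIV \<pi> i), \<pi> (inv_into UNIV \<pi> j)) = Star" "inv_into UNIV \<pi> j < n" by (simp_all add: perm_inv)
      then have "inv_into UNIV \<pi> j < p" "A11 $$ (inv_into UNIV \<pi> i, inv_into UNIV \<pi> j) = Star"
        using A_block_index[of "inv_into UNIV \<pi> i" "inv_into UNIV \<pi> j"] ip i_n by (auto simp: zero_entry_def split: if_splits)
      then show ?thesis using ip State by (simp add: col_def append_cols_index)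
    next
      case (Input q)
      then have q: "q < m" "B $$ (i, q) = Star" using I(4)[OF i] by (simp_all add: star_edge_def pattern_dims[OF A B])
      then have "B1 $$ (inv_into UNIV \<pi> i, q) = Star"
        using B_block_index[of "inv_into UNIV \<pi> i" q] ip i_n by (simp add: perm_inv)
      then show ?thesis using ip q Input by (simp add: col_def append_cols_index)
    qed
  qed
  have "inj_on (\<lambda>i. col (\<sigma> i)) I"
  proof (rule inj_onI)
    fix i j assume ij: "i \<in> I" "j \<in> I" "col (\<sigma> i) = col (\<sigma> j)"
    have "inv_into UNIV \<pi> a = inv_into UNIV \<pi> b \<longleftrightarrow> a = b" for a b
      by (metis perm_inv(1))
    moreover have "(\<exists>a. \<sigma> i = State a) \<longleftrightarrow> (\<exists>b. \<sigma> j = State b)"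
      using star[OF ij(1)] star[OF ij(2)] ij(3) by simp
    ultimately have "\<sigma> i = \<sigma> j"
      using ij(3) by (cases "\<sigma> i"; cases "\<sigma> j") (simp_all add: col_def)
    then show "i = j" using I(3) ij by (auto simp: inj_on_def)
  qed
  then have "inj_on (\<lambda>l. col (\<sigma> (e l))) {..<k}"
    using e comp_inj_on[of e "{..<k}" "\<lambda>i. col (\<sigma> i)"] by (simp add: bij_betw_def o_def)
  moreover have "inj_on (\<lambda>l. inv_into UNIV \<pi> (e l)) {..<k}"
    using e perm_inv(1) by (metis (no_types, lifting) bij_betw_def inj_on_def)
  moreover have "e l \<in> I" if "l < k" for l using e that by (auto simp: bij_betw_def)
  ultimately show ?thesis
    unfolding is_transversal_def using star
    by (intro exI[of _ "\<lambda>l. inv_into UNIV \<pi> (e l)"] exI[of _ "\<lambda>l. col (\<sigma> (e l))"]) simp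
qed

lemma transversal_imp_row_matching:
  assumes "is_transversal k"
  shows "row_matching A B (\<pi> ` {..<p}) k"
proof -
  obtain r c where rc: "inj_on r {..<k}" "inj_on c {..<k}"
    "\<And>l. l < k \<Longrightarrow> r l < p \<and> c l < p + m \<and> append_cols A11 B1 $$ (r l, c l) = Star"
    using assms unfolding is_transversal_def by blast
  define w where "w j = (if j < p then State (\<pi> j) else Input (j - p))" for j
  have w_inj: "w i = w j \<longleftrightarrow> i = j" for i j by (auto simp: w_def perm_inj)
  define e where "e l = \<pi> (r l)" for l
  have e_inj: "inj_on e {..<k}" using rc(1) by (auto simp: e_def inj_on_def perm_inj)
  define \<sigma> where "\<sigma> i = w (c (the_inv_into {..<k} e i))" for i
  have \<sigma>e: "\<sigma> (e l) = w (c l)" if "l < k" for l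
    using that by (simp add: \<sigma>_def the_inv_into_f_f[OF e_inj])
  have star: "star_edge A B (State (e l)) (\<sigma> (e l))" if l: "l < k" for l
  proof -
    have r: "r l < p" "r l < n" "append_cols A11 B1 $$ (r l, c l) = Star" "c l < p + m"
      using rc(3)[OF l] block_dims(1) by auto
    show ?thesis
    proof (cases "c l < p")
      case True
      then have "A $$ (\<pi> (r l), \<pi> (c l)) = Star" "c l < n"
        using r block_dims(1) by (simp_all add: A_block_index append_cols_index)
      then show ?thesis using True r unfolding \<sigma>e[OF l]
        by (simp add: w_def e_def star_edge_def pattern_dims[OF A B] perm_lt)
    next
      case False
      then have "B $$ (\<pi> (r l), c l - p) = Star" "c l - p < m"
        using r by (auto simp: B_block_index append_cols_index)
      then show ?thesis using False r unfolding \<sigma>e[OF l]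
        by (simp add: w_def e_def star_edge_def pattern_dims[OF A B] perm_lt)
    qed
  qed
  have "inj_on \<sigma> (e ` {..<k})"
  proof (rule inj_onI)
    fix i j assume "i \<in> e ` {..<k}" "j \<in> e ` {..<k}" "\<sigma> i = \<sigma> j"
    then obtain a b where "a < k" "b < k" "i = e a" "j = e b" "w (c a) = w (c b)" by (auto simp: \<sigma>e)
    then show "i = j" using rc(2) by (auto simp: w_inj inj_on_def)
  qed
  moreover have "card (e ` {..<k}) = k" using e_inj by (simp add: card_image)
  moreover have "e ` {..<k} \<subseteq> \<pi> ` {..<p}" using rc(3) by (auto simp: e_def)
  ultimately show ?thesis unfolding row_matching_def using star by (intro exI[of _ "e ` {..<k}"] exI[of _ \<sigma>]) auto
qed

text \<open>\<open>(L + 1) div 2\<close> merges the even and the odd contribution. The second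
  conclusion identifies the number of vertices of a cycle with its number of arcs, so parity may be
  read from either.\<close>

lemma reducible_lower:
  assumes reach: "\<And>i. i < p \<Longrightarrow> input_reachable A B (\<pi> i)" and C: "disjoint_cycles (mat_digraph A22) k C"
  shows "t_rank (append_cols A11 B1) + (\<Sum>i\<in>{1..k}. (card (cycle_verts (C i)) + 1) div 2) \<le> m_dim A B"
    and "i \<in> {1..k} \<Longrightarrow> card (cycle_verts (C i)) = length (C i)"
proof -
  define Q where "Q = {..<n} - \<pi> ` {..<p}"
  define f where "f j = \<pi> (p + j)" for j
  define D where "D i = map (\<lambda>e. f (snd e)) (C i)" for i
  have f_inj: "inj f" by (auto simp: f_def inj_on_def perm_inj)
  have cyc: "pre_digraph.cycle (with_proj (mat_digraph A22)) (C i)" if "i \<in> {1..k}" for i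
    using C that by (simp add: disjoint_cycles_def)
  note cv = cycle_vertex_list[OF cyc]
  have Dmap: "D i = map f (map snd (C i))" for i by (simp add: D_def)
  have Dset: "set (D i) = f ` cycle_verts (C i)" if "i \<in> {1..k}" for i
    unfolding Dmap using cv(3)[OF that] by (metis set_map)
  \<comment> \<open>Arcs run from column to row; symmetry of the pattern makes the direction
    immaterial.\<close>
  have edge: "state_edge A Q (f a) (f b)" if "(a, b) \<in> parcs (mat_digraph A22)" for a b
  proof -
    have ab: "a < n - p" "b < n - p" "A22 $$ (b, a) = Star"
      using that block_dims(4) by (auto simp: mat_digraph_def)
    then have lt: "p + a < n" "p + b < n" by auto
    then have "A $$ (f b, f a) = Star" using ab by (simp add: f_def A_block_index)
    then have "A $$ (f a, f b) = Star" using pattern_sym[OF A B, of "f a" "f b"] lt by (simp add: f_def perm_lt)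
    then show ?thesis using lt by (simp add: state_edge_def Q_def f_def mem_block perm_inv perm_lt)
  qed
  have Dcyc: "cycle_in (state_edge A Q) (D i)" if i: "i \<in> {1..k}" for i
    unfolding cycle_in_def
  proof (intro conjI allI impI)
    show "D i \<noteq> []" using cv(1)[OF i] by (simp add: D_def)
    show "distinct (D i)" unfolding Dmap distinct_map[of f] using cv(2)[OF i] inj_on_subset[OF f_inj subset_UNIV] by blast
    fix j assume "j < length (D i)"
    then have j: "j < length (C i)" "Suc j mod length (C i) < length (C i)"
      by (auto simp: D_def intro: mod_less_divisor)
    show "state_edge A Q (D i ! j) (D i ! (Suc j mod length (D i)))"
      using edge[OF cv(4)[OF i j(1)]] j by (simp add: D_def)
  qed
  have disj: "set (D i) \<inter> set (D j) = {}" if "i \<in> {1..k}" "j \<in> {1..k}" "i \<noteq> j" for i j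
  proof -
    have "cycle_verts (C i) \<inter> cycle_verts (C j) = {}" using C that unfolding disjoint_cycles_def by blast
    then show ?thesis unfolding Dset[OF that(1)] Dset[OF that(2)] using f_inj by (auto dest: injD)
  qed
  have D_inj: "inj_on D {1..k}"
  proof (rule inj_onI, rule ccontr)
    fix i j assume ij: "i \<in> {1..k}" "j \<in> {1..k}" "D i = D j" "i \<noteq> j"
    then have "set (D i) = {}" using disj[OF ij(1,2,4)] by simp
    then show False using Dcyc[OF ij(1)] by (simp add: cycle_in_def)
  qed
  have disjD: "set (D i) \<inter> set (D j) = {}" if "i \<in> {1..k}" "j \<in> {1..k}" "D i \<noteq> D j" for i j
    using disj[OF that(1,2)] that(3) by auto
  have fam: "cycle_family A Q (D ` {1..k})"
    unfolding cycle_family_def[OF A B] using Dcyc disjD by (simp add: ball_simps)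
  show len: "card (cycle_verts (C i)) = length (C i)" if "i \<in> {1..k}" for i
    unfolding cv(3)[OF that, symmetric] distinct_card[OF cv(2)[OF that]] by (rule length_map)
  have "t_rank (append_cols A11 B1) + (\<Sum>c\<in>D ` {1..k}. (length c + 1) div 2) \<le> m_dim A B"
    by (rule m_dim_lower[OF A B block_separated block_reaches[OF reach]
        transversal_imp_row_matching[OF t_rank_transversal(1)] fam[unfolded Q_def]])
  then show "t_rank (append_cols A11 B1) + (\<Sum>i\<in>{1..k}. (card (cycle_verts (C i)) + 1) div 2) \<le> m_dim A B"
    unfolding sum.reindex[OF D_inj] using len by (simp add: D_def)
qed

lemma reducible_upper:
  assumes S: "independence_set (mat_digraph A22) S"
  shows "m_dim A B + card S + p \<le> t_rank (append_cols A11 B1) + n"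
proof -
  define f where "f j = \<pi> (p + j)" for j
  have Sn: "s < n - p" if "s \<in> S" for s
    using S that block_dims(4) by (auto simp: independence_set_def mat_digraph_def)
  have no: "A22 $$ (i, j) \<noteq> Star" if "i \<in> S" "j \<in> S" for i j
  proof
    assume "A22 $$ (i, j) = Star"
    then have "(j, i) \<in> parcs (mat_digraph A22)" using Sn that block_dims(4) by (auto simp: mat_digraph_def)
    then show False using S that by (auto simp: independence_set_def)
  qed
  have "m_dim A B + card (f ` S) + card (\<pi> ` {..<p}) \<le> t_rank (append_cols A11 B1) + n"
  proof (rule m_dim_upper[OF A B block_separated])
    show "f ` S \<subseteq> {..<n} - \<pi> ` {..<p}"
    proof
      fix a assume "a \<in> f ` S"
      then obtain s where s: "s \<in> S" "a = \<pi> (p + s)" by (auto simp: f_def)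
      then have "p + s < n" using Sn[OF s(1)] by simp
      then show "a \<in> {..<n} - \<pi> ` {..<p}" using s(2) by (simp add: mem_block perm_inv perm_lt)
    qed
    fix i j assume "i \<in> f ` S" "j \<in> f ` S"
    then obtain s t where st: "s \<in> S" "t \<in> S" "i = \<pi> (p + s)" "j = \<pi> (p + t)" by (auto simp: f_def)
    then have "p + s < n" "p + t < n" using Sn[of s] Sn[of t] by auto
    then show "A $$ (i, j) \<noteq> Star" using no[OF st(1,2)] st by (simp add: A_block_index)
  next
    fix k assume "row_matching A B (\<pi> ` {..<p}) k"
    then show "k \<le> t_rank (append_cols A11 B1)"
      by (intro t_rank_transversal(2) row_matching_imp_transversal)
  qed
  moreover have "card (f ` S) = card S" by (intro card_image) (auto simp: f_def inj_on_def perm_inj)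
  ultimately show ?thesis by (simp add: card_block)
qed

end

theorem theorem2:
  fixes n m :: nat and A B :: pattern
  assumes "sym_structured n A" and "B \<in> carrier_mat n m"
  shows
    "(\<not> reducible n m A B \<longrightarrow> m_dim A B = generic_controllable_dim A B) \<and>
     (reducible n m A B \<longrightarrow>
       (\<forall>p \<pi> A11 A22 B1.
          block_form n m p \<pi> A B A11 A22 B1 \<and>
          (\<forall>i<n. i < p \<longleftrightarrow> input_reachable A B (\<pi> i)) \<longrightarrow>
          (\<forall>k C Se So.
             disjoint_cycles (mat_digraph A22) k C \<and>
             Se = {i \<in> {1..k}. even (length (C i))} \<and>
             So = {i \<in> {1..k}. odd (length (C i))} \<longrightarrow>
             real (m_dim A B) \<ge> real (t_rank (append_cols A11 B1))
               + 1/2 * (\<Sum>i\<in>Se. real (card (cycle_verts (C i))))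
               + 1/2 * (\<Sum>i\<in>So. real (card (cycle_verts (C i))) + 1)) \<and>
          (\<forall>S. maximal_independence_set (mat_digraph A22) S \<longrightarrow>
             int (m_dim A B) \<le> int (t_rank (append_cols A11 B1)) + (int n - int p) - int (card S))))"
proof (intro conjI impI allI)
  assume "\<not> reducible n m A B"
  then show "m_dim A B = generic_controllable_dim A B" by (rule irreducible_case[OF assms])
next
  fix p \<pi> A11 A22 B1 k C Se So
  assume "block_form n m p \<pi> A B A11 A22 B1 \<and> (\<forall>i<n. (i < p) = input_reachable A B (\<pi> i))"
    and "disjoint_cycles (mat_digraph A22) k C \<and> Se = {i \<in> {1..k}. even (length (C i))} \<and>
      So = {i \<in> {1..k}. odd (length (C i))}"
  then have bf: "block_form n m p \<pi> A B A11 A22 B1" and C: "disjoint_cycles (mat_digraph A22) k C"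
    and io: "\<forall>i<n. (i < p) = input_reachable A B (\<pi> i)"
    and Se: "Se = {i \<in> {1..k}. even (length (C i))}" and So: "So = {i \<in> {1..k}. odd (length (C i))}"
    by blast+
  have reach: "input_reachable A B (\<pi> i)" if "i < p" for i
  proof -
    have "i < n" using that block_dims(1)[OF assms bf] by simp
    then show ?thesis using io that by blast
  qed
  note low = reducible_lower[OF assms bf reach C]
  define L where "L i = card (cycle_verts (C i))" for i
  \<comment> \<open>The cycles are sorted by their number of arcs but summed by their number of
    vertices; the two agree.\<close>
  have SL: "Se = {i \<in> {1..k}. even (L i)}" "So = {i \<in> {1..k}. odd (L i)}"
    using low(2) by (auto simp: Se So L_def)
  have "real (\<Sum>i\<in>{1..k}. (L i + 1) div 2) =
      (\<Sum>i\<in>Se. real ((L i + 1) div 2)) + (\<Sum>i\<in>So. real ((L i + 1) div 2))"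
  proof -
    have "{1..k} = Se \<union> So" "Se \<inter> So = {}" by (auto simp: SL)
    moreover have "finite Se" "finite So" by (simp_all add: SL)
    ultimately show ?thesis by (simp add: sum.union_disjoint)
  qed
  also have "(\<Sum>i\<in>Se. real ((L i + 1) div 2)) = (\<Sum>i\<in>Se. 1/2 * real (L i))"
    by (intro sum.cong refl) (auto simp: SL elim!: evenE)
  also have "(\<Sum>i\<in>So. real ((L i + 1) div 2)) = (\<Sum>i\<in>So. 1/2 * (real (L i) + 1))"
    by (intro sum.cong refl) (auto simp: SL elim!: oddE)
  finally have "real (\<Sum>i\<in>{1..k}. (L i + 1) div 2) =
      1/2 * (\<Sum>i\<in>Se. real (L i)) + 1/2 * (\<Sum>i\<in>So. real (L i) + 1)"
    by (simp only: sum_distrib_left)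
  moreover have "real (t_rank (append_cols A11 B1)) + real (\<Sum>i\<in>{1..k}. (L i + 1) div 2) \<le> real (m_dim A B)"
    unfolding of_nat_add[symmetric] of_nat_le_iff L_def by (rule low(1))
  ultimately show "real (m_dim A B) \<ge> real (t_rank (append_cols A11 B1))
      + 1/2 * (\<Sum>i\<in>Se. real (card (cycle_verts (C i))))
      + 1/2 * (\<Sum>i\<in>So. real (card (cycle_verts (C i))) + 1)"
    unfolding L_def by linarith
next
  fix p \<pi> A11 A22 B1 S
  assume "block_form n m p \<pi> A B A11 A22 B1 \<and> (\<forall>i<n. (i < p) = input_reachable A B (\<pi> i))"
    and "maximal_independence_set (mat_digraph A22) S"
  then have bf: "block_form n m p \<pi> A B A11 A22 B1" and S: "independence_set (mat_digraph A22) S"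
    by (simp_all add: maximal_independence_set_def)
  from reducible_upper[OF assms bf S]
  show "int (m_dim A B) \<le> int (t_rank (append_cols A11 B1)) + (int n - int p) - int (card S)" by linarith
qed

end
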